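(* Let $T=(1,2,\ldots,d,t_d,\ldots,t_{\mathsf j},0)$ with $d\ge t_d\ge\cdots\ge t_{\mathsf j}>0$ be a Hilbert function of order $d$ and socle degree $\mathsf j$, and let $P$ be a partition of diagonal lengths $T$ that decomposes into single-block component partitions $P_d,\ldots,P_{\mathsf j}$. Then $P$ is special if and only if $P_i$ is special for some $i\in[d,\mathsf j]$.
   Context: Let $R=\mathsf k[x,y]$ with its standard grading, $\mathfrak m=(x,y)$, where the field $\mathsf k$ has characteristic zero, or is infinite of characteristic $p>\mathsf j$. For a partition $P=(p_1\ge\cdots\ge p_m)$ let $C_P$ be the set of monomials $x^ay^b$ with $0\le b<m$, $0\le a<p_{b+1}$ (Ferrers diagram: $x$-degree increases to the right, $y$-degree increases downwards), and $E_P$ the set of monomials not in $C_P$, and also the monomial ideal they generate. The diagonal lengths of $P$ is the Hilbert function of $R/E_P$. Put $t_{d-1}=d$, $t_{\mathsf j+1}=0$, $\delta_i=t_{i-1}-t_i$ for $d\le i\le\mathsf j+1$. Monomials of degree $i$ are ordered $x^i<x^{i-1}y<\cdots<y^i$ (lex; "first", "above" mean smaller $y$-degree). The initial monomial of a form is its monomial of highest $y$-degree with nonzero coefficient; $\mathrm{in}(I)$ is generated by the initial monomials of elements of $I$; the Jordan cell $\mathbb V(E_P)$ is the affine variety (an affine space) parametrizing all graded ideals $I\subset R$ with $\mathrm{in}(I)=E_P$. $\kappa(P)$ is the minimum number of generators of a generic ideal $I\in\mathbb V(E_P)$ (generic: in a suitable nonempty Zariski-open dense subset). $\mathrm G_T$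 is the irreducible projective variety parametrizing graded ideals $I\subset R$ such that $R/I$ has Hilbert function $T$, and $\kappa(T)$ is the minimum number of generators of a generic $I\in\mathrm G_T$. A partition $P$ of diagonal lengths $T$ is special if $\kappa(P)\neq\kappa(T)$ (and similarly for $P_i$, with $T_i$ in place of $T$). Component partitions. A monomial $x^ay^b\in E_P$ is a horizontal-border monomial if $b>0$ and $x^ay^{b-1}\notin E_P$; it is a vertical-border monomial if $a>0$ and $x^{a-1}y^b\notin E_P$. $A(P)_i$ is the set of degree-$i$ horizontal-border monomials. A degree-$i$ hand monomial is a degree-$i$ monomial $\nu\in C_P$ with $x\nu\in E_P$. For $d\le i\le\mathsf j$: $V_{i1}=A(P)_i$ if $x^i\in C_P$; if $x^i\notin C_P$, $V_{i1}=A(P)_i\cup\{x^ay^b\}$ where $x^ay^b$ is the last (lex) degree-$i$ vertical-border monomial lying above the first (lex) monomial of $A(P)_i$ (the condition "above" being vacuous if $A(P)_i=\emptyset$). $V_{i2}$ is the set of the first (lex) $\delta_{i+1}$ degree-$i$ hand monomials. With $d_i=\delta_i+\delta_{i+1}$, one has $|V_{i1}|=\delta_i+1$, $|V_{i1}\cup V_{i2}|=d_i+1$; let $s_i$ be the unique order-preserving bijection from $V_{i1}\cup V_{i2}$ to the set of degree-$d_i$ monomials of $R$. The component $P_i$ is the unique partition with $E_{P_i}=\langle s_i(V_{i1})\rangle+\mathfrak m^{d_i+1}$; its diagonal lengths are $T_i=(1,2,\ldots,d_i,\delta_{i+1},0)$. If $d_i=0$, then $P_i$ is the empty partition, $E_{P_i}=R$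 and $\kappa(P_i)=\kappa(T_i)=1$. *)

theory Defs
  imports "HOL-Analysis.Analysis" "HOL-Library.Poly_Mapping"
begin

section \<open>The graded ring \<open>k[x,y]\<close>\<close>

text \<open>The pair \<open>(a, b)\<close> stands for the monomial \<open>x\<^sup>a y\<^sup>b\<close>, so \<open>fst\<close> is its \<open>x\<close>-degree and \<open>snd\<close> its
  \<open>y\<close>-degree. On the monomials of one fixed degree, the order \<open>x\<^sup>i < x\<^sup>i\<^sup>-\<^sup>1y < \<dots> < y\<^sup>i\<close> is
  comparison of the \<open>y\<close>-degrees.\<close>

type_synonym mono = "nat \<times> nat"
type_synonym 'k bipoly = "mono \<Rightarrow>\<^sub>0 'k"

definition mdeg :: "mono \<Rightarrow> nat" where
  "mdeg \<mu> = fst \<mu> + snd \<mu>"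

definition monos_of_degree :: "nat \<Rightarrow> mono set" where
  "monos_of_degree n = {\<mu>. mdeg \<mu> = n}"

definition monomial :: "mono \<Rightarrow> 'k::field bipoly" where
  "monomial \<mu> = Poly_Mapping.single \<mu> 1"

definition scalar_mult :: "'k::field \<Rightarrow> 'k bipoly \<Rightarrow> 'k bipoly" where
  "scalar_mult c f = Poly_Mapping.single 0 c * f"

text \<open>The ideals of a commutative ring are its submodules, and \<open>ideal.span\<close> is the ideal generated
  by a set.\<close>

global_interpretation ideal: module "(*) :: 'a::comm_ring_1 \<Rightarrow> 'a \<Rightarrow> 'a"
  by unfold_locales (simp_all add: algebra_simps)

global_interpretation bipoly: vector_space "scalar_mult :: 'k::field \<Rightarrow> 'k bipoly \<Rightarrow> 'k bipoly"
  by unfold_locales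
    (simp_all add: scalar_mult_def distrib_left distrib_right mult.assoc [symmetric] mult_single
      single_add)

definition form_of_degree :: "nat \<Rightarrow> 'k::field bipoly \<Rightarrow> bool" where
  "form_of_degree n f \<longleftrightarrow> (\<forall>\<mu> \<in> Poly_Mapping.keys f. mdeg \<mu> = n)"

definition homogeneous_component :: "nat \<Rightarrow> 'k::field bipoly \<Rightarrow> 'k bipoly" where
  "homogeneous_component n f =
     (\<Sum>\<mu> \<in> {\<mu> \<in> Poly_Mapping.keys f. mdeg \<mu> = n}. Poly_Mapping.single \<mu> (Poly_Mapping.lookup f \<mu>))"

definition graded_ideal :: "'k::field bipoly set \<Rightarrow> bool" where
  "graded_ideal I \<longleftrightarrow> ideal.subspace I \<and> (\<forall>f \<in> I. \<forall>n. homogeneous_component n f \<in> I)"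

text \<open>The Hilbert function \<open>n \<mapsto> dim R\<^sub>n / I\<^sub>n\<close> of the quotient by a graded ideal.\<close>

definition hilbert_function :: "'k::field bipoly set \<Rightarrow> nat \<Rightarrow> nat" where
  "hilbert_function I n =
     bipoly.dim {f :: 'k bipoly. form_of_degree n f} - bipoly.dim {f \<in> I. form_of_degree n f}"

definition min_generators :: "'k::field bipoly set \<Rightarrow> nat" where
  "min_generators I = (LEAST n. \<exists>B. finite B \<and> card B = n \<and> ideal.span B = I)"

definition initial_ideal :: "'k::field bipoly set \<Rightarrow> 'k bipoly set" where
  "initial_ideal I = ideal.span {monomial \<mu> | \<mu> f n.
     f \<in> I \<and> form_of_degree n f \<and> \<mu> \<in> Poly_Mapping.keys f \<and>
     (\<forall>\<nu> \<in> Poly_Mapping.keys f. snd \<nu> \<le> snd \<mu>)}"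


section \<open>Zariski topologies and generic values\<close>

inductive_set polynomial_functions :: "(('i \<Rightarrow> 'k::field) \<Rightarrow> 'k) set" where
  const: "(\<lambda>v. c) \<in> polynomial_functions"
| coord: "(\<lambda>v. v i) \<in> polynomial_functions"
| add: "p \<in> polynomial_functions \<Longrightarrow> q \<in> polynomial_functions \<Longrightarrow> (\<lambda>v. p v + q v) \<in> polynomial_functions"
| mult: "p \<in> polynomial_functions \<Longrightarrow> q \<in> polynomial_functions \<Longrightarrow> (\<lambda>v. p v * q v) \<in> polynomial_functions"

definition affine_zariski :: "('i \<Rightarrow> 'k::field) topology" where
  "affine_zariski = topology_generated_by {{v. p v \<noteq> 0} | p. p \<in> polynomial_functions}"

text \<open>If the monomials in \<open>M\<close> form a basis of \<open>R/I\<close>, the ideal \<open>I\<close> is determined by the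
  coefficients that express every monomial \<open>\<mu>\<close>, modulo \<open>I\<close>, through the monomials \<open>\<nu>\<close> of \<open>M\<close>.
  In each degree these are the standard affine coordinates, on the chart given by \<open>M\<close>, of the
  point \<open>I\<^sub>n\<close> of the Grassmannian of \<open>R\<^sub>n\<close>. The coordinates with \<open>\<mu> \<in> M\<close> or with
  \<open>mdeg \<mu> \<noteq> mdeg \<nu>\<close> are constant.\<close>

definition monomial_basis :: "mono set \<Rightarrow> 'k::field bipoly set \<Rightarrow> bool" where
  "monomial_basis M I \<longleftrightarrow> (\<forall>f. \<exists>!g. Poly_Mapping.keys g \<subseteq> M \<and> f - g \<in> I)"

definition normal_form :: "mono set \<Rightarrow> 'k::field bipoly set \<Rightarrow> 'k bipoly \<Rightarrow> 'k bipoly" where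
  "normal_form M I f = (THE g. Poly_Mapping.keys g \<subseteq> M \<and> f - g \<in> I)"

definition coordinates :: "mono set \<Rightarrow> 'k::field bipoly set \<Rightarrow> mono \<times> mono \<Rightarrow> 'k" where
  "coordinates M I = (\<lambda>(\<mu>, \<nu>). Poly_Mapping.lookup (normal_form M I (monomial \<mu>)) \<nu>)"

definition G :: "(nat \<Rightarrow> nat) \<Rightarrow> 'k::field bipoly set set" where
  "G T = {I. graded_ideal I \<and> hilbert_function I = T}"

text \<open>The Zariski topology of \<open>G T\<close> as a subvariety of a product of Grassmannians, glued from the
  affine charts: its open sets are generated by the Zariski open sets of all charts.\<close>

definition G_topology :: "(nat \<Rightarrow> nat) \<Rightarrow> 'k::field bipoly set topology" where
  "G_topology T = topology_generated_by
     (\<Union>M. {U. openin (pullback_topology {I \<in> G T. monomial_basis M I} (coordinates M) affine_zariski) U})"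

text \<open>The value that \<open>f\<close> takes on a nonempty open dense subset. Two such subsets meet, hence the
  value is unique.\<close>

definition generic_value :: "'a topology \<Rightarrow> ('a \<Rightarrow> nat) \<Rightarrow> nat" where
  "generic_value X f = (THE n. \<exists>U. openin X U \<and> U \<noteq> {} \<and> X closure_of U = topspace X \<and> (\<forall>I \<in> U. f I = n))"

lemma generic_value_eqI:
  assumes U: "openin X U" "U \<noteq> {}" "X closure_of U = topspace X" "\<forall>I \<in> U. f I = n"
  shows "generic_value X f = n"
  unfolding generic_value_def
proof (rule the_equality)
  fix m
  assume "\<exists>U. openin X U \<and> U \<noteq> {} \<and> X closure_of U = topspace X \<and> (\<forall>I \<in> U. f I = m)"
  then obtain W where W: "openin X W" "W \<noteq> {}" "\<forall>I \<in> W. f I = m"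
    by blast
  then have "U \<inter> W \<noteq> {}"
    using U(3) dense_intersects_open by blast
  then show "m = n"
    using U(4) W(3) by auto
qed (use U in blast)


section \<open>Partitions and Jordan cells\<close>

definition is_partition :: "nat list \<Rightarrow> bool" where
  "is_partition P \<longleftrightarrow> sorted_wrt (\<ge>) P \<and> 0 \<notin> set P"

definition C :: "nat list \<Rightarrow> mono set" where
  "C P = {(a, b). b < length P \<and> a < P ! b}"

definition E :: "nat list \<Rightarrow> mono set" where
  "E P = - C P"

definition E_ideal :: "nat list \<Rightarrow> 'k::field bipoly set" where
  "E_ideal P = ideal.span (monomial ` E P)"

definition diagonal_lengths :: "'k::field itself \<Rightarrow> nat list \<Rightarrow> nat \<Rightarrow> nat" where
  "diagonal_lengths _ P = hilbert_function (E_ideal P :: 'k bipoly set)"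

definition jordan_cell :: "nat list \<Rightarrow> 'k::field bipoly set set" where
  "jordan_cell P = {I. graded_ideal I \<and> initial_ideal I = E_ideal P}"

text \<open>The whole cell lies in the chart given by \<open>C P\<close>; the coordinates of this chart embed it as a
  Zariski closed subset of an affine space.\<close>

definition cell_topology :: "nat list \<Rightarrow> 'k::field bipoly set topology" where
  "cell_topology P = pullback_topology (jordan_cell P) (coordinates (C P)) affine_zariski"

definition kappa_cell :: "'k::field itself \<Rightarrow> nat list \<Rightarrow> nat" where
  "kappa_cell _ P = generic_value (cell_topology P :: 'k bipoly set topology) min_generators"

definition kappa :: "'k::field itself \<Rightarrow> (nat \<Rightarrow> nat) \<Rightarrow> nat" where
  "kappa _ T = generic_value (G_topology T :: 'k bipoly set topology) min_generators"

text \<open>Only meant for a partition \<open>P\<close> of diagonal lengths \<open>T\<close>.\<close>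

definition special :: "'k::field itself \<Rightarrow> (nat \<Rightarrow> nat) \<Rightarrow> nat list \<Rightarrow> bool" where
  "special k T P \<longleftrightarrow> kappa_cell k P \<noteq> kappa k T"


section \<open>Component partitions\<close>

text \<open>\<open>T = (1, 2, \<dots>, d, t\<^sub>d, \<dots>, t\<^sub>j, 0)\<close> with \<open>d \<ge> t\<^sub>d \<ge> \<dots> \<ge> t\<^sub>j > 0\<close>. In particular \<open>T (d - 1) = d\<close>
  and \<open>T (j + 1) = 0\<close>, as required in \<open>\<delta>\<close> below.\<close>

definition hilbert_sequence :: "(nat \<Rightarrow> nat) \<Rightarrow> nat \<Rightarrow> nat \<Rightarrow> bool" where
  "hilbert_sequence T d j \<longleftrightarrow> 0 < d \<and> (\<forall>i<d. T i = i + 1) \<and> T d \<le> d \<and> (\<forall>i\<ge>d. T (i + 1) \<le> T i) \<and>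
     0 < T j \<and> (\<forall>i>j. T i = 0)"

definition \<delta> :: "(nat \<Rightarrow> nat) \<Rightarrow> nat \<Rightarrow> nat" where
  "\<delta> T i = T (i - 1) - T i"

definition horizontal_border :: "nat list \<Rightarrow> nat \<Rightarrow> mono set" where
  "horizontal_border P i = {(a, b). a + b = i \<and> (a, b) \<in> E P \<and> 0 < b \<and> (a, b - 1) \<notin> E P}"

definition vertical_border :: "nat list \<Rightarrow> nat \<Rightarrow> mono set" where
  "vertical_border P i = {(a, b). a + b = i \<and> (a, b) \<in> E P \<and> 0 < a \<and> (a - 1, b) \<notin> E P}"

definition hand_monos :: "nat list \<Rightarrow> nat \<Rightarrow> mono set" where
  "hand_monos P i = {(a, b). a + b = i \<and> (a, b) \<in> C P \<and> (a + 1, b) \<in> E P}"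

text \<open>A monomial lies above the first monomial of \<open>horizontal_border P i\<close> iff it lies above all of
  them; this includes the vacuous case of an empty border.\<close>

definition vertical_border_above :: "nat list \<Rightarrow> nat \<Rightarrow> mono set" where
  "vertical_border_above P i =
     {\<nu> \<in> vertical_border P i. \<forall>\<mu> \<in> horizontal_border P i. snd \<nu> < snd \<mu>}"

definition V1 :: "nat list \<Rightarrow> nat \<Rightarrow> mono set" where
  "V1 P i = (if (i, 0) \<in> C P then horizontal_border P i
     else horizontal_border P i \<union>
       {\<nu> \<in> vertical_border_above P i. \<forall>\<nu>' \<in> vertical_border_above P i. snd \<nu>' \<le> snd \<nu>})"

definition V2 :: "(nat \<Rightarrow> nat) \<Rightarrow> nat list \<Rightarrow> nat \<Rightarrow> mono set" where
  "V2 T P i =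
     {\<nu> \<in> hand_monos P i. card {\<nu>' \<in> hand_monos P i. snd \<nu>' < snd \<nu>} < \<delta> T (i + 1)}"

definition component_degree :: "(nat \<Rightarrow> nat) \<Rightarrow> nat \<Rightarrow> nat" where
  "component_degree T i = \<delta> T i + \<delta> T (i + 1)"

text \<open>\<open>T\<^sub>i = (1, 2, \<dots>, d\<^sub>i, \<delta>\<^sub>i\<^sub>+\<^sub>1, 0)\<close>. If \<open>d\<^sub>i = 0\<close> this is the zero function, so that
  \<open>G T\<^sub>i\<close> consists of the unit ideal, which has one generator.\<close>

definition component_T :: "(nat \<Rightarrow> nat) \<Rightarrow> nat \<Rightarrow> nat \<Rightarrow> nat" where
  "component_T T i n =
     (if n < component_degree T i then n + 1
      else if n = component_degree T i then \<delta> T (i + 1)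
      else 0)"

definition is_component ::
    "'k::field itself \<Rightarrow> (nat \<Rightarrow> nat) \<Rightarrow> nat list \<Rightarrow> nat \<Rightarrow> nat list \<Rightarrow> bool" where
  "is_component _ T P i Q \<longleftrightarrow> is_partition Q \<and>
     (\<exists>s. bij_betw s (V1 P i \<union> V2 T P i) (monos_of_degree (component_degree T i)) \<and>
          (\<forall>\<mu> \<in> V1 P i \<union> V2 T P i. \<forall>\<nu> \<in> V1 P i \<union> V2 T P i.
             snd \<mu> < snd \<nu> \<longrightarrow> snd (s \<mu>) < snd (s \<nu>)) \<and>
          (E_ideal Q :: 'k bipoly set) =
            ideal.span (monomial ` (s ` V1 P i \<union> monos_of_degree (component_degree T i + 1))))"

end

theory Submission
  imports Defs "HOL-Computational_Algebra.Polynomial"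
begin

text \<open>
  Setting \<open>x = 1\<close> turns a graded ideal \<open>I\<close> into an increasing sequence of subspaces
  \<open>W\<^sub>n \<subseteq> k[y]\<^sub>\<le>\<^sub>n\<close> with \<open>y W\<^sub>n \<subseteq> W\<^sub>n\<^sub>+\<^sub>1\<close>, and every such sequence comes from exactly one \<open>I\<close>.
  Nakayama's lemma then reads: the minimal number of generators is the sum over \<open>n\<close> of
  \<open>dim W\<^sub>n - dim (W\<^sub>n\<^sub>-\<^sub>1 + y W\<^sub>n\<^sub>-\<^sub>1)\<close> (\<open>min_generators_eq\<close>).

  \<^emph>\<open>The cell.\<close> That \<open>I\<close> lies in the Jordan cell of \<open>P\<close> means that the degrees of the nonzero elements
  of \<open>W\<^sub>n\<close> are the rows \<open>b\<close> with \<open>x\<^sup>n\<^sup>-\<^sup>by\<^sup>b \<in> E P\<close>. Let \<open>B\<^sub>n\<close> be the set of rows that occur in degree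
  \<open>n\<close> for the first time, and pick for every row \<open>b \<in> B\<^sub>n\<close> a monic \<open>g\<^sub>b \<in> W\<^sub>n\<close> of degree \<open>b\<close>. The ideal is
  then described by the relations \<open>y g\<^sub>b = g\<^sub>b\<^sub>+\<^sub>1 - \<Sum> a\<^sub>b\<^sub>c g\<^sub>c\<close>, where \<open>c \<le> b\<close> and \<open>c\<close> has occurred by degree
  \<open>n + 1\<close>; the coefficients \<open>a\<^sub>b\<^sub>c\<close> are arbitrary. So the cell is the image of an affine space.
  Multiplication by \<open>y\<close> from \<open>W\<^sub>n\<close> to \<open>W\<^sub>n\<^sub>+\<^sub>1 / W\<^sub>n\<close> is a matrix with rows \<open>B\<^sub>n\<close> and columns \<open>B\<^sub>n\<^sub>+\<^sub>1\<close>: the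
  entry at \<open>(b, c)\<close> is free for \<open>c \<le> b\<close>, is \<open>1\<close> for \<open>c = b + 1\<close> and \<open>0\<close> for \<open>c > b + 1\<close>, and different \<open>n\<close>
  involve different parameters. Its generic corank is the number of columns that a largest matching
  in this staircase pattern misses, which is the maximum over \<open>t\<close> of
  \<open>|{c \<in> B\<^sub>n\<^sub>+\<^sub>1. c \<ge> t}| - |{b \<in> B\<^sub>n. b + 1 \<ge> t}|\<close>. Below it is called the defect of \<open>(B\<^sub>n, B\<^sub>n\<^sub>+\<^sub>1)\<close>. Hence a
  generic ideal of the cell has, in degree \<open>n + 1\<close>, as many generators as this defect
  (\<open>generic_generators_le\<close>, \<open>exists_generic_generators\<close>, \<open>generic_value_degree_cell\<close>).

  \<^emph>\<open>The whole family.\<close> A generic linear substitution brings the initial monomials of an ideal into the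
  last position in every degree; this is the nonvanishing of a Wronskian, and it is here that the
  characteristic matters (\<open>sheared_no_low_degree\<close>). So the cell with these initial monomials is
  dense in \<open>G T\<close>, and \<open>\<kappa>(T)\<close> is its generic number of generators (\<open>generic_value_G\<close>). For this cell
  the defect has its least possible value, the truncated difference \<open>|B\<^sub>n\<^sub>+\<^sub>1| - |B\<^sub>n|\<close>. As \<open>T\<close> determines
  the cardinalities of all \<open>B\<^sub>n\<close>, the partition \<open>P\<close> is special iff for some \<open>n\<close> its defect exceeds this
  difference (\<open>special_iff_defect\<close>).

  \<^emph>\<open>Components.\<close> The condition is about one pair of consecutive degrees at a time. For
  \<open>n\<close> outside of \<open>{d..j}\<close> it never holds. For \<open>i \<in> {d..j}\<close> the component \<open>P\<^sub>i\<close> has only one interesting pair of degrees, whose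
  two sets have the cardinalities of \<open>B\<^sub>i\<close> and \<open>B\<^sub>i\<^sub>+\<^sub>1\<close> and the same defect: the maximum over \<open>t\<close> is
  attained at \<open>t = 0\<close> or next to a row that belongs to the component, and there the counts agree
  (\<open>staircase_defect_component\<close>).
\<close>

section \<open>Matchings in staircase patterns\<close>

text \<open>As a simplification rule for the ring itself, \<open>ideal.scale_scale\<close> is associativity from right to
  left, which loops with \<open>mult.assoc\<close> and \<open>algebra_simps\<close>.\<close>

declare ideal.scale_scale [simp del]

text \<open>In the pattern that admits the pairs \<open>(b, c)\<close> with \<open>c \<le> Suc b\<close>, the columns \<open>c \<ge> t\<close> can only be
  matched with rows \<open>b\<close> such that \<open>t \<le> Suc b\<close>. The truncated difference is therefore a lower bound
  for the number of unmatched columns.\<close>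

definition staircase_excess :: "nat set \<Rightarrow> nat set \<Rightarrow> nat \<Rightarrow> nat" where
  "staircase_excess B F t = card {c \<in> F. t \<le> c} - card {b \<in> B. t \<le> Suc b}"

definition staircase_defect :: "nat set \<Rightarrow> nat set \<Rightarrow> nat" where
  "staircase_defect B F = Max (range (staircase_excess B F))"

lemma finite_range_staircase_excess:
  assumes "finite F" shows "finite (range (staircase_excess B F))"
proof (rule finite_subset)
  show "range (staircase_excess B F) \<subseteq> {..card F}"
    using assms by (auto simp: staircase_excess_def intro!: le_trans[OF diff_le_self] card_mono)
qed simp

lemma staircase_excess_le_defect: "finite F \<Longrightarrow> staircase_excess B F t \<le> staircase_defect B F"
  unfolding staircase_defect_def by (rule Max_ge[OF finite_range_staircase_excess]) auto

lemma staircase_defect_attained: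
  assumes "finite F" obtains t where "staircase_defect B F = staircase_excess B F t"
  using Max_in[OF finite_range_staircase_excess[OF assms, of B]] unfolding staircase_defect_def by auto

lemma card_diff_le_staircase_defect: "finite F \<Longrightarrow> card F - card B \<le> staircase_defect B F"
  using staircase_excess_le_defect[of F B 0] by (simp add: staircase_excess_def)

text \<open>The bound given by the excess is sharp. Treat the columns in decreasing order: match \<open>c\<close> with the
  row \<open>b\<close> such that \<open>Suc b = c\<close> if there is one, and otherwise with any unused row \<open>b \<ge> c\<close>. The row
  \<open>b = c - 1\<close> cannot be used for a larger column, so it is still available. If \<open>c\<close> stays unmatched, all rows that
  could serve the columns \<open>\<ge> c\<close> are in use, so \<open>t = c\<close> shows that nothing was lost. The matching respects the
  pairs \<open>(b, Suc b)\<close> because in the application their matrix entries are the constant \<open>1\<close>.\<close>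

lemma exists_staircase_matching:
  fixes B F :: "nat set"
  assumes B: "finite B" and F: "finite F"
  obtains \<mu> R where "R \<subseteq> B" "inj_on \<mu> R" "\<mu> ` R \<subseteq> F" "\<And>b. b \<in> R \<Longrightarrow> \<mu> b \<le> Suc b"
    "\<And>b. b \<in> B \<Longrightarrow> Suc b \<in> F \<Longrightarrow> b \<in> R \<and> \<mu> b = Suc b"
    "card F - card R \<le> staircase_defect B F"
proof -
  have "\<exists>\<mu> R t. R \<subseteq> B \<and> inj_on \<mu> R \<and> \<mu> ` R \<subseteq> F \<and> (\<forall>b\<in>R. \<mu> b \<le> Suc b) \<and>
      (\<forall>b\<in>B. Suc b \<in> F \<longrightarrow> b \<in> R \<and> \<mu> b = Suc b) \<and>
      card F + card {b \<in> B. t \<le> Suc b} \<le> card R + card {c \<in> F. t \<le> c}"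
    using F
  proof (induction F rule: finite_linorder_min_induct)
    case empty
    obtain t where "\<forall>b\<in>B. Suc b < t"
      using B by (metis finite_nat_set_iff_bounded Suc_less_eq)
    then have "{b \<in> B. t \<le> Suc b} = {}" by fastforce
    then have "card {b \<in> B. t \<le> Suc b} = 0" by (simp only: card.empty)
    then show ?case
      by (intro exI[of _ id] exI[of _ "{}"] exI[of _ t]) auto
  next
    case (insert c F)
    then obtain \<mu> R t where IH: "R \<subseteq> B" "inj_on \<mu> R" "\<mu> ` R \<subseteq> F" "\<forall>b\<in>R. \<mu> b \<le> Suc b"
      "\<forall>b\<in>B. Suc b \<in> F \<longrightarrow> b \<in> R \<and> \<mu> b = Suc b"
      "card F + card {b \<in> B. t \<le> Suc b} \<le> card R + card {c \<in> F. t \<le> c}"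
      by auto
    have fR: "finite R" using IH(1) B finite_subset by auto
    have c: "c \<notin> F" using insert by auto
    have unused: "Suc b > c" if "b \<in> R" for b
      using that IH(3,4) insert by fastforce
    have mono: "card {c' \<in> F. t \<le> c'} \<le> card {c' \<in> insert c F. t \<le> c'}"
      using insert by (intro card_mono) auto
    consider (partner) b where "b \<in> B" "b \<notin> R" "c \<le> Suc b" "Suc b = c \<or> (\<forall>b'\<in>B. Suc b' \<noteq> c)"
      | (none) "\<forall>b\<in>B. c \<le> Suc b \<longrightarrow> b \<in> R"
    proof (cases "\<exists>b\<in>B. Suc b = c")
      case True
      then obtain b where "b \<in> B" "Suc b = c" by auto
      then show ?thesis using that(1)[of b] unused by force
    next
      case False
      then show ?thesis using that by blast
    qed
    then show ?case
    proof cases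
      case partner
      let ?\<mu> = "\<mu>(b := c)" and ?R = "insert b R"
      have "inj_on ?\<mu> ?R"
      proof -
        have "c \<notin> \<mu> ` R" using IH(3) c by auto
        then have "inj_on ?\<mu> R" "?\<mu> b \<notin> ?\<mu> ` (R - {b})"
          using IH(2) by (auto intro: inj_on_fun_updI)
        then show ?thesis by (simp only: inj_on_insert) blast
      qed
      moreover have "\<forall>b'\<in>B. Suc b' \<in> insert c F \<longrightarrow> b' \<in> ?R \<and> ?\<mu> b' = Suc b'"
        using IH(5) partner by auto
      moreover have "card (insert c F) + card {b \<in> B. t \<le> Suc b} \<le>
          card ?R + card {c' \<in> insert c F. t \<le> c'}"
        using IH(6) mono partner(2) fR c insert(1) by simp
      moreover have "?\<mu> ` ?R \<subseteq> insert c F" "\<forall>b'\<in>?R. ?\<mu> b' \<le> Suc b'"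
        using IH(3,4) partner by auto
      ultimately show ?thesis
        using IH(1) partner(1)
        by (intro exI[of _ ?\<mu>] exI[of _ ?R] exI[of _ t] conjI; (assumption | simp add: fun_upd_def))
    next
      case none
      have "{c' \<in> insert c F. c \<le> c'} = insert c F" using insert by auto
      moreover have "card {b \<in> B. c \<le> Suc b} \<le> card R"
        using none fR by (intro card_mono) auto
      moreover have "\<forall>b\<in>B. Suc b \<in> insert c F \<longrightarrow> b \<in> R \<and> \<mu> b = Suc b"
        using none unused IH(5) by fastforce
      ultimately show ?thesis
        using IH(1-4) by (intro exI[of _ \<mu>] exI[of _ R] exI[of _ c]) auto
    qed
  qed
  then obtain \<mu> R t where *: "R \<subseteq> B" "inj_on \<mu> R" "\<mu> ` R \<subseteq> F" "\<forall>b\<in>R. \<mu> b \<le> Suc b"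
      "\<forall>b\<in>B. Suc b \<in> F \<longrightarrow> b \<in> R \<and> \<mu> b = Suc b"
      "card F + card {b \<in> B. t \<le> Suc b} \<le> card R + card {c \<in> F. t \<le> c}"
    by auto
  have "card F - card R \<le> staircase_excess B F t"
    using *(6) unfolding staircase_excess_def by linarith
  also have "\<dots> \<le> staircase_defect B F"
    by (rule staircase_excess_le_defect[OF F])
  finally show ?thesis using that[of R \<mu>] *(1-5) by blast
qed

section \<open>Elimination over an algebra of functions\<close>

text \<open>Fraction-free elimination is needed both for polynomial functions of the coordinates of a chart
  and for polynomials in the parameter of a curve.\<close>

locale function_algebra =
  fixes \<P> :: "('p \<Rightarrow> 'k::field) set"
  assumes const_mem: "(\<lambda>a. c) \<in> \<P>"
    and add_mem: "p \<in> \<P> \<Longrightarrow> q \<in> \<P> \<Longrightarrow> (\<lambda>a. p a + q a) \<in> \<P>"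
    and mult_mem: "p \<in> \<P> \<Longrightarrow> q \<in> \<P> \<Longrightarrow> (\<lambda>a. p a * q a) \<in> \<P>"
begin

lemma uminus_mem: "p \<in> \<P> \<Longrightarrow> (\<lambda>a. - p a) \<in> \<P>"
  using mult_mem[OF const_mem, of p "- 1"] by simp

lemma diff_mem: "p \<in> \<P> \<Longrightarrow> q \<in> \<P> \<Longrightarrow> (\<lambda>a. p a - q a) \<in> \<P>"
  using add_mem[OF _ uminus_mem, of p q] by simp

lemma sum_mem: "(\<And>i. i \<in> A \<Longrightarrow> p i \<in> \<P>) \<Longrightarrow> (\<lambda>a. \<Sum>i\<in>A. p i a) \<in> \<P>"
  by (induction A rule: infinite_finite_induct) (auto simp: const_mem add_mem)

lemma prod_mem: "(\<And>i. i \<in> A \<Longrightarrow> p i \<in> \<P>) \<Longrightarrow> (\<lambda>a. \<Prod>i\<in>A. p i a) \<in> \<P>"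
  by (induction A rule: infinite_finite_induct) (auto simp: const_mem mult_mem)

lemmas closure = const_mem add_mem mult_mem uminus_mem diff_mem sum_mem prod_mem

text \<open>This replaces a nonvanishing minor and its adjugate matrix: if the rows \<open>v i\<close> are independent at
  \<open>a0\<close>, then pivot columns \<open>\<kappa> l\<close>, a denominator \<open>q\<close> with \<open>q a0 \<noteq> 0\<close> and a matrix \<open>M\<close> exist such that
  \<open>M v\<close> is \<open>q\<close> times the identity on the pivot columns. A new row \<open>i0\<close> is first cleared in the old pivot
  columns, which gives \<open>w\<close>; independence at \<open>a0\<close> yields a column \<open>k0\<close> where \<open>w\<close> does not vanish at
  \<open>a0\<close>, and \<open>w\<close> is used to clear \<open>k0\<close> in the other rows.\<close>

lemma fraction_free_inverse:
  fixes v :: "'r \<Rightarrow> 'c \<Rightarrow> 'p \<Rightarrow> 'k"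
  assumes A: "finite A"
    and v: "\<And>i k. i \<in> A \<Longrightarrow> k \<in> K \<Longrightarrow> v i k \<in> \<P>"
    and indep: "\<And>c. (\<And>k. k \<in> K \<Longrightarrow> (\<Sum>i\<in>A. c i * v i k a0) = 0) \<Longrightarrow> (\<And>i. i \<in> A \<Longrightarrow> c i = 0)"
  shows "\<exists>\<kappa> q M. inj_on \<kappa> A \<and> \<kappa> ` A \<subseteq> K \<and> q \<in> \<P> \<and> q a0 \<noteq> 0 \<and> (\<forall>l\<in>A. \<forall>i\<in>A. M l i \<in> \<P>) \<and>
     (\<forall>l\<in>A. \<forall>l'\<in>A. \<forall>a. (\<Sum>i\<in>A. M l i a * v i (\<kappa> l') a) = (if l = l' then q a else 0))"
  using A v indep
proof (induction A rule: finite_induct)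
  case empty
  show ?case by (intro exI[of _ undefined] exI[of _ "\<lambda>_. 1"]) (auto simp: const_mem)
next
  case (insert i0 A)
  have "\<exists>\<kappa> q M. inj_on \<kappa> A \<and> \<kappa> ` A \<subseteq> K \<and> q \<in> \<P> \<and> q a0 \<noteq> 0 \<and> (\<forall>l\<in>A. \<forall>i\<in>A. M l i \<in> \<P>) \<and>
     (\<forall>l\<in>A. \<forall>l'\<in>A. \<forall>a. (\<Sum>i\<in>A. M l i a * v i (\<kappa> l') a) = (if l = l' then q a else 0))"
  proof (rule insert.IH)
    fix c i assume c: "\<And>k. k \<in> K \<Longrightarrow> (\<Sum>i\<in>A. c i * v i k a0) = 0" and i: "i \<in> A"
    have "(\<Sum>i\<in>A. (c(i0 := 0)) i * v i k a0) = (\<Sum>i\<in>A. c i * v i k a0)" for k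
      using insert.hyps by (intro sum.cong) auto
    moreover have "(\<Sum>i\<in>insert i0 A. (c(i0 := 0)) i * v i k a0) = (\<Sum>i\<in>A. (c(i0 := 0)) i * v i k a0)" for k
      using insert.hyps by (subst sum.insert) (simp_all del: fun_upd_apply, simp)
    ultimately have "(\<Sum>i\<in>insert i0 A. (c(i0 := 0)) i * v i k a0) = 0" if "k \<in> K" for k
      using c that by metis
    from insert.prems(2)[OF this, of i] i have "(c(i0 := 0)) i = 0" by blast
    then show "c i = 0" using i insert.hyps by (auto split: if_splits)
  qed (use insert.prems(1) in auto)
  then obtain \<kappa> q M where "inj_on \<kappa> A" "\<kappa> ` A \<subseteq> K" "q \<in> \<P>" "q a0 \<noteq> 0"
    and M: "\<forall>l\<in>A. \<forall>i\<in>A. M l i \<in> \<P>"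
    "\<forall>l\<in>A. \<forall>l'\<in>A. \<forall>a. (\<Sum>i\<in>A. M l i a * v i (\<kappa> l') a) = (if l = l' then q a else 0)"
    by blast
  note IH = this(1-4) M(1)[rule_format] M(2)[rule_format]
  define \<omega> where "\<omega> i a = (if i = i0 then q a else - (\<Sum>l\<in>A. v i0 (\<kappa> l) a * M l i a))" for i a
  define u where "u l k a = (\<Sum>i\<in>A. M l i a * v i k a)" for l k a
  define w where "w k a = (\<Sum>i\<in>insert i0 A. \<omega> i a * v i k a)" for k a
  have w_eq: "w k a = q a * v i0 k a - (\<Sum>l\<in>A. v i0 (\<kappa> l) a * u l k a)" for k a
  proof -
    have "(\<Sum>i\<in>A. \<omega> i a * v i k a) = - (\<Sum>i\<in>A. \<Sum>l\<in>A. v i0 (\<kappa> l) a * M l i a * v i k a)"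
      unfolding sum_negf[symmetric]
      using insert.hyps by (intro sum.cong) (auto simp: \<omega>_def sum_distrib_right sum_negf)
    also have "(\<Sum>i\<in>A. \<Sum>l\<in>A. v i0 (\<kappa> l) a * M l i a * v i k a) =
        (\<Sum>l\<in>A. \<Sum>i\<in>A. v i0 (\<kappa> l) a * M l i a * v i k a)"
      by (rule sum.swap)
    also have "\<dots> = (\<Sum>l\<in>A. v i0 (\<kappa> l) a * u l k a)"
      unfolding u_def sum_distrib_left mult.assoc ..
    finally show ?thesis
      using insert.hyps by (simp add: w_def \<omega>_def)
  qed
  have w_pivot: "w (\<kappa> l) a = 0" if "l \<in> A" for l a
  proof -
    have "(\<Sum>l'\<in>A. v i0 (\<kappa> l') a * u l' (\<kappa> l) a) = (\<Sum>l'\<in>A. if l' = l then v i0 (\<kappa> l) a * q a else 0)"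
      using that by (intro sum.cong) (auto simp: u_def IH(6))
    then show ?thesis
      using that insert.hyps(1) by (simp add: w_eq)
  qed
  obtain k0 where k0: "k0 \<in> K" "w k0 a0 \<noteq> 0"
  proof -
    have "\<omega> i0 a0 \<noteq> 0" using IH(4) by (simp add: \<omega>_def)
    then show ?thesis
      using insert.prems(2)[of "\<lambda>i. \<omega> i a0" i0] that by (auto simp: w_def)
  qed
  have k0_new: "k0 \<notin> \<kappa> ` A" using w_pivot k0 by auto
  have \<omega>_mem: "\<omega> i \<in> \<P>" if "i \<in> insert i0 A" for i
  proof (cases "i = i0")
    case True
    then have "\<omega> i = q" by (auto simp: \<omega>_def)
    then show ?thesis using IH by simp
  next
    case False
    then have "\<omega> i = (\<lambda>a. - (\<Sum>l\<in>A. v i0 (\<kappa> l) a * M l i a))" by (auto simp: \<omega>_def)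
    then show ?thesis using IH False that insert.prems(1)
      by (auto intro!: closure)
  qed
  have w_mem: "w k \<in> \<P>" if "k \<in> K" for k
  proof -
    have "w k = (\<lambda>a. \<Sum>i\<in>insert i0 A. \<omega> i a * v i k a)" by (auto simp: w_def)
    then show ?thesis using \<omega>_mem insert.prems(1) that by (auto intro!: sum_mem mult_mem)
  qed
  have u_mem: "u l k \<in> \<P>" if "l \<in> A" "k \<in> K" for l k
  proof -
    have "u l k = (\<lambda>a. \<Sum>i\<in>A. M l i a * v i k a)" by (auto simp: u_def)
    then show ?thesis using IH insert.prems(1) that by (auto intro!: closure)
  qed
  define Mx where "Mx l i = (if i = i0 then (\<lambda>_. 0) else M l i)" for l i
  have Mx_mem: "Mx l i \<in> \<P>" if "l \<in> A" "i \<in> insert i0 A" for l i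
    using that IH(5) by (auto simp: Mx_def const_mem)
  define M' where "M' l i = (if l = i0 then (\<lambda>a. q a * \<omega> i a)
      else (\<lambda>a. w k0 a * Mx l i a - u l k0 a * \<omega> i a))" for l i
  have M'_mem: "M' l i \<in> \<P>" if "l \<in> insert i0 A" "i \<in> insert i0 A" for l i
  proof (cases "l = i0")
    case True
    then show ?thesis using that \<omega>_mem IH(3) by (simp add: M'_def mult_mem del: insert_iff)
  next
    case False
    then have "l \<in> A" using that by simp
    then show ?thesis
      using False that(2) by (simp add: M'_def diff_mem mult_mem Mx_mem \<omega>_mem w_mem u_mem k0(1) del: insert_iff)
  qed
  have row0: "(\<Sum>i\<in>insert i0 A. M' i0 i a * v i k a) = q a * w k a" for k a
    unfolding w_def sum_distrib_left by (simp only: M'_def simp_thms if_True mult.assoc)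
  have row: "(\<Sum>i\<in>insert i0 A. M' l i a * v i k a) = w k0 a * u l k a - u l k0 a * w k a"
    if "l \<in> A" for l k a
  proof -
    have "l \<noteq> i0" using that insert.hyps by auto
    then have "(\<Sum>i\<in>insert i0 A. M' l i a * v i k a) =
        (\<Sum>i\<in>insert i0 A. w k0 a * (Mx l i a * v i k a) - u l k0 a * (\<omega> i a * v i k a))"
      by (intro sum.cong refl) (simp add: M'_def left_diff_distrib mult.assoc)
    also have "\<dots> = w k0 a * (\<Sum>i\<in>insert i0 A. Mx l i a * v i k a) - u l k0 a * w k a"
      unfolding sum_subtractf sum_distrib_left[symmetric] w_def ..
    also have "(\<Sum>i\<in>insert i0 A. Mx l i a * v i k a) = u l k a"
      unfolding u_def using insert.hyps by (auto simp: Mx_def intro!: sum.cong)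
    finally show ?thesis .
  qed
  let ?\<kappa> = "\<kappa>(i0 := k0)"
  have "(\<Sum>i\<in>insert i0 A. M' l i a * v i (?\<kappa> l') a) = (if l = l' then q a * w k0 a else 0)"
    if "l \<in> insert i0 A" "l' \<in> insert i0 A" for l l' a
  proof (cases "l = i0")
    case True
    then show ?thesis using that row0 w_pivot insert.hyps by (auto simp del: sum.insert)
  next
    case False
    then have l: "l \<in> A" using that by auto
    show ?thesis
    proof (cases "l' = i0")
      case True
      then show ?thesis using l False by (simp add: row del: sum.insert)
    next
      case l': False
      then have "l' \<in> A" using that by auto
      then have "u l (\<kappa> l') a = (if l = l' then q a else 0)" using l IH(6) by (simp add: u_def)
      then show ?thesis using l l' \<open>l' \<in> A\<close> by (simp add: row w_pivot del: sum.insert)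
    qed
  qed
  moreover have "inj_on ?\<kappa> (insert i0 A)"
    using IH(1) k0_new insert.hyps by (auto simp: inj_on_def)
  moreover have "?\<kappa> ` insert i0 A \<subseteq> K" using IH(2) k0(1) by auto
  moreover have "(\<lambda>a. q a * w k0 a) \<in> \<P>" using IH(3) w_mem k0(1) by (intro closure)
  moreover have "q a0 * w k0 a0 \<noteq> 0" using IH(4) k0 by simp
  ultimately show ?case
    using M'_mem by (intro exI[of _ ?\<kappa>] exI[of _ "\<lambda>a. q a * w k0 a"] exI[of _ M']) blast
qed

end

section \<open>Dimension counts in vector spaces\<close>

context vector_space
begin

lemma independent_family:
  fixes u :: "'r \<Rightarrow> 'b"
  assumes S: "finite S"
    and zero: "\<And>c s. (\<Sum>s\<in>S. scale (c s) (u s)) = 0 \<Longrightarrow> s \<in> S \<Longrightarrow> c s = 0"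
  shows "inj_on u S" "independent (u ` S)"
proof -
  show inj: "inj_on u S"
  proof (rule inj_onI, rule ccontr)
    fix s t assume st: "s \<in> S" "t \<in> S" "u s = u t" "s \<noteq> t"
    let ?c = "\<lambda>r. if r = s then (1::'a) else if r = t then - 1 else 0"
    have "(\<Sum>r\<in>S. scale (?c r) (u r)) = (\<Sum>r\<in>{s,t}. scale (?c r) (u r))"
      using st S by (intro sum.mono_neutral_right) auto
    also have "\<dots> = 0" using st by simp
    finally have *: "(\<Sum>r\<in>S. scale (?c r) (u r)) = 0" .
    from zero[of ?c s, OF * st(1)] show False by simp
  qed
  show "independent (u ` S)"
  proof (rule independent_if_scalars_zero)
    fix f x assume f: "(\<Sum>x\<in>u ` S. scale (f x) x) = 0" and "x \<in> u ` S"
    then have "(\<Sum>s\<in>S. scale (f (u s)) (u s)) = 0" by (simp only: sum.reindex[OF inj] o_def)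
    then show "f x = 0" using zero[of "\<lambda>s. f (u s)"] \<open>x \<in> u ` S\<close> by auto
  qed (use S in auto)
qed

text \<open>The dimension count behind Nakayama's lemma, in a space that need not have finite dimension:
  representatives of the elements of \<open>S\<close> in the span of \<open>B\<close> modulo \<open>Q\<close> stay independent.\<close>

lemma card_le_of_independent_modulo:
  assumes Q: "subspace Q" and B: "finite B" and S: "independent S" "finite S"
    and cover: "\<And>s. s \<in> S \<Longrightarrow> \<exists>u \<in> span B. s - u \<in> Q"
    and disj: "span S \<inter> Q \<subseteq> {0}"
  shows "card S \<le> card B"
proof -
  obtain u where u: "\<And>s. s \<in> S \<Longrightarrow> u s \<in> span B" "\<And>s. s \<in> S \<Longrightarrow> s - u s \<in> Q"
    using cover by metis
  have zero: "c s = 0" if c: "(\<Sum>s\<in>S. scale (c s) (u s)) = 0" and "s \<in> S" for c s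
  proof -
    have "(\<Sum>s\<in>S. scale (c s) s) = (\<Sum>s\<in>S. scale (c s) (s - u s))"
      using c by (simp add: scale_right_diff_distrib sum_subtractf)
    also have "\<dots> \<in> Q" using u by (intro subspace_sum[OF Q] subspace_scale[OF Q]) auto
    finally have "(\<Sum>s\<in>S. scale (c s) s) \<in> Q" .
    moreover have "(\<Sum>s\<in>S. scale (c s) s) \<in> span S"
      by (intro span_sum span_scale span_base)
    ultimately have "(\<Sum>s\<in>S. scale (c s) s) = 0" using disj by auto
    then show ?thesis using independentD[OF S(1) S(2) subset_refl] that by auto
  qed
  have ind: "inj_on u S" "independent (u ` S)"
    by (rule independent_family[OF S(2)], rule zero, assumption+)+
  have "card (u ` S) \<le> card B"
    using independent_span_bound[OF B ind(2)] u by auto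
  then show ?thesis using card_image[OF ind(1)] by simp
qed

end

lemma (in vector_space) dim_mono_of_finite:
  assumes "V \<subseteq> W" "W \<subseteq> span B" "finite B"
  shows "dim V \<le> dim W"
proof -
  obtain BV where BV: "BV \<subseteq> V" "independent BV" "V \<subseteq> span BV" "card BV = dim V"
    using basis_exists by blast
  obtain BW where BW: "BW \<subseteq> W" "independent BW" "W \<subseteq> span BW" "card BW = dim W"
    using basis_exists by blast
  have "finite BW" using independent_span_bound[OF assms(3) BW(2)] BW(1) assms(2) by auto
  then have "card BV \<le> card BW" using independent_span_bound[OF _ BV(2)] BV(1) assms(1) BW(3) by blast
  then show ?thesis using BV BW by simp
qed

lemma (in vector_space) subspace_eq_of_dim_eq:
  assumes "subspace V" "V \<subseteq> W" "W \<subseteq> span B" "finite B" "dim W \<le> dim V"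
  shows "V = W"
proof -
  obtain BV where BV: "BV \<subseteq> V" "independent BV" "V \<subseteq> span BV" "card BV = dim V"
    using basis_exists by blast
  obtain BW where BW: "BV \<subseteq> BW" "BW \<subseteq> W" "independent BW" "W \<subseteq> span BW"
    using maximal_independent_subset_extend[of BV W] BV assms by blast
  have f: "finite BW" using independent_span_bound[OF assms(4) BW(3)] BW(2) assms(3) by auto
  have "card BW = dim W" using BW by (intro basis_card_eq_dim) auto
  then have "BV = BW" using BV(4) BW(1) f assms(5) by (intro card_seteq) auto
  then have "W \<subseteq> span BV" using BW by simp
  also have "\<dots> \<subseteq> V" using BV assms(1) by (intro span_minimal)
  finally show ?thesis using assms(2) by auto
qed

lemma (in vector_space) exists_complement_basis:
  assumes S: "subspace S" "S \<subseteq> W" and W: "subspace W" "W \<subseteq> span F" "finite F"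
  obtains B where "B \<subseteq> W" "independent B" "finite B" "card B = dim W - dim S" "span B \<inter> S = {0}"
    "W \<subseteq> span (S \<union> B)"
proof -
  obtain BS where BS: "BS \<subseteq> S" "independent BS" "S \<subseteq> span BS" "card BS = dim S"
    using basis_exists by blast
  obtain BW where BW: "BS \<subseteq> BW" "BW \<subseteq> W" "independent BW" "W \<subseteq> span BW"
    using maximal_independent_subset_extend[of BS W] BS S by blast
  have f: "finite BW" using independent_span_bound[OF W(3) BW(3)] BW(2) W(2) by auto
  have cW: "card BW = dim W" using BW by (intro basis_card_eq_dim) auto
  have c: "card (BW - BS) = dim W - dim S"
    using card_Diff_subset[of BS BW] BW(1) f cW BS(4) finite_subset by auto
  have spanS: "span BS = S" using BS S(1) span_subspace by auto
  have "x = 0" if x: "x \<in> span (BW - BS)" "x \<in> span BS" for x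
  proof -
    have r: "representation BW x = representation (BW - BS) x"
      using representation_extend[OF BW(3) x(1)] by auto
    have r': "representation BW x = representation BS x"
      using representation_extend[OF BW(3) x(2) BW(1)] by auto
    have "representation BW x b = 0" for b
      using representation_ne_zero[of "BW - BS" x b] representation_ne_zero[of BS x b] r r' by auto
    moreover have "x \<in> span BW" using x(2) span_mono[OF BW(1)] by auto
    ultimately show ?thesis using sum_nonzero_representation_eq[OF BW(3), of x] by simp
  qed
  then have disj: "span (BW - BS) \<inter> S = {0}" using spanS S(1) subspace_0 span_zero by blast
  have "W \<subseteq> span (S \<union> (BW - BS))"
    using BS(1) by (intro subset_trans[OF BW(4)] span_mono) blast
  moreover have "independent (BW - BS)" using BW(3) by (rule independent_mono) blast
  moreover have "BW - BS \<subseteq> W" "finite (BW - BS)" using BW(2) f by auto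
  ultimately show ?thesis using c disj by (intro that)
qed

section \<open>Dehomogenization\<close>

global_interpretation pv: vector_space "smult :: 'k::field \<Rightarrow> 'k poly \<Rightarrow> 'k poly"
  by unfold_locales (simp_all add: smult_add_right smult_add_left)

lemma degree_le_subset_span: "{g :: 'k::field poly. degree g \<le> n} \<subseteq> pv.span (monom 1 ` {..n})"
proof clarify
  fix g :: "'k poly" assume "degree g \<le> n"
  then have "g = (\<Sum>i\<le>n. monom (coeff g i) i)"
    by (simp add: poly_as_sum_of_monoms')
  also have "\<dots> = (\<Sum>i\<le>n. smult (coeff g i) (monom 1 i))" by (simp add: smult_monom)
  also have "\<dots> \<in> pv.span (monom 1 ` {..n})"
    by (intro pv.span_sum pv.span_scale pv.span_base) auto
  finally show "g \<in> pv.span (monom 1 ` {..n})" .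
qed

lemma subspace_degree_le: "pv.subspace {g :: 'k::field poly. degree g \<le> n}"
  by (auto simp: pv.subspace_def intro: degree_add_le)

lemma subspace_pCons_vimage:
  assumes "pv.subspace V" shows "pv.subspace {g. pCons 0 g \<in> V}"
proof -
  have "pCons 0 (x + y) = pCons 0 x + pCons 0 y" "pCons 0 (smult c x) = smult c (pCons 0 x)" for x y :: "'a poly" and c
    by auto
  then show ?thesis using assms unfolding pv.subspace_def by (simp del: add_pCons smult_pCons)
qed

text \<open>Setting \<open>x = 1\<close> in the component of degree \<open>n\<close>; the remaining variable \<open>y\<close> is the variable of
  \<open>'k poly\<close>. Multiplication by \<open>x\<close> becomes the inclusion of polynomials of degree at most \<open>n\<close> in those of degree at most
  \<open>Suc n\<close>, multiplication by \<open>y\<close> becomes \<open>pCons 0\<close>, and the initial monomial becomes the degree.\<close>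

definition dehomogenize :: "nat \<Rightarrow> 'k::field bipoly \<Rightarrow> 'k poly" where
  "dehomogenize n f = (\<Sum>i\<le>n. monom (Poly_Mapping.lookup f (n - i, i)) i)"

definition homogenize :: "nat \<Rightarrow> 'k::field poly \<Rightarrow> 'k bipoly" where
  "homogenize n g = (\<Sum>i\<le>n. Poly_Mapping.single (n - i, i) (coeff g i))"

lemma coeff_dehomogenize:
  "coeff (dehomogenize n f) i = (if i \<le> n then Poly_Mapping.lookup f (n - i, i) else 0)"
  by (simp add: dehomogenize_def coeff_sum if_distrib sum.delta cong: if_cong)

lemma lookup_homogenize:
  "Poly_Mapping.lookup (homogenize n g) \<mu> = (if mdeg \<mu> = n then coeff g (snd \<mu>) else 0)"
proof -
  have "Poly_Mapping.lookup (homogenize n g) \<mu> = (\<Sum>i\<le>n. if i = snd \<mu> then (if mdeg \<mu> = n then coeff g i else 0) else 0)"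
    unfolding homogenize_def lookup_sum
    by (intro sum.cong refl) (auto simp: lookup_single mdeg_def when_def prod_eq_iff)
  also have "\<dots> = (if mdeg \<mu> = n then coeff g (snd \<mu>) else 0)"
    by (auto simp: sum.delta mdeg_def)
  finally show ?thesis .
qed

lemma lookup_homogeneous_component:
  "Poly_Mapping.lookup (homogeneous_component n f) \<mu> = (if mdeg \<mu> = n then Poly_Mapping.lookup f \<mu> else 0)"
proof -
  have "Poly_Mapping.lookup (homogeneous_component n f) \<mu> =
      (\<Sum>\<nu>\<in>{\<nu> \<in> Poly_Mapping.keys f. mdeg \<nu> = n}. if \<nu> = \<mu> then Poly_Mapping.lookup f \<nu> else 0)"
    unfolding homogeneous_component_def lookup_sum
    by (intro sum.cong refl) (auto simp: lookup_single when_def)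
  then show ?thesis by (auto simp: sum.delta in_keys_iff)
qed

lemma degree_dehomogenize: "degree (dehomogenize n f) \<le> n"
  by (rule degree_le) (simp add: coeff_dehomogenize)

lemma lookup_scalar_mult: "Poly_Mapping.lookup (scalar_mult c f) \<mu> = c * Poly_Mapping.lookup f \<mu>"
  unfolding scalar_mult_def mult_map_scale_conv_mult[symmetric] by (simp add: Poly_Mapping.map.rep_eq when_def)

lemma dehomogenize_add: "dehomogenize n (f + g) = dehomogenize n f + dehomogenize n g"
  by (rule poly_eqI) (simp add: coeff_dehomogenize lookup_add)

lemma dehomogenize_diff: "dehomogenize n (f - g) = dehomogenize n f - dehomogenize n g"
  by (rule poly_eqI) (simp add: coeff_dehomogenize lookup_minus)

lemma dehomogenize_0 [simp]: "dehomogenize n 0 = 0"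
  by (rule poly_eqI) (simp add: coeff_dehomogenize)

lemma dehomogenize_sum: "dehomogenize n (\<Sum>i\<in>A. f i) = (\<Sum>i\<in>A. dehomogenize n (f i))"
  by (induction A rule: infinite_finite_induct) (simp_all add: dehomogenize_add)

lemma dehomogenize_scalar_mult: "dehomogenize n (scalar_mult c f) = smult c (dehomogenize n f)"
  by (rule poly_eqI) (simp add: coeff_dehomogenize lookup_scalar_mult)

lemma homogenize_add: "homogenize n (f + g) = homogenize n f + homogenize n g"
  by (rule poly_mapping_eqI) (simp add: lookup_homogenize lookup_add)

lemma homogenize_diff: "homogenize n (f - g) = homogenize n f - homogenize n g"
  by (rule poly_mapping_eqI) (simp add: lookup_homogenize lookup_minus)

lemma homogenize_0 [simp]: "homogenize n 0 = 0"
  by (rule poly_mapping_eqI) (simp add: lookup_homogenize)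

lemma homogenize_smult: "homogenize n (smult c g) = scalar_mult c (homogenize n g)"
  by (rule poly_mapping_eqI) (simp add: lookup_homogenize lookup_scalar_mult)

lemma dehomogenize_homogenize: "degree g \<le> n \<Longrightarrow> dehomogenize n (homogenize n g) = g"
  by (rule poly_eqI) (auto simp: coeff_dehomogenize lookup_homogenize mdeg_def coeff_eq_0)

lemma dehomogenize_homogenize_other: "m \<noteq> n \<Longrightarrow> dehomogenize m (homogenize n g) = 0"
  by (rule poly_eqI) (auto simp: coeff_dehomogenize lookup_homogenize mdeg_def)

lemma homogenize_dehomogenize: "homogenize n (dehomogenize n f) = homogeneous_component n f"
  by (rule poly_mapping_eqI)
    (auto simp: lookup_homogenize coeff_dehomogenize lookup_homogeneous_component mdeg_def)

lemma homogenize_monom: "b \<le> n \<Longrightarrow> homogenize n (monom 1 b) = monomial (n - b, b)"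
  by (rule poly_mapping_eqI)
    (auto simp: lookup_homogenize monomial_def lookup_single when_def mdeg_def prod_eq_iff)

lemma form_of_degree_homogenize: "form_of_degree n (homogenize n g)"
  by (auto simp: form_of_degree_def in_keys_iff lookup_homogenize split: if_splits)

lemma homogeneous_component_form: "form_of_degree n f \<Longrightarrow> homogeneous_component n f = f"
  by (rule poly_mapping_eqI) (auto simp: lookup_homogeneous_component form_of_degree_def in_keys_iff)

lemma homogenize_dehomogenize_form: "form_of_degree n f \<Longrightarrow> homogenize n (dehomogenize n f) = f"
  by (simp add: homogenize_dehomogenize homogeneous_component_form)

lemma bipoly_eqI_dehomogenize:
  assumes "\<And>n. dehomogenize n f = dehomogenize n g" shows "f = g"
proof (rule poly_mapping_eqI)
  fix \<mu> :: mono
  have "coeff (dehomogenize (mdeg \<mu>) f) (snd \<mu>) = coeff (dehomogenize (mdeg \<mu>) g) (snd \<mu>)"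
    using assms by simp
  then show "Poly_Mapping.lookup f \<mu> = Poly_Mapping.lookup g \<mu>"
    by (simp add: coeff_dehomogenize mdeg_def)
qed

lemma sum_of_singles: "(\<Sum>\<mu>\<in>Poly_Mapping.keys f. Poly_Mapping.single \<mu> (Poly_Mapping.lookup f \<mu>)) = f"
proof (rule poly_mapping_eqI)
  fix \<nu>
  have "Poly_Mapping.lookup (\<Sum>\<mu>\<in>Poly_Mapping.keys f. Poly_Mapping.single \<mu> (Poly_Mapping.lookup f \<mu>)) \<nu> =
    (\<Sum>\<mu>\<in>Poly_Mapping.keys f. if \<mu> = \<nu> then Poly_Mapping.lookup f \<mu> else 0)"
    unfolding lookup_sum by (intro sum.cong refl) (auto simp: lookup_single when_def)
  then show "Poly_Mapping.lookup (\<Sum>\<mu>\<in>Poly_Mapping.keys f. Poly_Mapping.single \<mu> (Poly_Mapping.lookup f \<mu>)) \<nu> =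
      Poly_Mapping.lookup f \<nu>"
    by (auto simp: sum.delta in_keys_iff)
qed

lemma lookup_single_mult:
  fixes f :: "'k::field bipoly"
  shows "Poly_Mapping.lookup (Poly_Mapping.single \<mu> c * f) \<nu> =
    (if fst \<mu> \<le> fst \<nu> \<and> snd \<mu> \<le> snd \<nu> then c * Poly_Mapping.lookup f (fst \<nu> - fst \<mu>, snd \<nu> - snd \<mu>) else 0)"
    (is "_ = ?R")
proof -
  have "Poly_Mapping.single \<mu> c * f = (\<Sum>\<kappa>\<in>Poly_Mapping.keys f. Poly_Mapping.single (\<mu> + \<kappa>) (c * Poly_Mapping.lookup f \<kappa>))"
    by (subst (1) sum_of_singles[of f, symmetric]) (simp add: sum_distrib_left mult_single)
  moreover have "\<mu> + \<kappa> = \<nu> \<longleftrightarrow> fst \<mu> \<le> fst \<nu> \<and> snd \<mu> \<le> snd \<nu> \<and> \<kappa> = (fst \<nu> - fst \<mu>, snd \<nu> - snd \<mu>)" for \<kappa>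
    by (cases \<mu>; cases \<kappa>; cases \<nu>) auto
  ultimately have "Poly_Mapping.lookup (Poly_Mapping.single \<mu> c * f) \<nu> =
     (\<Sum>\<kappa>\<in>Poly_Mapping.keys f. if \<kappa> = (fst \<nu> - fst \<mu>, snd \<nu> - snd \<mu>) then ?R else 0)"
    by (simp only: lookup_sum)
      (intro sum.cong refl, auto simp: lookup_single when_def)
  also have "\<dots> = ?R" by (auto simp: sum.delta in_keys_iff)
  finally show ?thesis .
qed

lemma dehomogenize_X_mult:
  "dehomogenize 0 (monomial (1, 0) * f) = 0"
  "dehomogenize (Suc n) (monomial (1, 0) * f) = dehomogenize n f"
  by (rule poly_eqI; auto simp: monomial_def coeff_dehomogenize lookup_single_mult Suc_diff_le le_Suc_eq)+

lemma dehomogenize_Y_mult: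
  "dehomogenize 0 (monomial (0, 1) * f) = 0"
  "dehomogenize (Suc n) (monomial (0, 1) * f) = pCons 0 (dehomogenize n f)"
  by (rule poly_eqI; auto simp: monomial_def coeff_dehomogenize lookup_single_mult coeff_pCons split: nat.splits)+

definition slice :: "'k::field bipoly set \<Rightarrow> nat \<Rightarrow> 'k poly set" where
  "slice I n = {g. degree g \<le> n \<and> homogenize n g \<in> I}"

text \<open>The sequences \<open>W\<close> that arise from graded ideals.\<close>

definition slice_system :: "(nat \<Rightarrow> 'k::field poly set) \<Rightarrow> bool" where
  "slice_system W \<longleftrightarrow> (\<forall>n. pv.subspace (W n) \<and> (\<forall>g \<in> W n. degree g \<le> n \<and> g \<in> W (Suc n) \<and> pCons 0 g \<in> W (Suc n)))"

definition ideal_of_slices :: "(nat \<Rightarrow> 'k::field poly set) \<Rightarrow> 'k bipoly set" where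
  "ideal_of_slices W = {f. \<forall>n. dehomogenize n f \<in> W n}"

lemma slice_systemD:
  assumes "slice_system W"
  shows "pv.subspace (W n)" "g \<in> W n \<Longrightarrow> degree g \<le> n" "g \<in> W n \<Longrightarrow> g \<in> W (Suc n)"
    "g \<in> W n \<Longrightarrow> pCons 0 g \<in> W (Suc n)"
  using assms unfolding slice_system_def by auto

lemma slice_system_0: "slice_system W \<Longrightarrow> 0 \<in> W n"
  using slice_systemD(1) pv.subspace_0 by blast

lemma slice_system_mono: "slice_system W \<Longrightarrow> m \<le> n \<Longrightarrow> W m \<subseteq> W n"
  by (rule lift_Suc_mono_le[of W]) (auto dest: slice_systemD(3))

lemma single_Suc_mult:
  "Poly_Mapping.single (Suc i, j) c * f = monomial (1, 0) * (Poly_Mapping.single (i, j) c * f)"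
  "Poly_Mapping.single (i, Suc j) c * f = monomial (0, 1) * (Poly_Mapping.single (i, j) c * f)"
  by (simp_all add: monomial_def mult.assoc[symmetric] mult_single)

text \<open>Closure under \<open>x\<close> and \<open>y\<close> is what the two inclusions of a slice system say, and every polynomial is a
  sum of terms \<open>c x\<^sup>iy\<^sup>j\<close>.\<close>

lemma ideal_of_slices_mult:
  assumes W: "slice_system W" and f: "f \<in> ideal_of_slices W"
  shows "r * f \<in> ideal_of_slices W"
proof -
  have mem: "monomial (1, 0) * h \<in> ideal_of_slices W \<and> monomial (0, 1) * h \<in> ideal_of_slices W"
    if "h \<in> ideal_of_slices W" for h
  proof -
    have "dehomogenize n (monomial (1, 0) * h) \<in> W n \<and> dehomogenize n (monomial (0, 1) * h) \<in> W n" for n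
      using that slice_systemD[OF W] slice_system_0[OF W] unfolding ideal_of_slices_def
      by (cases n) (auto simp: dehomogenize_X_mult dehomogenize_Y_mult simp del: One_nat_def)
    then show ?thesis by (simp add: ideal_of_slices_def)
  qed
  have single: "Poly_Mapping.single (i, j) c * f \<in> ideal_of_slices W" for i j c
  proof (induction i)
    case 0
    show ?case
    proof (induction j)
      case 0
      have "Poly_Mapping.single (0, 0) c * f = scalar_mult c f"
        by (simp add: scalar_mult_def zero_prod_def)
      then show ?case using f slice_systemD(1)[OF W]
        by (simp add: ideal_of_slices_def dehomogenize_scalar_mult pv.subspace_scale)
    qed (use mem single_Suc_mult in metis)
  qed (use mem single_Suc_mult in metis)
  have "r * f = (\<Sum>\<mu>\<in>Poly_Mapping.keys r. Poly_Mapping.single \<mu> (Poly_Mapping.lookup r \<mu>) * f)"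
    by (subst (1) sum_of_singles[of r, symmetric]) (simp add: sum_distrib_right)
  then show ?thesis
    using single slice_systemD(1)[OF W] by (auto simp: ideal_of_slices_def dehomogenize_sum intro!: pv.subspace_sum)
qed

lemma graded_ideal_of_slices:
  assumes W: "slice_system W" shows "graded_ideal (ideal_of_slices W)"
  unfolding graded_ideal_def ideal.subspace_def
proof (intro conjI ballI allI)
  show "0 \<in> ideal_of_slices W" "\<And>f g. f \<in> ideal_of_slices W \<Longrightarrow> g \<in> ideal_of_slices W \<Longrightarrow> f + g \<in> ideal_of_slices W"
    using slice_systemD(1)[OF W] slice_system_0[OF W]
    by (auto simp: ideal_of_slices_def dehomogenize_add intro: pv.subspace_add)
  fix f n assume f: "f \<in> ideal_of_slices W"
  have "dehomogenize m (homogeneous_component n f) \<in> W m" for m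
  proof (cases "m = n")
    case True
    then show ?thesis using f by (simp add: homogenize_dehomogenize[symmetric]
      dehomogenize_homogenize degree_dehomogenize ideal_of_slices_def)
  next
    case False
    then show ?thesis using slice_systemD(1)[OF W] slice_system_0[OF W]
      by (simp add: homogenize_dehomogenize[symmetric] dehomogenize_homogenize_other)
  qed
  then show "homogeneous_component n f \<in> ideal_of_slices W" by (simp add: ideal_of_slices_def)
qed (use ideal_of_slices_mult[OF W] in auto)

lemma slice_ideal_of_slices:
  assumes W: "slice_system W" shows "slice (ideal_of_slices W) n = W n"
proof (intro set_eqI iffI)
  fix g assume "g \<in> slice (ideal_of_slices W) n"
  then have "degree g \<le> n" "dehomogenize n (homogenize n g) \<in> W n" by (auto simp: slice_def ideal_of_slices_def)
  then show "g \<in> W n" by (simp add: dehomogenize_homogenize)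
next
  fix g assume g: "g \<in> W n"
  then have d: "degree g \<le> n" using slice_systemD[OF W] by auto
  have "dehomogenize m (homogenize n g) \<in> W m" for m
    using g d slice_systemD(1)[OF W] slice_system_0[OF W]
    by (cases "m = n") (auto simp: dehomogenize_homogenize dehomogenize_homogenize_other)
  then show "g \<in> slice (ideal_of_slices W) n" using d by (simp add: slice_def ideal_of_slices_def)
qed

lemma sum_homogeneous_components:
  assumes "mdeg ` Poly_Mapping.keys f \<subseteq> A" "finite A"
  shows "(\<Sum>n\<in>A. homogeneous_component n f) = f"
proof (rule poly_mapping_eqI)
  fix \<mu>
  show "Poly_Mapping.lookup (\<Sum>n\<in>A. homogeneous_component n f) \<mu> = Poly_Mapping.lookup f \<mu>"
    using assms by (auto simp: lookup_sum lookup_homogeneous_component sum.delta in_keys_iff image_subset_iff)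
qed

lemma graded_idealD:
  assumes "graded_ideal I"
  shows "ideal.subspace I" "f \<in> I \<Longrightarrow> homogeneous_component n f \<in> I"
    "f \<in> I \<Longrightarrow> g \<in> I \<Longrightarrow> f + g \<in> I" "f \<in> I \<Longrightarrow> g \<in> I \<Longrightarrow> f - g \<in> I"
    "0 \<in> I" "f \<in> I \<Longrightarrow> r * f \<in> I" "f \<in> I \<Longrightarrow> scalar_mult c f \<in> I"
  using assms ideal.subspace_add ideal.subspace_0 ideal.subspace_scale ideal.subspace_diff
  unfolding graded_ideal_def scalar_mult_def by auto

text \<open>A graded ideal is determined by its slices.\<close>

lemma graded_ideal_mem_iff:
  assumes I: "graded_ideal I"
  shows "f \<in> I \<longleftrightarrow> (\<forall>n. dehomogenize n f \<in> slice I n)"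
proof
  assume "f \<in> I"
  then show "\<forall>n. dehomogenize n f \<in> slice I n"
    using graded_idealD(2)[OF I] by (simp add: slice_def degree_dehomogenize homogenize_dehomogenize)
next
  assume "\<forall>n. dehomogenize n f \<in> slice I n"
  then have "homogeneous_component n f \<in> I" for n
    by (simp add: slice_def homogenize_dehomogenize)
  then have "(\<Sum>n\<in>mdeg ` Poly_Mapping.keys f. homogeneous_component n f) \<in> I"
    by (intro ideal.subspace_sum[OF graded_idealD(1)[OF I]])
  then show "f \<in> I" by (simp add: sum_homogeneous_components)
qed

lemma slice_system_slice:
  assumes I: "graded_ideal I" shows "slice_system (slice I)"
proof -
  have "pv.subspace (slice I n)" for n
    unfolding pv.subspace_def slice_def
    using graded_idealD[OF I] by (auto simp: homogenize_add homogenize_smult intro: degree_add_le)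
  moreover have "g \<in> slice I (Suc n) \<and> pCons 0 g \<in> slice I (Suc n)" if "g \<in> slice I n" for g n
  proof -
    have g: "degree g \<le> n" "homogenize n g \<in> I" using that by (auto simp: slice_def)
    have "dehomogenize (Suc n) (monomial (1,0) * homogenize n g) \<in> slice I (Suc n)"
      "dehomogenize (Suc n) (monomial (0,1) * homogenize n g) \<in> slice I (Suc n)"
      using graded_idealD(6)[OF I g(2)] graded_ideal_mem_iff[OF I] by blast+
    then show ?thesis using g(1) by (simp only: dehomogenize_X_mult dehomogenize_Y_mult dehomogenize_homogenize)
  qed
  ultimately show ?thesis by (auto simp: slice_system_def slice_def)
qed

lemma graded_ideal_eq_iff:
  assumes "graded_ideal I" "graded_ideal J"
  shows "I = J \<longleftrightarrow> (\<forall>n. slice I n = slice J n)"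
  using graded_ideal_mem_iff[OF assms(1)] graded_ideal_mem_iff[OF assms(2)] by auto

lemma slice_subset_span: "slice I n \<subseteq> pv.span (monom 1 ` {..n})"
  using degree_le_subset_span by (auto simp: slice_def)

lemma linear_homogenize: "Vector_Spaces.linear smult scalar_mult (homogenize n)"
  by unfold_locales (simp_all add: homogenize_add homogenize_smult smult_add_right smult_add_left)

lemma homogenize_eq_0_iff: "degree g \<le> n \<Longrightarrow> homogenize n g = 0 \<longleftrightarrow> g = 0"
  using dehomogenize_homogenize[of g n] by force

lemma dim_forms_eq_dim_slice:
  fixes I :: "'k::field bipoly set"
  shows "bipoly.dim {f \<in> I. form_of_degree n f} = pv.dim (slice I n)"
proof -
  interpret h: Vector_Spaces.linear smult scalar_mult "homogenize n :: 'k poly \<Rightarrow> _" by (rule linear_homogenize)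
  obtain B where B: "B \<subseteq> slice I n" "pv.independent B" "slice I n \<subseteq> pv.span B" "card B = pv.dim (slice I n)"
    using pv.basis_exists by blast
  have deg: "degree g \<le> n" if "g \<in> pv.span B" for g
    using pv.span_minimal[of B "{g. degree g \<le> n}"] subspace_degree_le B(1) that by (auto simp: slice_def)
  have inj: "inj_on (homogenize n) (pv.span B)"
    by (rule inj_on_inverseI[of _ "dehomogenize n"]) (use deg dehomogenize_homogenize in auto)
  have eq: "{f \<in> I. form_of_degree n f} = homogenize n ` slice I n"
  proof (intro set_eqI iffI)
    fix f assume "f \<in> {f \<in> I. form_of_degree n f}"
    then show "f \<in> homogenize n ` slice I n"
      by (intro image_eqI[of _ _ "dehomogenize n f"])
        (auto simp: homogenize_dehomogenize_form slice_def degree_dehomogenize)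
  qed (auto simp: slice_def form_of_degree_homogenize)
  have "bipoly.dim {f \<in> I. form_of_degree n f} = card (homogenize n ` B)"
  proof (rule bipoly.basis_card_eq_dim[symmetric])
    show "bipoly.independent (homogenize n ` B)"
      using h.independent_injective_image[OF B(2) inj] .
    show "{f \<in> I. form_of_degree n f} \<subseteq> bipoly.span (homogenize n ` B)"
      unfolding eq h.span_image using B(3) by auto
  qed (use B(1) eq in auto)
  also have "\<dots> = card B" using inj pv.span_superset by (intro card_image) (rule inj_on_subset)
  finally show ?thesis using B(4) by simp
qed

lemma dim_degree_le: "pv.dim {g :: 'k::field poly. degree g \<le> n} = Suc n"
proof -
  have "pv.independent (monom (1::'k) ` {..n})"
  proof (rule pv.independent_if_scalars_zero)
    fix f :: "'k poly \<Rightarrow> 'k" and x :: "'k poly" assume f: "(\<Sum>x\<in>monom 1 ` {..n}. smult (f x) x) = 0" and "x \<in> monom 1 ` {..n}"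
    then obtain i where i: "i \<le> n" "x = monom 1 i" by auto
    have inj: "inj_on (monom (1::'k)) {..n}" by (auto simp: inj_on_def monom_eq_iff')
    have "coeff (\<Sum>j\<le>n. smult (f (monom 1 j)) (monom 1 j)) i = 0"
      using f by (simp add: sum.reindex[OF inj])
    then show "f x = 0" using i by (simp add: coeff_sum if_distrib sum.delta cong: if_cong)
  qed simp
  moreover have "card (monom (1::'k) ` {..n}) = Suc n"
    by (subst card_image) (auto simp: inj_on_def monom_eq_iff')
  moreover have "monom (1::'k) ` {..n} \<subseteq> {g. degree g \<le> n}" by (auto simp: degree_monom_eq)
  ultimately show ?thesis using pv.basis_card_eq_dim[OF _ degree_le_subset_span] by metis
qed

lemma hilbert_function_eq: "hilbert_function I n = Suc n - pv.dim (slice I n)"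
proof -
  have "{f :: 'a bipoly. form_of_degree n f} = {f \<in> UNIV. form_of_degree n f}" by simp
  then have "bipoly.dim {f :: 'a bipoly. form_of_degree n f} = pv.dim (slice (UNIV :: 'a bipoly set) n)"
    using dim_forms_eq_dim_slice[of "UNIV :: 'a bipoly set" n] by simp
  also have "\<dots> = Suc n" unfolding slice_def using dim_degree_le by simp
  finally show ?thesis unfolding hilbert_function_def dim_forms_eq_dim_slice by simp
qed

lemma dim_slice_le: "pv.dim (slice I n) \<le> Suc n"
  using pv.dim_mono_of_finite[of "slice I n" "{g. degree g \<le> n}"] degree_le_subset_span dim_degree_le
  by (metis (mono_tags, lifting) finite_atMost finite_imageI mem_Collect_eq slice_def subsetI)

section \<open>Minimal numbers of generators\<close>

text \<open>The slice in degree \<open>n\<close> of the product of the ideal with \<open>(x, y)\<close>.\<close>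

definition decomposables :: "(nat \<Rightarrow> 'k::field poly set) \<Rightarrow> nat \<Rightarrow> 'k poly set" where
  "decomposables W n = (case n of 0 \<Rightarrow> {0} | Suc m \<Rightarrow> pv.span (W m \<union> pCons 0 ` W m))"

lemma subspace_decomposables: "pv.subspace (decomposables W n)"
  by (auto simp: decomposables_def split: nat.split)

lemma decomposables_subset:
  assumes W: "slice_system W" shows "decomposables W n \<subseteq> W n"
proof (cases n)
  case 0
  then show ?thesis using slice_system_0[OF W] by (simp add: decomposables_def)
next
  case (Suc m)
  then show ?thesis unfolding decomposables_def Suc nat.case
    using slice_systemD[OF W] by (intro pv.span_minimal) auto
qed

lemma homogenize_Suc: "degree g \<le> n \<Longrightarrow> homogenize (Suc n) g = monomial (1, 0) * homogenize n g"
  by (rule poly_mapping_eqI)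
    (auto simp: lookup_homogenize monomial_def lookup_single_mult mdeg_def coeff_eq_0)

lemma homogenize_Suc_pCons: "homogenize (Suc n) (pCons 0 g) = monomial (0, 1) * homogenize n g"
  by (rule poly_mapping_eqI)
    (auto simp: lookup_homogenize monomial_def lookup_single_mult mdeg_def coeff_pCons split: nat.splits)

lemma decomposables_of_full:
  assumes "W n = {g. degree g \<le> n}"
  shows "{g. degree g \<le> Suc n} \<subseteq> decomposables W (Suc n)"
proof clarify
  fix g :: "'a poly" assume g: "degree g \<le> Suc n"
  obtain a h where gh: "g = pCons a h" by (cases g) auto
  have "g = [:a:] + pCons 0 h" using gh by simp
  moreover have "[:a:] \<in> W n" using assms by simp
  moreover have "h \<in> W n" using g gh assms by (cases "h = 0") auto
  moreover from this have "[:a:] + pCons 0 h \<in> pv.span (W n \<union> pCons 0 ` W n)"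
    using \<open>[:a:] \<in> W n\<close> by (intro pv.span_add pv.span_base) auto
  ultimately show "g \<in> decomposables W (Suc n)"
    by (simp only: decomposables_def nat.case)
qed

text \<open>Homogeneous generators that complement the decomposables in every degree generate the ideal, by
  induction on the degree. Conversely, in any relation \<open>f = \<Sum> r\<^sub>b b\<close> the non-constant parts of the
  coefficients contribute elements with decomposable components, so that every generating set \<open>B\<close>
  spans \<open>I\<close> over the field modulo decomposables. This also covers inhomogeneous \<open>B\<close>.\<close>

lemma min_generators_eq:
  fixes I :: "'k::field bipoly set"
  assumes I: "graded_ideal I" and full: "\<And>n. N \<le> n \<Longrightarrow> slice I n = {g. degree g \<le> n}"
  shows "min_generators I = (\<Sum>n\<le>N. pv.dim (slice I n) - pv.dim (decomposables (slice I) n))"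
proof -
  let ?W = "slice I" and ?D = "decomposables (slice I)"
  have W: "slice_system ?W" by (rule slice_system_slice[OF I])
  have "\<exists>B. B \<subseteq> ?W n \<and> pv.independent B \<and> finite B \<and> card B = pv.dim (?W n) - pv.dim (?D n) \<and>
      pv.span B \<inter> ?D n = {0} \<and> ?W n \<subseteq> pv.span (?D n \<union> B)" for n
    by (rule pv.exists_complement_basis[OF subspace_decomposables decomposables_subset[OF W]
      slice_systemD(1)[OF W] slice_subset_span]) auto
  then obtain B where B: "\<And>n. B n \<subseteq> ?W n" "\<And>n. pv.independent (B n)" "\<And>n. finite (B n)"
    "\<And>n. card (B n) = pv.dim (?W n) - pv.dim (?D n)"
    "\<And>n. pv.span (B n) \<inter> ?D n = {0}" "\<And>n. ?W n \<subseteq> pv.span (?D n \<union> B n)"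
    by metis
  define \<Sigma> where "\<Sigma> = (SIGMA n:{..N}. B n)"
  define h where "h = (\<lambda>(n, b). homogenize n b :: 'k bipoly)"
  define \<G> where "\<G> = h ` \<Sigma>"
  have deg: "degree b \<le> n" "b \<noteq> 0" if "b \<in> B n" for n b
    using that B(1,2)[of n] pv.dependent_zero[of "B n"] by (auto simp: slice_def)
  have fin: "finite \<Sigma>" using B(3) by (auto simp: \<Sigma>_def)
  have inj: "inj_on h \<Sigma>"
  proof (rule inj_onI)
    fix p q assume "p \<in> \<Sigma>" "q \<in> \<Sigma>" and eq: "h p = h q"
    then obtain m b n c where p: "p = (m, b)" "b \<in> B m" and q: "q = (n, c)" "c \<in> B n"
      by (auto simp: \<Sigma>_def)
    have eq': "homogenize m b = homogenize n c" using eq p q by (simp add: h_def)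
    have "m = n"
    proof (rule ccontr)
      assume "m \<noteq> n"
      then have "dehomogenize m (homogenize m b) = 0"
        using eq' by (simp add: dehomogenize_homogenize_other)
      then show False using deg[OF p(2)] by (simp add: dehomogenize_homogenize)
    qed
    then show "p = q" using eq' p q deg dehomogenize_homogenize by metis
  qed
  have card_G: "card \<G> = (\<Sum>n\<le>N. pv.dim (?W n) - pv.dim (?D n))"
    unfolding \<G>_def card_image[OF inj] unfolding \<Sigma>_def using B(3,4) by simp
  have fin_G: "finite \<G>" using fin by (simp add: \<G>_def)
  have G_I: "\<G> \<subseteq> I" using B(1) by (auto simp: \<G>_def h_def \<Sigma>_def slice_def)
  have subspace_vimage: "pv.subspace {g. homogenize n g \<in> ideal.span \<G>}" for n
    unfolding pv.subspace_def scalar_mult_def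
    by (auto simp: homogenize_add homogenize_smult scalar_mult_def
      intro: ideal.span_zero ideal.span_add ideal.span_scale)
  have D_sub: "?D n \<subseteq> {g. homogenize n g \<in> ideal.span \<G>}"
    if IH: "\<And>m. m < n \<Longrightarrow> ?W m \<subseteq> {g. homogenize m g \<in> ideal.span \<G>}" for n
  proof (cases n)
    case 0
    then show ?thesis by (auto simp: decomposables_def intro: ideal.span_zero)
  next
    case (Suc m)
    have "?W m \<union> pCons 0 ` ?W m \<subseteq> {g. homogenize n g \<in> ideal.span \<G>}"
      using IH[of m] Suc slice_systemD(2)[OF W]
      by (auto simp: homogenize_Suc homogenize_Suc_pCons intro!: ideal.span_scale)
    then show ?thesis unfolding Suc decomposables_def nat.case
      using subspace_vimage[of n] Suc by (intro pv.span_minimal) auto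
  qed
  have W_sub: "?W n \<subseteq> {g. homogenize n g \<in> ideal.span \<G>}" for n
  proof (induction n rule: less_induct)
    case (less n)
    note D = D_sub[OF less.IH]
    show ?case
    proof (cases "n \<le> N")
      case True
      have "B n \<subseteq> {g. homogenize n g \<in> ideal.span \<G>}"
        using True by (auto simp: \<G>_def h_def \<Sigma>_def intro!: ideal.span_base)
      with D have "pv.span (?D n \<union> B n) \<subseteq> {g. homogenize n g \<in> ideal.span \<G>}"
        by (intro pv.span_minimal subspace_vimage) auto
      then show ?thesis using B(6)[of n] by auto
    next
      case False
      then obtain m where m: "n = Suc m" "N \<le> m" by (cases n) auto
      have "?W n \<subseteq> ?D n"
        using decomposables_of_full[of ?W m] full[of m] full[of n] m by auto
      then show ?thesis using D by auto
    qed
  qed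
  have span_G: "ideal.span \<G> = I"
  proof
    show "ideal.span \<G> \<subseteq> I" using G_I graded_idealD(1)[OF I] by (rule ideal.span_minimal)
    show "I \<subseteq> ideal.span \<G>"
    proof
      fix f assume f: "f \<in> I"
      have "homogeneous_component n f \<in> ideal.span \<G>" for n
        using W_sub[of n] f graded_ideal_mem_iff[OF I] homogenize_dehomogenize[of n f] by auto
      then have "(\<Sum>n\<in>mdeg ` Poly_Mapping.keys f. homogeneous_component n f) \<in> ideal.span \<G>"
        by (intro ideal.span_sum)
      then show "f \<in> ideal.span \<G>" by (simp add: sum_homogeneous_components)
    qed
  qed
  \<comment> \<open>This is \<open>(x, y) I\<close>.\<close>
  define Q where "Q = {f. \<forall>n. dehomogenize n f \<in> ?D n}"
  have Q: "bipoly.subspace Q"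
    using subspace_decomposables[of ?W]
    by (auto simp: Q_def bipoly.subspace_def dehomogenize_add dehomogenize_scalar_mult
      pv.subspace_add pv.subspace_scale pv.subspace_0)
  have XY: "monomial (1, 0) * f \<in> Q \<and> monomial (0, 1) * f \<in> Q" if "f \<in> I" for f
  proof -
    have "dehomogenize n (monomial (1, 0) * f) \<in> ?D n \<and> dehomogenize n (monomial (0, 1) * f) \<in> ?D n" for n
    proof (cases n)
      case 0
      then show ?thesis by (simp add: dehomogenize_X_mult dehomogenize_Y_mult decomposables_def del: One_nat_def)
    next
      case (Suc m)
      then show ?thesis using that graded_ideal_mem_iff[OF I]
        by (auto simp: dehomogenize_X_mult dehomogenize_Y_mult decomposables_def
          simp del: One_nat_def intro!: pv.span_base)
    qed
    then show ?thesis by (simp add: Q_def)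
  qed
  have shift: "r * f - scalar_mult (Poly_Mapping.lookup r 0) f \<in> Q" if f: "f \<in> I" for r f
  proof -
    have single: "Poly_Mapping.single \<mu> c * f \<in> Q" if nz: "\<mu> \<noteq> 0" for \<mu> c
    proof -
      obtain i j where \<mu>: "\<mu> = (i, j)" by (cases \<mu>)
      consider i' where "i = Suc i'" | j' where "j = Suc j'"
        using nz \<mu> by (cases i; cases j) (auto simp: zero_prod_def)
      then show ?thesis
        using XY graded_idealD(6)[OF I f] \<mu> by cases (simp_all add: single_Suc_mult)
    qed
    have "r * f = (\<Sum>\<mu>\<in>insert 0 (Poly_Mapping.keys r). Poly_Mapping.single \<mu> (Poly_Mapping.lookup r \<mu>) * f)"
    proof -
      have "r * f = (\<Sum>\<mu>\<in>Poly_Mapping.keys r. Poly_Mapping.single \<mu> (Poly_Mapping.lookup r \<mu>) * f)"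
        by (subst (1) sum_of_singles[of r, symmetric]) (simp add: sum_distrib_right)
      also have "\<dots> = (\<Sum>\<mu>\<in>insert 0 (Poly_Mapping.keys r). Poly_Mapping.single \<mu> (Poly_Mapping.lookup r \<mu>) * f)"
        by (intro sum.mono_neutral_left) (auto simp: in_keys_iff)
      finally show ?thesis .
    qed
    also have "\<dots> = scalar_mult (Poly_Mapping.lookup r 0) f +
        (\<Sum>\<mu>\<in>Poly_Mapping.keys r - {0}. Poly_Mapping.single \<mu> (Poly_Mapping.lookup r \<mu>) * f)"
      by (subst sum.insert_remove) (auto simp: scalar_mult_def)
    finally have "r * f - scalar_mult (Poly_Mapping.lookup r 0) f =
        (\<Sum>\<mu>\<in>Poly_Mapping.keys r - {0}. Poly_Mapping.single \<mu> (Poly_Mapping.lookup r \<mu>) * f)" by simp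
    also have "\<dots> \<in> Q" using single by (intro bipoly.subspace_sum[OF Q]) simp
    finally show ?thesis .
  qed
  have cover: "\<exists>u \<in> bipoly.span B'. f - u \<in> Q" if B': "ideal.span B' = I" and f: "f \<in> I" for B' f
  proof -
    have "f \<in> ideal.span B'" using B' f by simp
    then show ?thesis
    proof (induction rule: ideal.span_induct_alt)
      case base
      show ?case using bipoly.span_zero bipoly.subspace_0[OF Q] by force
    next
      case (step r b y)
      then obtain u where u: "u \<in> bipoly.span B'" "y - u \<in> Q" by auto
      have "b \<in> I" using step(1) B' ideal.span_base by auto
      from bipoly.subspace_add[OF Q shift[OF this, of r] u(2)]
      have "r * b + y - (scalar_mult (Poly_Mapping.lookup r 0) b + u) \<in> Q" by (simp add: algebra_simps)
      moreover have "scalar_mult (Poly_Mapping.lookup r 0) b + u \<in> bipoly.span B'"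
        by (rule bipoly.span_add[OF bipoly.span_scale[OF bipoly.span_base[OF step(1)]] u(1)])
      ultimately show ?case by blast
    qed
  qed
  have zero: "c s = 0" if c: "(\<Sum>s\<in>\<G>. scalar_mult (c s) s) \<in> Q" and s: "s \<in> \<G>" for c s
  proof -
    obtain n b where nb: "s = homogenize n b" "n \<le> N" "b \<in> B n"
      using s by (auto simp: \<G>_def h_def \<Sigma>_def)
    have "(\<Sum>s\<in>\<G>. scalar_mult (c s) s) = (\<Sum>m\<le>N. \<Sum>b\<in>B m. scalar_mult (c (homogenize m b)) (homogenize m b))"
      unfolding \<G>_def sum.reindex[OF inj] unfolding \<Sigma>_def
      using B(3) by (subst sum.Sigma) (auto simp: h_def intro!: sum.cong)
    then have "dehomogenize n (\<Sum>s\<in>\<G>. scalar_mult (c s) s) =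
        (\<Sum>m\<le>N. \<Sum>b\<in>B m. smult (c (homogenize m b)) (dehomogenize n (homogenize m b)))"
      by (simp add: dehomogenize_sum dehomogenize_scalar_mult)
    also have "\<dots> = (\<Sum>m\<le>N. if m = n then (\<Sum>b\<in>B n. smult (c (homogenize n b)) b) else 0)"
      by (intro sum.cong refl) (auto simp: dehomogenize_homogenize dehomogenize_homogenize_other deg intro!: sum.cong)
    also have "\<dots> = (\<Sum>b\<in>B n. smult (c (homogenize n b)) b)" using nb(2) by simp
    finally have eq: "dehomogenize n (\<Sum>s\<in>\<G>. scalar_mult (c s) s) = (\<Sum>b\<in>B n. smult (c (homogenize n b)) b)" .
    have "dehomogenize n (\<Sum>s\<in>\<G>. scalar_mult (c s) s) \<in> ?D n" using c unfolding Q_def by blast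
    then have "(\<Sum>b\<in>B n. smult (c (homogenize n b)) b) \<in> ?D n" by (simp only: eq)
    moreover have "(\<Sum>b\<in>B n. smult (c (homogenize n b)) b) \<in> pv.span (B n)"
      by (intro pv.span_sum pv.span_scale pv.span_base)
    ultimately have "(\<Sum>b\<in>B n. smult (c (homogenize n b)) b) = 0" using B(5)[of n] by auto
    from pv.independentD[OF B(2) B(3) subset_refl this nb(3)] show ?thesis using nb(1) by simp
  qed
  have indep_G: "bipoly.independent \<G>"
  proof (rule bipoly.independent_if_scalars_zero[OF fin_G])
    fix c s assume "(\<Sum>s\<in>\<G>. scalar_mult (c s) s) = 0" "s \<in> \<G>"
    then show "c s = 0" using bipoly.subspace_0[OF Q] by (intro zero) auto
  qed
  have disj: "bipoly.span \<G> \<inter> Q \<subseteq> {0}"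
  proof clarify
    fix x assume x: "x \<in> bipoly.span \<G>" "x \<in> Q"
    then obtain c where c: "x = (\<Sum>s\<in>\<G>. scalar_mult (c s) s)"
      unfolding bipoly.span_finite[OF fin_G] by auto
    then have "c s = 0" if "s \<in> \<G>" for s using x(2) that zero by auto
    then show "x = 0" using c by simp
  qed
  have "min_generators I = card \<G>"
    unfolding min_generators_def
  proof (rule Least_equality)
    show "\<exists>B. finite B \<and> card B = card \<G> \<and> ideal.span B = I" using fin_G span_G by blast
    fix m assume "\<exists>B. finite B \<and> card B = m \<and> ideal.span B = I"
    then obtain B' where B': "finite B'" "card B' = m" "ideal.span B' = I" by auto
    have "card \<G> \<le> card B'"
      by (rule bipoly.card_le_of_independent_modulo[OF Q B'(1) indep_G fin_G cover[OF B'(3)] disj])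
        (use G_I in auto)
    then show "card \<G> \<le> m" using B'(2) by simp
  qed
  then show ?thesis using card_G by simp
qed

section \<open>Ideals with prescribed degrees of their slices\<close>

text \<open>In a combination of polynomials of distinct degrees the largest degree with a nonzero coefficient
  survives.\<close>

lemma echelon_scalars_zero:
  fixes g :: "nat \<Rightarrow> 'k::field poly"
  assumes A: "finite A" and g: "\<And>b. b \<in> A \<Longrightarrow> degree (g b) = b \<and> g b \<noteq> 0"
    and u: "\<exists>b\<in>A. u b \<noteq> 0"
  shows "(\<Sum>b\<in>A. smult (u b) (g b)) \<noteq> 0" "degree (\<Sum>b\<in>A. smult (u b) (g b)) \<in> A"
proof -
  define m where "m = Max {b \<in> A. u b \<noteq> 0}"
  have m: "m \<in> A" "u m \<noteq> 0" "\<And>b. b \<in> A \<Longrightarrow> u b \<noteq> 0 \<Longrightarrow> b \<le> m"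
    using Max_in[of "{b \<in> A. u b \<noteq> 0}"] Max_ge[of "{b \<in> A. u b \<noteq> 0}"] A u by (auto simp: m_def)
  have c: "coeff (\<Sum>b\<in>A. smult (u b) (g b)) k = (if k = m then u m * lead_coeff (g m) else 0)" if "k \<ge> m" for k
  proof -
    have "coeff (\<Sum>b\<in>A. smult (u b) (g b)) k = (\<Sum>b\<in>A. if b = m \<and> k = m then u m * lead_coeff (g m) else 0)"
      unfolding coeff_sum
    proof (intro sum.cong refl)
      fix b assume b: "b \<in> A"
      show "coeff (smult (u b) (g b)) k = (if b = m \<and> k = m then u m * lead_coeff (g m) else 0)"
        using g[OF b] m(3)[OF b] that by (cases "u b = 0") (auto intro!: coeff_eq_0 simp: m)
    qed
    then show ?thesis using A m(1) by (simp add: sum.delta)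
  qed
  have "lead_coeff (g m) \<noteq> 0" using g[OF m(1)] by (metis leading_coeff_0_iff)
  with c[of m] m(2) have nz: "coeff (\<Sum>b\<in>A. smult (u b) (g b)) m \<noteq> 0" by simp
  then show "(\<Sum>b\<in>A. smult (u b) (g b)) \<noteq> 0" by auto
  have "degree (\<Sum>b\<in>A. smult (u b) (g b)) = m"
    using nz c by (intro antisym degree_le le_degree) auto
  then show "degree (\<Sum>b\<in>A. smult (u b) (g b)) \<in> A" using m by simp
qed

lemma echelon_independent:
  fixes g :: "nat \<Rightarrow> 'k::field poly"
  assumes A: "finite A" and g: "\<And>b. b \<in> A \<Longrightarrow> degree (g b) = b \<and> g b \<noteq> 0"
  shows "inj_on g A" "pv.independent (g ` A)"
  by (rule pv.independent_family[OF A]; use echelon_scalars_zero(1)[OF A g] in blast)+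

lemma span_image_eq:
  assumes "finite A" "inj_on g A" "v \<in> pv.span (g ` A)"
  obtains u where "v = (\<Sum>b\<in>A. smult (u b) (g b))"
proof -
  obtain f where "v = (\<Sum>x\<in>g ` A. smult (f x) x)"
    using assms pv.span_finite[of "g ` A"] by auto
  then have "v = (\<Sum>b\<in>A. smult (f (g b)) (g b))" by (simp only: sum.reindex[OF assms(2)] o_def)
  then show ?thesis by (rule that)
qed

lemma echelon_degrees:
  fixes g :: "nat \<Rightarrow> 'k::field poly"
  assumes A: "finite A" and g: "\<And>b. b \<in> A \<Longrightarrow> degree (g b) = b \<and> g b \<noteq> 0"
  shows "degree ` (pv.span (g ` A) - {0}) = A"
proof (intro set_eqI iffI)
  fix b assume b: "b \<in> A"
  have "g b \<in> pv.span (g ` A) - {0}" using g[OF b] pv.span_base[OF imageI[OF b]] by simp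
  moreover have "b = degree (g b)" using g[OF b] by simp
  ultimately show "b \<in> degree ` (pv.span (g ` A) - {0})" by (rule rev_image_eqI)
next
  fix d assume "d \<in> degree ` (pv.span (g ` A) - {0})"
  then obtain v where v: "v \<in> pv.span (g ` A)" "v \<noteq> 0" "d = degree v" by auto
  obtain u where u: "v = (\<Sum>b\<in>A. smult (u b) (g b))"
    using span_image_eq[OF A echelon_independent(1)[OF A g] v(1)] by blast
  have "\<exists>b\<in>A. u b \<noteq> 0"
  proof (rule ccontr)
    assume "\<not> (\<exists>b\<in>A. u b \<noteq> 0)"
    then have "v = 0" unfolding u by (intro sum.neutral) auto
    then show False using v(2) by simp
  qed
  then show "d \<in> A" using echelon_scalars_zero(2)[OF A g] u v(3) by simp
qed

lemma echelon_span:
  fixes g :: "nat \<Rightarrow> 'k::field poly"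
  assumes V: "pv.subspace V" and deg: "degree ` (V - {0}) \<subseteq> A"
    and g: "\<And>b. b \<in> A \<Longrightarrow> degree (g b) = b \<and> g b \<noteq> 0 \<and> g b \<in> V"
  shows "V = pv.span (g ` A)"
proof
  show "pv.span (g ` A) \<subseteq> V" using V g by (intro pv.span_minimal) auto
  have "v \<in> pv.span (g ` A)" if "v \<in> V" for v
    using that
  proof (induction "degree v" arbitrary: v rule: less_induct)
    case less
    show ?case
    proof (cases "v = 0")
      case True
      then show ?thesis by (simp add: pv.span_zero)
    next
      case False
      let ?b = "degree v"
      have b: "?b \<in> A" using deg less.prems False by auto
      define w where "w = v - smult (lead_coeff v / lead_coeff (g ?b)) (g ?b)"
      have wV: "w \<in> V" using less.prems g[OF b] V by (auto simp: w_def intro!: pv.subspace_diff pv.subspace_scale)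
      have "w \<in> pv.span (g ` A)"
      proof (cases "w = 0")
        case True
        then show ?thesis by (simp add: pv.span_zero)
      next
        case False
        have "coeff (g ?b) ?b \<noteq> 0" using g[OF b] by (metis leading_coeff_0_iff)
        then have "coeff w k = 0" if "k \<ge> ?b" for k
          using that g[OF b] unfolding w_def by (cases "k = ?b") (auto simp: coeff_eq_0)
        then have "degree w < ?b" using False by (metis leading_coeff_0_iff not_less)
        then show ?thesis using less.hyps wV by auto
      qed
      moreover have "v = w + smult (lead_coeff v / lead_coeff (g ?b)) (g ?b)" by (simp add: w_def)
      moreover have "smult (lead_coeff v / lead_coeff (g ?b)) (g ?b) \<in> pv.span (g ` A)"
        using b by (intro pv.span_scale pv.span_base) auto
      ultimately show ?thesis using pv.span_add by metis
    qed
  qed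
  then show "V \<subseteq> pv.span (g ` A)" by auto
qed

lemma dim_eq_card_degrees:
  fixes V :: "'k::field poly set"
  assumes V: "pv.subspace V" and fin: "finite (degree ` (V - {0}))"
  shows "pv.dim V = card (degree ` (V - {0}))"
proof -
  let ?A = "degree ` (V - {0})"
  have "\<forall>b\<in>?A. \<exists>g. degree g = b \<and> g \<noteq> 0 \<and> g \<in> V" by auto
  then obtain g where g: "\<And>b. b \<in> ?A \<Longrightarrow> degree (g b) = b \<and> g b \<noteq> 0 \<and> g b \<in> V" by metis
  have "V = pv.span (g ` ?A)" using g by (intro echelon_span[OF V]) auto
  then have "pv.dim V = card (g ` ?A)"
    using pv.dim_span_eq_card_independent echelon_independent(2)[OF fin] g by metis
  also have "\<dots> = card ?A" using echelon_independent(1)[OF fin] g by (intro card_image) blast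
  finally show ?thesis .
qed

text \<open>The rows \<open>b\<close> that occur in degree \<open>n\<close> but not in degree \<open>n - 1\<close>.\<close>

definition entering :: "(nat \<Rightarrow> nat set) \<Rightarrow> nat \<Rightarrow> nat set" where
  "entering D n = D n - (case n of 0 \<Rightarrow> {} | Suc m \<Rightarrow> D m)"

text \<open>For the rows \<open>D\<close> of a partition this is its Jordan cell. In terms of \<open>D\<close>, the dense cell of \<open>G T\<close> can be
  treated without writing down its partition.\<close>

definition degree_cell :: "(nat \<Rightarrow> nat set) \<Rightarrow> 'k::field bipoly set set" where
  "degree_cell D = {I. graded_ideal I \<and> (\<forall>n. degree ` (slice I n - {0}) = D n)}"

text \<open>The parametrization of a cell: \<open>e b\<close> is the first degree in which the row \<open>b\<close> occurs, and \<open>a\<close> holds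
  the parameters. The recursion is the relation that expresses \<open>y g\<^sub>b\<close> through the basis of the next
  slice. The coefficient of \<open>g\<^sub>b\<^sub>+\<^sub>1\<close> is \<open>1\<close> because all \<open>g\<^sub>b\<close> are monic.\<close>

fun cell_basis :: "(nat \<Rightarrow> nat) \<Rightarrow> (nat \<times> nat \<Rightarrow> 'k::field) \<Rightarrow> nat \<Rightarrow> 'k poly" where
  "cell_basis e a 0 = 1"
| "cell_basis e a (Suc b) =
     pCons 0 (cell_basis e a b) + (\<Sum>c\<in>{c. c \<le> b \<and> e c \<le> Suc (e b)}. smult (a (b, c)) (cell_basis e a c))"

declare cell_basis.simps(2) [simp del]

lemma degree_cell_basis: "degree (cell_basis e a b) = b \<and> lead_coeff (cell_basis e a b) = 1"
proof (induction b rule: less_induct)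
  case (less b)
  show ?case
  proof (cases b)
    case (Suc m)
    have IH: "degree (cell_basis e a m) = m" "lead_coeff (cell_basis e a m) = 1" using less[of m] Suc by blast+
    then have nz: "cell_basis e a m \<noteq> 0" by auto
    let ?s = "\<Sum>c\<in>{c. c \<le> m \<and> e c \<le> Suc (e m)}. smult (a (m, c)) (cell_basis e a c)"
    have "degree ?s \<le> m"
      using less Suc by (intro degree_sum_le) (auto intro: le_trans[OF degree_smult_le])
    then have "degree ?s < degree (pCons 0 (cell_basis e a m))" using IH nz by simp
    then show ?thesis using IH nz Suc
      by (simp add: cell_basis.simps(2) degree_add_eq_left lead_coeff_add_le coeff_eq_0)
  qed simp
qed

lemma cell_basis_nz: "cell_basis e a b \<noteq> 0"
  using degree_cell_basis[of e a b] by auto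

lemma pCons_cell_basis_in_span:
  assumes "e (Suc b) \<le> Suc (e b)"
  shows "pCons 0 (cell_basis e a b) \<in> pv.span (cell_basis e a ` {c. c \<le> Suc b \<and> e c \<le> Suc (e b)})"
proof -
  let ?S = "cell_basis e a ` {c. c \<le> Suc b \<and> e c \<le> Suc (e b)}"
  have "cell_basis e a (Suc b) - (\<Sum>c\<in>{c. c \<le> b \<and> e c \<le> Suc (e b)}. smult (a (b, c)) (cell_basis e a c)) \<in> pv.span ?S"
    using assms by (intro pv.span_diff pv.span_sum pv.span_scale pv.span_base) auto
  then show ?thesis by (simp add: cell_basis.simps(2))
qed

text \<open>The rows of an ideal of monomials that contains all monomials of degree at least \<open>N\<close>.\<close>

locale staircase =
  fixes D :: "nat \<Rightarrow> nat set" and N :: nat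
  assumes D_le: "b \<in> D n \<Longrightarrow> b \<le> n"
    and D_Suc: "b \<in> D n \<Longrightarrow> b \<in> D (Suc n)"
    and Suc_D: "b \<in> D n \<Longrightarrow> Suc b \<in> D (Suc n)"
    and D_full: "N \<le> n \<Longrightarrow> D n = {..n}"
begin

definition entry :: "nat \<Rightarrow> nat" where "entry b = (LEAST n. b \<in> D n)"

lemma D_mono: "m \<le> n \<Longrightarrow> D m \<subseteq> D n"
  by (rule lift_Suc_mono_le[of D]) (auto dest: D_Suc)

lemma finite_D [simp]: "finite (D n)"
  using D_le by (rule_tac finite_subset[of _ "{..n}"]) auto

lemma D_iff_entry: "b \<in> D n \<longleftrightarrow> entry b \<le> n"
proof
  assume "b \<in> D n" then show "entry b \<le> n" unfolding entry_def by (rule Least_le)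
next
  have "b \<in> D (max N b)" using D_full[of "max N b"] by auto
  then have "b \<in> D (entry b)" unfolding entry_def by (rule LeastI)
  moreover assume "entry b \<le> n"
  ultimately show "b \<in> D n" using D_mono by auto
qed

lemma entry_Suc_le: "entry (Suc b) \<le> Suc (entry b)"
  using Suc_D[of b "entry b"] by (simp add: D_iff_entry)

lemma entering_iff: "b \<in> entering D n \<longleftrightarrow> entry b = n"
  by (auto simp: entering_def D_iff_entry split: nat.splits)

lemma finite_entering [simp]: "finite (entering D n)"
  by (simp add: entering_def)

lemma D_Suc_eq: "D (Suc n) = D n \<union> entering D (Suc n)" "D n \<inter> entering D (Suc n) = {}"
  using D_Suc by (auto simp: entering_def)

lemma D_eq_entry: "D n = {c. entry c \<le> n}"
  by (auto simp: D_iff_entry)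

abbreviation basis :: "(nat \<times> nat \<Rightarrow> 'k::field) \<Rightarrow> nat \<Rightarrow> 'k poly" where
  "basis \<equiv> cell_basis entry"

definition cell_slices :: "(nat \<times> nat \<Rightarrow> 'k::field) \<Rightarrow> nat \<Rightarrow> 'k poly set" where
  "cell_slices a n = pv.span (basis a ` D n)"

definition cell_ideal :: "(nat \<times> nat \<Rightarrow> 'k::field) \<Rightarrow> 'k bipoly set" where
  "cell_ideal a = ideal_of_slices (cell_slices a)"

lemma basis_nz: "degree (basis a b) = b \<and> basis a b \<noteq> 0"
  using degree_cell_basis cell_basis_nz by blast

lemma basis_in_slices: "b \<in> D n \<Longrightarrow> basis a b \<in> cell_slices a n"
  unfolding cell_slices_def by (intro pv.span_base imageI)

lemma pCons_basis_in_slices: "b \<in> D n \<Longrightarrow> pCons 0 (basis a b) \<in> cell_slices a (Suc n)"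
  unfolding cell_slices_def
  by (rule subsetD[OF pv.span_mono pCons_cell_basis_in_span[of entry b a, OF entry_Suc_le]]) (auto simp: D_iff_entry)

lemma slice_system_cell_slices: "slice_system (cell_slices a)"
  unfolding slice_system_def
proof (intro allI ballI conjI)
  fix n show "pv.subspace (cell_slices a n)" by (simp add: cell_slices_def)
  fix g assume g: "g \<in> cell_slices a n"
  have "cell_slices a n \<subseteq> {g. degree g \<le> n}"
    unfolding cell_slices_def using subspace_degree_le D_le by (intro pv.span_minimal) (auto simp: basis_nz)
  then show "degree g \<le> n" using g by auto
  have "cell_slices a n \<subseteq> cell_slices a (Suc n)"
    unfolding cell_slices_def using D_Suc by (intro pv.span_mono image_mono) auto
  then show "g \<in> cell_slices a (Suc n)" using g by auto
  have "pv.subspace {g. pCons 0 g \<in> cell_slices a (Suc n)}"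
    by (rule subspace_pCons_vimage) (simp add: cell_slices_def)
  then have "cell_slices a n \<subseteq> {g. pCons 0 g \<in> cell_slices a (Suc n)}"
    using pCons_basis_in_slices unfolding cell_slices_def[of a n] by (intro pv.span_minimal) auto
  then show "pCons 0 g \<in> cell_slices a (Suc n)" using g by auto
qed

lemma slice_cell_ideal: "slice (cell_ideal a) n = cell_slices a n"
  unfolding cell_ideal_def by (rule slice_ideal_of_slices[OF slice_system_cell_slices])

lemma graded_cell_ideal: "graded_ideal (cell_ideal a)"
  unfolding cell_ideal_def by (rule graded_ideal_of_slices[OF slice_system_cell_slices])

lemma cell_ideal_in_cell: "cell_ideal a \<in> degree_cell D"
  unfolding degree_cell_def using graded_cell_ideal
  by (auto simp: slice_cell_ideal cell_slices_def echelon_degrees[OF finite_D basis_nz])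

text \<open>Every ideal of the cell is reached. Choose monic elements \<open>h b\<close> of degree \<open>b\<close> in the first slice that
  contains one. Then \<open>h (Suc b) - y h b\<close> lies in the slice of degree \<open>Suc (entry b)\<close> and has degree at
  most \<open>b\<close>, hence is a combination of the \<open>h c\<close> that the recursion allows.\<close>

lemma degree_cell_eq_cell_ideal:
  fixes I :: "'k::field bipoly set"
  assumes "I \<in> degree_cell D"
  obtains a where "I = cell_ideal a"
proof -
  have I: "graded_ideal I" and deg: "\<And>n. degree ` (slice I n - {0}) = D n"
    using assms by (auto simp: degree_cell_def)
  have W: "slice_system (slice I)" by (rule slice_system_slice[OF I])
  have "\<exists>h. degree h = b \<and> lead_coeff h = 1 \<and> h \<in> slice I (entry b)" for b
  proof -
    have "b \<in> degree ` (slice I (entry b) - {0})" using deg D_iff_entry by auto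
    then obtain h where h: "h \<in> slice I (entry b)" "h \<noteq> 0" "degree h = b" by auto
    then have "smult (inverse (lead_coeff h)) h \<in> slice I (entry b)"
      using slice_systemD(1)[OF W] by (intro pv.subspace_scale)
    moreover have "lead_coeff (smult (inverse (lead_coeff h)) h) = 1" using h(2) by simp
    ultimately show ?thesis using h by (intro exI[of _ "smult (inverse (lead_coeff h)) h"]) auto
  qed
  then obtain h where h: "\<And>b. degree (h b) = b" "\<And>b. lead_coeff (h b) = 1" "\<And>b. h b \<in> slice I (entry b)"
    by metis
  have h': "h b \<in> slice I n" if "b \<in> D n" for b n
    using h(3)[of b] that slice_system_mono[OF W, of "entry b" n] D_iff_entry by auto
  have hnz: "h b \<noteq> 0" for b using h(2)[of b] by auto
  have "\<exists>u. h (Suc b) - pCons 0 (h b) = (\<Sum>c\<in>{c. c \<le> b \<and> entry c \<le> Suc (entry b)}. smult (u c) (h c))" for b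
  proof -
    let ?A = "{c. c \<le> b \<and> entry c \<le> Suc (entry b)}"
    let ?n = "Suc (entry b)"
    let ?V = "{v \<in> slice I ?n. degree v \<le> b}"
    have "pv.subspace ?V"
      using pv.subspace_inter[OF slice_systemD(1)[OF W, of ?n] subspace_degree_le[of b]]
      by (simp add: Int_def)
    moreover have "degree ` (?V - {0}) \<subseteq> ?A" using deg[of ?n] D_eq_entry by auto
    moreover have "h c \<in> ?V" if "c \<in> ?A" for c using that h' h(1) D_iff_entry by auto
    ultimately have V: "?V = pv.span (h ` ?A)" using h(1) hnz by (intro echelon_span) auto
    have "h (Suc b) - pCons 0 (h b) \<in> slice I ?n"
      using h'[of "Suc b" ?n] entry_Suc_le[of b] D_iff_entry h(3)[of b] slice_systemD[OF W]
      by (intro pv.subspace_diff) auto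
    moreover have "degree (h (Suc b) - pCons 0 (h b)) \<le> b"
    proof (rule degree_le, intro allI impI)
      fix k assume "b < k"
      then consider "k = Suc b" | "k > Suc b" by linarith
      then show "coeff (h (Suc b) - pCons 0 (h b)) k = 0"
        using h(1,2)[of b] h(1,2)[of "Suc b"] hnz[of b]
        by cases (auto simp: coeff_eq_0 coeff_pCons split: nat.splits)
    qed
    ultimately have "h (Suc b) - pCons 0 (h b) \<in> pv.span (h ` ?A)" using V by blast
    moreover have "finite ?A" by simp
    moreover have "inj_on h ?A" using h(1) by (metis inj_onI)
    ultimately show ?thesis using span_image_eq by metis
  qed
  then obtain u where u: "\<And>b. h (Suc b) - pCons 0 (h b) = (\<Sum>c\<in>{c. c \<le> b \<and> entry c \<le> Suc (entry b)}. smult (u b c) (h c))"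
    by metis
  define a where "a = (\<lambda>(b, c). u b c)"
  have basis: "basis a b = h b" for b
  proof (induction b rule: less_induct)
    case (less b)
    show ?case
    proof (cases b)
      case 0
      have "h 0 = 1" using h(1,2)[of 0] by (metis degree_eq_zeroE lead_coeff_pCons(2) one_pCons)
      then show ?thesis using 0 by simp
    next
      case (Suc m)
      have "basis a b = pCons 0 (h m) + (\<Sum>c\<in>{c. c \<le> m \<and> entry c \<le> Suc (entry m)}. smult (u m c) (h c))"
        using less Suc by (simp add: cell_basis.simps(2) a_def)
      then show ?thesis using u[of m] Suc by (simp add: algebra_simps)
    qed
  qed
  have "slice I n = cell_slices a n" for n
    unfolding cell_slices_def using slice_systemD(1)[OF W] deg h' basis basis_nz[of a]
    by (intro echelon_span) auto
  then have "I = cell_ideal a"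
    using graded_ideal_eq_iff[OF I graded_cell_ideal] slice_cell_ideal by blast
  then show ?thesis by (rule that)
qed

lemma dim_slice_degree_cell: "I \<in> degree_cell D \<Longrightarrow> pv.dim (slice I n) = card (D n)"
  using dim_eq_card_degrees[of "slice I n"] slice_systemD(1)[OF slice_system_slice, of I n]
  by (auto simp: degree_cell_def)

lemma slice_full_degree_cell:
  assumes I: "I \<in> degree_cell D" and n: "N \<le> n"
  shows "slice I n = {g. degree g \<le> n}"
proof (rule pv.subspace_eq_of_dim_eq)
  show "pv.subspace (slice I n)"
    using I slice_systemD(1)[OF slice_system_slice] by (auto simp: degree_cell_def)
  show "pv.dim {g :: 'a poly. degree g \<le> n} \<le> pv.dim (slice I n)"
    unfolding dim_slice_degree_cell[OF I] dim_degree_le D_full[OF n] by simp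
qed (use degree_le_subset_span in \<open>auto simp: slice_def\<close>)

text \<open>In degree \<open>0\<close> nothing is decomposable, which accounts for the first summand.\<close>

definition generic_generators :: nat where
  "generic_generators = card (D 0) + (\<Sum>n<N. staircase_defect (entering D n) (entering D (Suc n)))"

lemma min_generators_degree_cell:
  assumes I: "I \<in> degree_cell D"
  shows "min_generators I = card (D 0) + (\<Sum>n<N. card (D (Suc n)) - pv.dim (decomposables (slice I) (Suc n)))"
proof -
  have "min_generators I = (\<Sum>n\<le>N. pv.dim (slice I n) - pv.dim (decomposables (slice I) n))"
    using I by (intro min_generators_eq slice_full_degree_cell) (auto simp: degree_cell_def)
  also have "\<dots> = (\<Sum>n\<le>N. card (D n) - pv.dim (decomposables (slice I) n))"
    by (simp add: dim_slice_degree_cell[OF I])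
  also have "\<dots> = card (D 0) - pv.dim (decomposables (slice I) 0) + (\<Sum>n<N. card (D (Suc n)) - pv.dim (decomposables (slice I) (Suc n)))"
    by (rule sum.atMost_shift)
  also have "pv.dim (decomposables (slice I) 0) = 0"
    using pv.dim_span_eq_card_independent[OF pv.independent_empty] by (simp add: decomposables_def del: pv.dim_span)
  finally show ?thesis by simp
qed

lemma card_D_Suc: "card (D (Suc n)) = card (D n) + card (entering D (Suc n))"
  unfolding D_Suc_eq(1) using D_Suc_eq(2) by (intro card_Un_disjoint) auto

text \<open>Only the \<open>y g\<^sub>b\<close> with \<open>b\<close> entering in degree \<open>n\<close> can leave the slice of degree \<open>n\<close>, and for \<open>Suc b < t\<close> they stay in the
  span of the \<open>g\<^sub>c\<close> with \<open>c < t\<close>. So at most \<open>|{b. t \<le> Suc b}|\<close> of the new rows \<open>c \<ge> t\<close> are hit.\<close>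

lemma staircase_defect_le_new_generators:
  assumes I: "I \<in> degree_cell D"
  shows "staircase_defect (entering D n) (entering D (Suc n)) \<le> card (D (Suc n)) - pv.dim (decomposables (slice I) (Suc n))"
proof -
  obtain a where a: "I = cell_ideal a" using degree_cell_eq_cell_ideal[OF I] by blast
  obtain t where t: "staircase_defect (entering D n) (entering D (Suc n)) = staircase_excess (entering D n) (entering D (Suc n)) t"
    by (rule staircase_defect_attained[OF finite_entering])
  let ?g = "basis a"
  let ?X = "D n \<union> {c \<in> entering D (Suc n). c < t}" and ?Y = "{b \<in> entering D n. t \<le> Suc b}"
  let ?S = "?g ` ?X \<union> (\<lambda>b. pCons 0 (?g b)) ` ?Y"
  have slice: "slice I n = pv.span (?g ` D n)" by (simp add: a slice_cell_ideal cell_slices_def)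
  have sub_n: "slice I n \<subseteq> pv.span ?S" unfolding slice by (intro pv.span_mono) auto
  have pc: "pCons 0 (?g b) \<in> pv.span ?S" if b: "b \<in> D n" for b
  proof -
    consider "b \<in> ?Y" | "entry b < n" | "entry b = n" "Suc b < t"
      using b by (auto simp: D_iff_entry entering_iff) linarith
    then show ?thesis
    proof cases
      case 1 then show ?thesis by (intro pv.span_base) auto
    next
      case 2
      then obtain m where m: "n = Suc m" "b \<in> D m" by (cases n) (auto simp: D_iff_entry)
      then have "pCons 0 (?g b) \<in> slice I n"
        using pCons_basis_in_slices[of b m a] by (simp add: a slice_cell_ideal)
      then show ?thesis using sub_n by auto
    next
      case 3
      then have "{c. c \<le> Suc b \<and> entry c \<le> Suc (entry b)} \<subseteq> ?X"
        by (auto simp: D_iff_entry entering_iff)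
      then have "pv.span (?g ` {c. c \<le> Suc b \<and> entry c \<le> Suc (entry b)}) \<subseteq> pv.span ?S"
        by (intro pv.span_mono) auto
      then show ?thesis using pCons_cell_basis_in_span[of entry b a, OF entry_Suc_le] by blast
    qed
  qed
  have "pv.subspace {g. pCons 0 g \<in> pv.span ?S}" by (rule subspace_pCons_vimage) simp
  then have "slice I n \<subseteq> {g. pCons 0 g \<in> pv.span ?S}"
    unfolding slice using pc by (intro pv.span_minimal) auto
  then have "decomposables (slice I) (Suc n) \<subseteq> pv.span ?S"
    unfolding decomposables_def nat.case using sub_n by (intro pv.span_minimal) auto
  then have "pv.dim (decomposables (slice I) (Suc n)) \<le> card ?S"
    by (rule pv.dim_le_card) simp
  also have "\<dots> \<le> card ?X + card ?Y"
    by (rule le_trans[OF card_Un_le add_mono]) (auto intro!: card_image_le)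
  also have "card ?X = card (D n) + card {c \<in> entering D (Suc n). c < t}"
    using D_Suc_eq(2)[of n] by (intro card_Un_disjoint) auto
  finally have *: "pv.dim (decomposables (slice I) (Suc n)) \<le> card (D n) + card {c \<in> entering D (Suc n). c < t} + card ?Y" .
  have "card (entering D (Suc n)) = card ({c \<in> entering D (Suc n). c < t} \<union> {c \<in> entering D (Suc n). t \<le> c})"
    by (rule arg_cong[of _ _ card]) auto
  also have "\<dots> = card {c \<in> entering D (Suc n). c < t} + card {c \<in> entering D (Suc n). t \<le> c}"
    by (intro card_Un_disjoint) auto
  finally show ?thesis using * card_D_Suc[of n] unfolding t staircase_excess_def by linarith
qed

lemma generic_generators_le: "I \<in> degree_cell D \<Longrightarrow> generic_generators \<le> min_generators I"
  unfolding generic_generators_def min_generators_degree_cell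
  by (intro add_left_mono sum_mono staircase_defect_le_new_generators)

text \<open>Put the parameters at the matched pairs equal to \<open>1\<close> and all others equal to \<open>0\<close>. Modulo the slice of
  degree \<open>n\<close>, multiplication by \<open>y\<close> then sends \<open>g\<^sub>b\<close> to plus or minus \<open>g\<^sub>c\<close> for a matched pair \<open>(b, c)\<close>. Pairs in
  different degrees use different parameters, so one choice serves all degrees.\<close>

lemma exists_generic_generators:
  obtains a :: "nat \<times> nat \<Rightarrow> 'k::field" where "min_generators (cell_ideal a) = generic_generators"
proof -
  define matching where "matching n \<mu> R \<longleftrightarrow>
    R \<subseteq> entering D n \<and> inj_on \<mu> R \<and> \<mu> ` R \<subseteq> entering D (Suc n) \<and> (\<forall>b\<in>R. \<mu> b \<le> Suc b) \<and>
    (\<forall>b\<in>entering D n. Suc b \<in> entering D (Suc n) \<longrightarrow> b \<in> R \<and> \<mu> b = Suc b) \<and>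
    card (entering D (Suc n)) - card R \<le> staircase_defect (entering D n) (entering D (Suc n))" for n \<mu> R
  have "\<exists>\<mu> R. matching n \<mu> R" for n
  proof -
    obtain R \<mu> where "R \<subseteq> entering D n" "inj_on \<mu> R" "\<mu> ` R \<subseteq> entering D (Suc n)" "\<And>b. b \<in> R \<Longrightarrow> \<mu> b \<le> Suc b"
      "\<And>b. b \<in> entering D n \<Longrightarrow> Suc b \<in> entering D (Suc n) \<Longrightarrow> b \<in> R \<and> \<mu> b = Suc b"
      "card (entering D (Suc n)) - card R \<le> staircase_defect (entering D n) (entering D (Suc n))"
      by (rule exists_staircase_matching[OF finite_entering[of n] finite_entering[of "Suc n"]]) (rule that)
    then have "matching n \<mu> R" by (simp add: matching_def)
    then show ?thesis by blast
  qed
  then obtain \<mu> R where M: "\<And>n. matching n (\<mu> n) (R n)" by metis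
  have \<mu>: "R n \<subseteq> entering D n" "inj_on (\<mu> n) (R n)" "\<mu> n ` R n \<subseteq> entering D (Suc n)"
    "b \<in> R n \<Longrightarrow> \<mu> n b \<le> Suc b"
    "b \<in> entering D n \<Longrightarrow> Suc b \<in> entering D (Suc n) \<Longrightarrow> b \<in> R n \<and> \<mu> n b = Suc b"
    "card (entering D (Suc n)) - card (R n) \<le> staircase_defect (entering D n) (entering D (Suc n))" for n b
    using M[of n] by (simp_all add: matching_def)
  \<comment> \<open>The recursion ignores \<open>a (b, Suc b)\<close>, so the matched pairs \<open>(b, Suc b)\<close> keep their constant entry.\<close>
  define a :: "nat \<times> nat \<Rightarrow> 'k" where
    "a = (\<lambda>(b, c). if b \<in> R (entry b) \<and> c = \<mu> (entry b) b then 1 else 0)"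
  have "card (D (Suc n)) - pv.dim (decomposables (slice (cell_ideal a)) (Suc n)) \<le>
      staircase_defect (entering D n) (entering D (Suc n))" for n
  proof -
    let ?W = "slice (cell_ideal a)" and ?g = "basis a"
    let ?X = "D n \<union> \<mu> n ` R n"
    have fR: "finite (R n)" using \<mu>(1) finite_entering finite_subset by blast
    have W: "slice_system ?W" by (simp add: slice_system_slice graded_cell_ideal)
    have base: "?g b \<in> decomposables ?W (Suc n)" "pCons 0 (?g b) \<in> decomposables ?W (Suc n)" if "b \<in> D n" for b
      using that basis_in_slices[of b n a] by (auto simp: decomposables_def slice_cell_ideal intro: pv.span_base)
    have matched: "?g (\<mu> n b) \<in> decomposables ?W (Suc n)" if b: "b \<in> R n" for b
    proof -
      let ?c = "\<mu> n b"
      have e: "entry b = n" "entry ?c = Suc n" using \<mu>(1)[of n] \<mu>(3)[of n] b by (auto simp: entering_iff)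
      have b_n: "b \<in> D n" using e by (simp add: D_iff_entry)
      let ?A = "{c. c \<le> b \<and> entry c \<le> Suc (entry b)}"
      have sum: "(\<Sum>c\<in>?A. smult (a (b, c)) (?g c)) = (if ?c \<le> b then ?g ?c else 0)"
      proof -
        have "(\<Sum>c\<in>?A. smult (a (b, c)) (?g c)) = (\<Sum>c\<in>?A. if c = ?c then ?g ?c else 0)"
          using b e by (intro sum.cong) (auto simp: a_def)
        also have "\<dots> = (if ?c \<le> b then ?g ?c else 0)" using e by (simp add: sum.delta)
        finally show ?thesis .
      qed
      then have rec: "?g (Suc b) = pCons 0 (?g b) + (if ?c \<le> b then ?g ?c else 0)"
        by (simp add: cell_basis.simps(2))
      show ?thesis
      proof (cases "?c \<le> b")
        case False
        then have "?c = Suc b" using \<mu>(4)[OF b] by auto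
        then show ?thesis using rec base(2)[OF b_n] False by simp
      next
        case True
        have "Suc b \<notin> entering D (Suc n)" using \<mu>(5)[of b n] True e by (auto simp: entering_iff)
        then have "Suc b \<in> D n" using entry_Suc_le[of b] e by (auto simp: entering_iff D_iff_entry)
        moreover have "?g ?c = ?g (Suc b) - pCons 0 (?g b)" using rec True by simp
        ultimately show ?thesis
          using base b_n subspace_decomposables pv.subspace_diff by metis
      qed
    qed
    have "pv.span (?g ` ?X) \<subseteq> decomposables ?W (Suc n)"
      using base matched by (intro pv.span_minimal subspace_decomposables) auto
    moreover have "decomposables ?W (Suc n) \<subseteq> pv.span (monom 1 ` {..Suc n})"
      using decomposables_subset[OF W] slice_subset_span by blast
    ultimately have "pv.dim (pv.span (?g ` ?X)) \<le> pv.dim (decomposables ?W (Suc n))"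
      by (rule pv.dim_mono_of_finite) simp
    moreover have "pv.dim (pv.span (?g ` ?X)) = card ?X"
      using echelon_independent[of ?X ?g] basis_nz[of a] fR
      by (simp add: pv.dim_span_eq_card_independent card_image del: pv.dim_span)
    moreover have "card ?X = card (D n) + card (R n)"
    proof -
      have "card ?X = card (D n) + card (\<mu> n ` R n)"
        using D_Suc_eq(2)[of n] \<mu>(3)[of n] fR by (intro card_Un_disjoint) auto
      then show ?thesis using card_image[OF \<mu>(2)] by simp
    qed
    ultimately show ?thesis using \<mu>(6)[of n] card_D_Suc[of n] by linarith
  qed
  then have "min_generators (cell_ideal a) \<le> generic_generators"
    unfolding generic_generators_def min_generators_degree_cell[OF cell_ideal_in_cell]
    by (intro add_left_mono sum_mono)
  then have "min_generators (cell_ideal a) = generic_generators"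
    using generic_generators_le[OF cell_ideal_in_cell] by (rule antisym)
  then show ?thesis by (rule that)
qed

end

section \<open>Jordan cells\<close>

text \<open>Membership in a monomial ideal can be tested on the monomials of a polynomial.\<close>

lemma span_monomials:
  "ideal.span (monomial ` S :: 'k::field bipoly set) =
     {f. \<forall>\<mu>\<in>Poly_Mapping.keys f. \<exists>\<nu>\<in>S. fst \<nu> \<le> fst \<mu> \<and> snd \<nu> \<le> snd \<mu>}" (is "_ = ?J")
proof
  have "ideal.subspace ?J"
    unfolding ideal.subspace_def
  proof (intro conjI allI impI ballI)
    fix f g :: "'k bipoly" assume "f \<in> ?J" "g \<in> ?J"
    then show "f + g \<in> ?J" using Poly_Mapping.keys_add[of f g] by blast
  next
    fix r f :: "'k bipoly" assume f: "f \<in> ?J"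
    show "r * f \<in> ?J"
    proof (clarify)
      fix a b assume "(a, b) \<in> Poly_Mapping.keys (r * f)"
      then obtain \<kappa> \<mu> where \<mu>: "\<mu> \<in> Poly_Mapping.keys f" "(a, b) = \<kappa> + \<mu>"
        using keys_mult[of r f] by blast
      obtain \<nu> where "\<nu> \<in> S" "fst \<nu> \<le> fst \<mu>" "snd \<nu> \<le> snd \<mu>" using f \<mu> by blast
      moreover have "a = fst \<kappa> + fst \<mu>" "b = snd \<kappa> + snd \<mu>" using \<mu>(2) by (auto simp: prod_eq_iff)
      ultimately show "\<exists>\<nu>\<in>S. fst \<nu> \<le> fst (a, b) \<and> snd \<nu> \<le> snd (a, b)"
        by (intro bexI[of _ \<nu>]) auto
    qed
  qed simp
  moreover have "monomial ` S \<subseteq> ?J" by (auto simp: monomial_def)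
  ultimately show "ideal.span (monomial ` S) \<subseteq> ?J" by (intro ideal.span_minimal)
  show "?J \<subseteq> ideal.span (monomial ` S)"
  proof
    fix f assume f: "f \<in> ?J"
    have "Poly_Mapping.single \<mu> (Poly_Mapping.lookup f \<mu>) \<in> ideal.span (monomial ` S)"
      if \<mu>: "\<mu> \<in> Poly_Mapping.keys f" for \<mu>
    proof -
      obtain \<nu> where \<nu>: "\<nu> \<in> S" "fst \<nu> \<le> fst \<mu>" "snd \<nu> \<le> snd \<mu>" using f \<mu> by blast
      have "Poly_Mapping.single \<mu> (Poly_Mapping.lookup f \<mu>) =
          Poly_Mapping.single (fst \<mu> - fst \<nu>, snd \<mu> - snd \<nu>) (Poly_Mapping.lookup f \<mu>) * monomial \<nu>"
        using \<nu> by (simp add: monomial_def mult_single plus_prod_def)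
      then show ?thesis using \<nu>(1) by (simp add: ideal.span_scale ideal.span_base)
    qed
    then have "(\<Sum>\<mu>\<in>Poly_Mapping.keys f. Poly_Mapping.single \<mu> (Poly_Mapping.lookup f \<mu>)) \<in> ideal.span (monomial ` S)"
      by (intro ideal.span_sum)
    then show "f \<in> ideal.span (monomial ` S)" by (simp add: sum_of_singles)
  qed
qed

lemma monomial_in_span_iff:
  "(monomial \<mu> :: 'k::field bipoly) \<in> ideal.span (monomial ` S) \<longleftrightarrow> (\<exists>\<nu>\<in>S. fst \<nu> \<le> fst \<mu> \<and> snd \<nu> \<le> snd \<mu>)"
  unfolding span_monomials by (simp add: monomial_def)

definition upward_closed :: "mono set \<Rightarrow> bool" where
  "upward_closed S \<longleftrightarrow> (\<forall>a b. (a, b) \<in> S \<longrightarrow> (Suc a, b) \<in> S \<and> (a, Suc b) \<in> S)"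

lemma upward_closedD:
  assumes S: "upward_closed S" and \<nu>: "\<nu> \<in> S" "fst \<nu> \<le> fst \<mu>" "snd \<nu> \<le> snd \<mu>"
  shows "\<mu> \<in> S"
proof -
  have 1: "(a + i, b) \<in> S" if "(a, b) \<in> S" for a b i
    using that S by (induction i) (auto simp: upward_closed_def)
  have 2: "(a, b + i) \<in> S" if "(a, b) \<in> S" for a b i
    using that S by (induction i) (auto simp: upward_closed_def)
  have "(fst \<nu> + (fst \<mu> - fst \<nu>), snd \<nu> + (snd \<mu> - snd \<nu>)) \<in> S"
    using \<nu> by (intro 1 2) simp
  then show ?thesis using \<nu> by simp
qed

lemma monomial_in_span_upward_closed:
  "upward_closed S \<Longrightarrow> (monomial \<mu> :: 'k::field bipoly) \<in> ideal.span (monomial ` S) \<longleftrightarrow> \<mu> \<in> S"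
  unfolding monomial_in_span_iff using upward_closedD[of S _ \<mu>] by blast

lemma span_monomials_eq_iff:
  assumes "upward_closed S" "upward_closed S'"
  shows "(ideal.span (monomial ` S) :: 'k::field bipoly set) = ideal.span (monomial ` S') \<longleftrightarrow> S = S'"
  using monomial_in_span_upward_closed[OF assms(1), where 'k='k] monomial_in_span_upward_closed[OF assms(2), where 'k='k]
  by auto

definition initial_monomials :: "'k::field bipoly set \<Rightarrow> mono set" where
  "initial_monomials I = {(a, b). b \<in> degree ` (slice I (a + b) - {0})}"

lemma initial_monomials_iff:
  "(a, b) \<in> initial_monomials I \<longleftrightarrow> (\<exists>g \<in> slice I (a + b). g \<noteq> 0 \<and> degree g = b)"
  unfolding initial_monomials_def by blast

lemma upward_closed_initial_monomials:
  assumes I: "graded_ideal I" shows "upward_closed (initial_monomials I)"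
  unfolding upward_closed_def
proof (intro allI impI)
  fix a b assume "(a, b) \<in> initial_monomials I"
  then obtain g where g: "g \<in> slice I (a + b)" "g \<noteq> 0" "degree g = b" unfolding initial_monomials_iff by blast
  have W: "slice_system (slice I)" by (rule slice_system_slice[OF I])
  have "g \<in> slice I (Suc a + b)" "pCons 0 g \<in> slice I (a + Suc b)" "degree (pCons 0 g) = Suc b" "pCons 0 g \<noteq> 0"
    using g slice_systemD(3,4)[OF W g(1)] by auto
  then show "(Suc a, b) \<in> initial_monomials I \<and> (a, Suc b) \<in> initial_monomials I"
    using g unfolding initial_monomials_iff by blast
qed

lemma initial_ideal_eq:
  fixes I :: "'k::field bipoly set"
  assumes I: "graded_ideal I"
  shows "initial_ideal I = ideal.span (monomial ` initial_monomials I)"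
proof -
  have "(\<exists>f n. f \<in> I \<and> form_of_degree n f \<and> \<mu> \<in> Poly_Mapping.keys f \<and> (\<forall>\<nu>\<in>Poly_Mapping.keys f. snd \<nu> \<le> snd \<mu>)) \<longleftrightarrow>
      \<mu> \<in> initial_monomials I" (is "?L \<longleftrightarrow> ?R") for \<mu>
  proof
    assume ?L
    then obtain f n where f: "f \<in> I" "form_of_degree n f" "\<mu> \<in> Poly_Mapping.keys f"
      "\<And>\<nu>. \<nu> \<in> Poly_Mapping.keys f \<Longrightarrow> snd \<nu> \<le> snd \<mu>" by auto
    have n: "fst \<mu> + snd \<mu> = n" using f(2,3) by (auto simp: form_of_degree_def mdeg_def)
    let ?g = "dehomogenize n f"
    have c: "coeff ?g (snd \<mu>) \<noteq> 0" using f(3) n by (auto simp: coeff_dehomogenize in_keys_iff)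
    moreover have "coeff ?g k = 0" if "k > snd \<mu>" for k
      using f(4)[of "(n - k, k)"] that by (auto simp: coeff_dehomogenize in_keys_iff)
    ultimately have "degree ?g = snd \<mu>" by (intro antisym degree_le le_degree) auto
    moreover have "?g \<in> slice I n" using f(1) graded_ideal_mem_iff[OF I] by auto
    moreover have "?g \<noteq> 0" using c by auto
    ultimately have "(fst \<mu>, snd \<mu>) \<in> initial_monomials I" unfolding initial_monomials_iff n by blast
    then show ?R by simp
  next
    assume ?R
    then have "(fst \<mu>, snd \<mu>) \<in> initial_monomials I" by simp
    then obtain g where g: "g \<in> slice I (mdeg \<mu>)" "g \<noteq> 0" "degree g = snd \<mu>"
      unfolding initial_monomials_iff mdeg_def by blast
    let ?f = "homogenize (mdeg \<mu>) g"
    have "\<mu> \<in> Poly_Mapping.keys ?f" using g by (auto simp: in_keys_iff lookup_homogenize simp flip: g(3))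
    moreover have "snd \<nu> \<le> snd \<mu>" if "\<nu> \<in> Poly_Mapping.keys ?f" for \<nu>
      using that le_degree[of g "snd \<nu>"] g(3) by (auto simp: in_keys_iff lookup_homogenize split: if_splits)
    moreover have "?f \<in> I" using g(1) by (simp add: slice_def)
    ultimately show ?L using form_of_degree_homogenize[of "mdeg \<mu>" g] by blast
  qed
  then have "{monomial \<mu> :: 'k bipoly |\<mu> f n. f \<in> I \<and> form_of_degree n f \<and> \<mu> \<in> Poly_Mapping.keys f \<and>
     (\<forall>\<nu>\<in>Poly_Mapping.keys f. snd \<nu> \<le> snd \<mu>)} = monomial ` initial_monomials I"
    by (auto simp: image_iff)
  then show ?thesis unfolding initial_ideal_def by simp
qed

text \<open>The diagonal of degree \<open>n\<close> of the complement of the Ferrers diagram, recorded by its rows.\<close>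

definition diagonal_rows :: "nat list \<Rightarrow> nat \<Rightarrow> nat set" where
  "diagonal_rows P n = {b. b \<le> n \<and> (n - b, b) \<in> E P}"

lemma upward_closed_E:
  assumes P: "is_partition P" shows "upward_closed (E P)"
proof -
  have "P ! b \<ge> P ! Suc b" if "Suc b < length P" for b
    using P that by (auto simp: is_partition_def sorted_wrt_iff_nth_less)
  then show ?thesis
    by (force simp: upward_closed_def E_def C_def)
qed

lemma staircase_diagonal_rows:
  assumes P: "is_partition P"
  obtains N where "staircase (diagonal_rows P) N"
proof -
  have up: "upward_closed (E P)" by (rule upward_closed_E[OF P])
  have "(a, b) \<in> E P" if "a + b \<ge> length P + sum_list P" for a b
  proof (rule ccontr)
    assume "(a, b) \<notin> E P"
    then have "b < length P" "a < P ! b" by (auto simp: E_def C_def)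
    moreover from this have "P ! b \<le> sum_list P" by (intro member_le_sum_list) auto
    ultimately show False using that by linarith
  qed
  then have "staircase (diagonal_rows P) (length P + sum_list P)"
    using up by unfold_locales
      (auto simp: diagonal_rows_def upward_closed_def Suc_diff_le)
  then show ?thesis by (rule that)
qed

lemma initial_monomials_eq_E_iff:
  "initial_monomials I = E P \<longleftrightarrow> (\<forall>n. degree ` (slice I n - {0}) = diagonal_rows P n)"
proof
  assume eq: "initial_monomials I = E P"
  show "\<forall>n. degree ` (slice I n - {0}) = diagonal_rows P n"
  proof (intro allI set_eqI)
    fix n b
    have "b \<in> degree ` (slice I n - {0}) \<longleftrightarrow> b \<le> n \<and> (n - b, b) \<in> initial_monomials I"
      by (auto simp: initial_monomials_def slice_def)
    then show "b \<in> degree ` (slice I n - {0}) \<longleftrightarrow> b \<in> diagonal_rows P n"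
      using eq by (simp add: diagonal_rows_def)
  qed
next
  assume "\<forall>n. degree ` (slice I n - {0}) = diagonal_rows P n"
  then show "initial_monomials I = E P" by (auto simp: initial_monomials_def diagonal_rows_def)
qed

lemma jordan_cell_eq:
  assumes P: "is_partition P"
  shows "jordan_cell P = degree_cell (diagonal_rows P)"
proof -
  have "initial_ideal I = E_ideal P \<longleftrightarrow> (\<forall>n. degree ` (slice I n - {0}) = diagonal_rows P n)"
    if I: "graded_ideal I" for I :: "'a bipoly set"
    unfolding initial_ideal_eq[OF I] E_ideal_def
      span_monomials_eq_iff[OF upward_closed_initial_monomials[OF I] upward_closed_E[OF P]]
    by (rule initial_monomials_eq_E_iff)
  from Collect_cong[OF conj_cong[OF refl this]] show ?thesis
    unfolding jordan_cell_def degree_cell_def .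
qed

lemma E_ideal_eq:
  assumes P: "is_partition P"
  shows "E_ideal P = {f. Poly_Mapping.keys f \<subseteq> E P}"
proof -
  have "(\<exists>\<nu>\<in>E P. fst \<nu> \<le> fst \<mu> \<and> snd \<nu> \<le> snd \<mu>) \<longleftrightarrow> \<mu> \<in> E P" for \<mu>
    using upward_closedD[OF upward_closed_E[OF P], of _ \<mu>] by blast
  then show ?thesis unfolding E_ideal_def span_monomials by (simp add: subset_eq)
qed

lemma E_ideal_in_degree_cell:
  assumes P: "is_partition P" shows "E_ideal P \<in> degree_cell (diagonal_rows P)"
proof -
  have I: "graded_ideal (E_ideal P :: 'a bipoly set)"
    unfolding graded_ideal_def
  proof (intro conjI ballI allI)
    show "ideal.subspace (E_ideal P :: 'a bipoly set)" by (simp add: E_ideal_def)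
    show "homogeneous_component n f \<in> E_ideal P" if "f \<in> E_ideal P" for f :: "'a bipoly" and n
      using that unfolding E_ideal_eq[OF P]
      by (auto simp: subset_iff in_keys_iff lookup_homogeneous_component split: if_splits)
  qed
  have mem: "g \<in> slice (E_ideal P :: 'a bipoly set) n \<longleftrightarrow> degree g \<le> n \<and> (\<forall>b\<le>n. coeff g b \<noteq> 0 \<longrightarrow> (n - b, b) \<in> E P)" for g n
  proof -
    have "Poly_Mapping.keys (homogenize n g) \<subseteq> E P \<longleftrightarrow> (\<forall>b\<le>n. coeff g b \<noteq> 0 \<longrightarrow> (n - b, b) \<in> E P)"
    proof
      assume *: "Poly_Mapping.keys (homogenize n g) \<subseteq> E P"
      have "(n - b, b) \<in> Poly_Mapping.keys (homogenize n g)" if "b \<le> n" "coeff g b \<noteq> 0" for b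
        using that by (simp add: in_keys_iff lookup_homogenize mdeg_def)
      then show "\<forall>b\<le>n. coeff g b \<noteq> 0 \<longrightarrow> (n - b, b) \<in> E P" using * by blast
    next
      assume *: "\<forall>b\<le>n. coeff g b \<noteq> 0 \<longrightarrow> (n - b, b) \<in> E P"
      show "Poly_Mapping.keys (homogenize n g) \<subseteq> E P"
      proof clarify
        fix a b assume "(a, b) \<in> Poly_Mapping.keys (homogenize n g)"
        then have "n = a + b" "coeff g b \<noteq> 0"
          by (auto simp: in_keys_iff lookup_homogenize mdeg_def split: if_splits)
        then show "(a, b) \<in> E P" using *[rule_format, of b] by simp
      qed
    qed
    then show ?thesis unfolding slice_def E_ideal_eq[OF P] by simp
  qed
  have "b \<in> degree ` (slice (E_ideal P :: 'a bipoly set) n - {0}) \<longleftrightarrow> b \<in> diagonal_rows P n" for n b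
  proof
    assume "b \<in> degree ` (slice (E_ideal P :: 'a bipoly set) n - {0})"
    then obtain g where "g \<in> slice (E_ideal P :: 'a bipoly set) n" "g \<noteq> 0" "b = degree g" by auto
    then show "b \<in> diagonal_rows P n" by (auto simp: mem diagonal_rows_def)
  next
    assume "b \<in> diagonal_rows P n"
    then have "monom 1 b \<in> slice (E_ideal P :: 'a bipoly set) n - {0}"
      by (auto simp: mem diagonal_rows_def degree_monom_eq monom_eq_0_iff split: if_splits)
    moreover have "b = degree (monom (1::'a) b)" by (simp add: degree_monom_eq)
    ultimately show "b \<in> degree ` (slice (E_ideal P :: 'a bipoly set) n - {0})" by (rule rev_image_eqI)
  qed
  then show ?thesis using I by (auto simp: degree_cell_def)
qed

lemma diagonal_lengths_eq:
  assumes P: "is_partition P"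
  shows "diagonal_lengths TYPE('k::field) P n = Suc n - card (diagonal_rows P n)"
proof -
  obtain N where "staircase (diagonal_rows P) N" by (rule staircase_diagonal_rows[OF P])
  then interpret staircase "diagonal_rows P" N .
  show ?thesis
    unfolding diagonal_lengths_def hilbert_function_eq
      dim_slice_degree_cell[OF E_ideal_in_degree_cell[OF P]] ..
qed

section \<open>Charts and semicontinuity\<close>

global_interpretation polynomial_functions: function_algebra polynomial_functions
  by unfold_locales (auto intro: polynomial_functions.intros)

text \<open>Polynomials in the parameter of a curve, as functions.\<close>

definition univariate_functions :: "('k::field \<Rightarrow> 'k) set" where
  "univariate_functions = range poly"

global_interpretation univariate_functions: function_algebra univariate_functions
proof
  fix c :: 'a and p q :: "'a \<Rightarrow> 'a"
  have "(\<lambda>a. c) = poly [:c:]" by auto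
  then show "(\<lambda>a. c) \<in> univariate_functions" by (auto simp: univariate_functions_def)
  assume "p \<in> univariate_functions" "q \<in> univariate_functions"
  then obtain f g where "p = poly f" "q = poly g" by (auto simp: univariate_functions_def)
  then have "(\<lambda>a. p a + q a) = poly (f + g)" "(\<lambda>a. p a * q a) = poly (f * g)" by auto
  then show "(\<lambda>a. p a + q a) \<in> univariate_functions" "(\<lambda>a. p a * q a) \<in> univariate_functions"
    by (auto simp: univariate_functions_def)
qed

lemma identity_univariate: "(\<lambda>s :: 'a::field. s) \<in> univariate_functions"
proof -
  have "(\<lambda>s. s) = poly ([:0, 1:] :: 'a poly)" by (simp add: fun_eq_iff)
  then show ?thesis by (auto simp: univariate_functions_def)
qed

lemma finite_zeros_univariate:
  assumes "h \<in> univariate_functions" "h s0 \<noteq> 0" shows "finite {s. h s = 0}"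
proof -
  obtain p where "h = poly p" using assms by (auto simp: univariate_functions_def)
  moreover from this have "p \<noteq> 0" using assms(2) by auto
  ultimately show ?thesis using poly_roots_finite[of p] by simp
qed

lemma independent_of_pivots:
  fixes u :: "'r \<Rightarrow> 'k::field poly"
  assumes A: "finite A" and q: "q \<noteq> 0"
    and u: "\<And>l l'. l \<in> A \<Longrightarrow> l' \<in> A \<Longrightarrow> coeff (u l) (\<kappa> l') = (if l = l' then q else 0)"
  shows "inj_on u A" "pv.independent (u ` A)"
proof -
  have zero: "c l = 0" if c: "(\<Sum>i\<in>A. smult (c i) (u i)) = 0" and l: "l \<in> A" for c l
  proof -
    have "0 = coeff (\<Sum>i\<in>A. smult (c i) (u i)) (\<kappa> l)" using c by simp
    also have "\<dots> = (\<Sum>i\<in>A. if i = l then c l * q else 0)"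
      unfolding coeff_sum using l u by (intro sum.cong) auto
    also have "\<dots> = c l * q" using A l by simp
    finally show ?thesis using q by simp
  qed
  show "inj_on u A" "pv.independent (u ` A)"
    by (rule pv.independent_family[OF A], rule zero, assumption+)+
qed

lemma independent_of_dim_eq_card:
  fixes v :: "'r \<Rightarrow> 'k::field poly"
  assumes A: "finite A" and d: "pv.dim (pv.span (v ` A)) = card A"
  shows "inj_on v A" "pv.independent (v ` A)"
proof -
  obtain B where B: "B \<subseteq> v ` A" "pv.independent B" "v ` A \<subseteq> pv.span B"
    using pv.maximal_independent_subset by blast
  have "pv.span (v ` A) = pv.span B"
    using B pv.span_mono[OF B(1)] pv.span_minimal[OF B(3)] by auto
  then have c: "card B = card A" using d pv.dim_span_eq_card_independent[OF B(2)] by simp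
  have "card B \<le> card (v ` A)" using B(1) A by (intro card_mono) auto
  then have "card (v ` A) = card A" using c card_image_le[OF A, of v] by simp
  then show "inj_on v A" by (rule eq_card_imp_inj_on[OF A])
  have "B = v ` A" using B(1) A c \<open>card (v ` A) = card A\<close> by (intro card_subset_eq) auto
  then show "pv.independent (v ` A)" using B(2) by simp
qed

lemma scalars_zero_of_independent:
  fixes v :: "'r \<Rightarrow> 'k::field poly"
  assumes A: "finite A" "inj_on v A" "pv.independent (v ` A)"
    and c: "(\<Sum>i\<in>A. smult (c i) (v i)) = 0" and i: "i \<in> A"
  shows "c i = 0"
proof -
  have "(\<Sum>x\<in>v ` A. smult (c (inv_into A v x)) x) = (\<Sum>i\<in>A. smult (c (inv_into A v (v i))) (v i))"
    by (simp only: sum.reindex[OF A(2)] o_def)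
  also have "\<dots> = (\<Sum>i\<in>A. smult (c i) (v i))" using A(2) by (intro sum.cong) auto
  finally have "(\<Sum>x\<in>v ` A. smult (c (inv_into A v x)) x) = 0" using c by simp
  from pv.independentD[OF A(3) _ subset_refl this imageI[OF i]] show ?thesis using A i by simp
qed

definition supported_in :: "mono set \<Rightarrow> nat \<Rightarrow> 'k::field poly \<Rightarrow> bool" where
  "supported_in M n h \<longleftrightarrow> (\<forall>c. coeff h c \<noteq> 0 \<longrightarrow> c \<le> n \<and> (n - c, c) \<in> M)"

text \<open>The degree \<open>n\<close> part of \<open>monomial_basis\<close>, after setting \<open>x = 1\<close>: the monomials of \<open>M\<close> of degree \<open>n\<close> span a
  complement of \<open>W\<close>.\<close>

definition complement_at :: "mono set \<Rightarrow> nat \<Rightarrow> 'k::field poly set \<Rightarrow> bool" where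
  "complement_at M n W \<longleftrightarrow> (\<forall>b\<le>n. \<exists>h. supported_in M n h \<and> monom 1 b - h \<in> W) \<and>
     (\<forall>g\<in>W. supported_in M n g \<longrightarrow> g = 0)"

lemma supported_in_diff: "supported_in M n f \<Longrightarrow> supported_in M n g \<Longrightarrow> supported_in M n (f - g)"
  by (auto simp: supported_in_def) (metis diff_self)+

lemma keys_homogenize_subset_iff:
  "degree h \<le> n \<Longrightarrow> Poly_Mapping.keys (homogenize n h) \<subseteq> M \<longleftrightarrow> supported_in M n h"
proof
  assume d: "degree h \<le> n" and *: "Poly_Mapping.keys (homogenize n h) \<subseteq> M"
  show "supported_in M n h" unfolding supported_in_def
  proof (intro allI impI)
    fix c assume c: "coeff h c \<noteq> 0"
    then have "c \<le> n" using d le_degree order_trans by blast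
    then have "(n - c, c) \<in> Poly_Mapping.keys (homogenize n h)"
      using c by (simp add: in_keys_iff lookup_homogenize mdeg_def)
    then show "c \<le> n \<and> (n - c, c) \<in> M" using * \<open>c \<le> n\<close> by auto
  qed
next
  assume *: "supported_in M n h"
  show "Poly_Mapping.keys (homogenize n h) \<subseteq> M"
  proof clarify
    fix a b assume "(a, b) \<in> Poly_Mapping.keys (homogenize n h)"
    then have "n = a + b" "coeff h b \<noteq> 0"
      by (auto simp: in_keys_iff lookup_homogenize mdeg_def split: if_splits)
    then show "(a, b) \<in> M" using * by (auto simp: supported_in_def)
  qed
qed

lemma supported_in_degree: "supported_in M n h \<Longrightarrow> degree h \<le> n"
  by (rule degree_le) (auto simp: supported_in_def not_less)

lemma supported_in_dehomogenize: "Poly_Mapping.keys g \<subseteq> M \<Longrightarrow> supported_in M n (dehomogenize n g)"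
  by (auto simp: supported_in_def coeff_dehomogenize in_keys_iff split: if_splits)

lemma monomial_basis_iff:
  fixes I :: "'k::field bipoly set"
  assumes I: "graded_ideal I"
  shows "monomial_basis M I \<longleftrightarrow> (\<forall>n. complement_at M n (slice I n))"
proof
  assume mb: "monomial_basis M I"
  show "\<forall>n. complement_at M n (slice I n)"
  proof
    fix n
    have "\<exists>h. supported_in M n h \<and> monom 1 b - h \<in> slice I n" if b: "b \<le> n" for b
    proof -
      obtain g where g: "Poly_Mapping.keys g \<subseteq> M" "homogenize n (monom 1 b) - g \<in> I"
        using mb unfolding monomial_basis_def by blast
      have "dehomogenize n (homogenize n (monom 1 b) - g) \<in> slice I n"
        using g(2) graded_ideal_mem_iff[OF I] by blast
      then have "monom 1 b - dehomogenize n g \<in> slice I n"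
        using b by (simp add: dehomogenize_diff dehomogenize_homogenize degree_monom_eq)
      then show ?thesis using supported_in_dehomogenize[OF g(1)] by blast
    qed
    moreover have "g = 0" if g: "g \<in> slice I n" "supported_in M n g" for g
    proof -
      have d: "degree g \<le> n" and "homogenize n g \<in> I" using g(1) by (auto simp: slice_def)
      then have "Poly_Mapping.keys (homogenize n g) \<subseteq> M \<and> homogenize n g - homogenize n g \<in> I"
        "Poly_Mapping.keys (0 :: 'k bipoly) \<subseteq> M \<and> homogenize n g - 0 \<in> I"
        using g(2) keys_homogenize_subset_iff graded_idealD(5)[OF I] by auto
      then have "homogenize n g = 0" using mb unfolding monomial_basis_def by blast
      then show ?thesis using homogenize_eq_0_iff[OF d] by simp
    qed
    ultimately show "complement_at M n (slice I n)" unfolding complement_at_def by blast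
  qed
next
  assume ca: "\<forall>n. complement_at M n (slice I n)"
  show "monomial_basis M I"
    unfolding monomial_basis_def
  proof (intro allI ex_ex1I)
    fix f :: "'k bipoly"
    have "\<forall>\<mu>. \<exists>h. supported_in M (mdeg \<mu>) h \<and> monom 1 (snd \<mu>) - h \<in> slice I (mdeg \<mu>)"
      using ca by (simp add: complement_at_def mdeg_def)
    then obtain h where h: "\<And>\<mu>. supported_in M (mdeg \<mu>) (h \<mu>)"
      "\<And>\<mu>. monom 1 (snd \<mu>) - h \<mu> \<in> slice I (mdeg \<mu>)" by metis
    define g where "g = (\<Sum>\<mu>\<in>Poly_Mapping.keys f. scalar_mult (Poly_Mapping.lookup f \<mu>) (homogenize (mdeg \<mu>) (h \<mu>)))"
    have "Poly_Mapping.keys g \<subseteq> M"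
    proof
      fix \<nu> assume "\<nu> \<in> Poly_Mapping.keys g"
      then have "(\<Sum>\<mu>\<in>Poly_Mapping.keys f. Poly_Mapping.lookup f \<mu> * Poly_Mapping.lookup (homogenize (mdeg \<mu>) (h \<mu>)) \<nu>) \<noteq> 0"
        by (simp add: g_def in_keys_iff lookup_sum lookup_scalar_mult)
      then obtain \<mu> where "Poly_Mapping.lookup (homogenize (mdeg \<mu>) (h \<mu>)) \<nu> \<noteq> 0"
        by (metis (no_types, lifting) mult_zero_right sum.neutral)
      then have "\<nu> \<in> Poly_Mapping.keys (homogenize (mdeg \<mu>) (h \<mu>))" by (simp add: in_keys_iff)
      then show "\<nu> \<in> M" using h(1) keys_homogenize_subset_iff supported_in_degree by blast
    qed
    moreover have "f - g \<in> I"
    proof -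
      have "homogenize (mdeg \<mu>) (monom 1 (snd \<mu>)) = (monomial \<mu> :: 'k bipoly)" for \<mu>
        using homogenize_monom[of "snd \<mu>" "mdeg \<mu>"] by (simp add: mdeg_def)
      then have "monomial \<mu> - homogenize (mdeg \<mu>) (h \<mu>) \<in> I" for \<mu>
        using h(2)[of \<mu>] by (simp add: slice_def homogenize_diff)
      then have "(\<Sum>\<mu>\<in>Poly_Mapping.keys f. scalar_mult (Poly_Mapping.lookup f \<mu>) (monomial \<mu> - homogenize (mdeg \<mu>) (h \<mu>))) \<in> I"
        by (intro ideal.subspace_sum[OF graded_idealD(1)[OF I]] graded_idealD(7)[OF I])
      moreover have "(\<Sum>\<mu>\<in>Poly_Mapping.keys f. scalar_mult (Poly_Mapping.lookup f \<mu>) (monomial \<mu>)) = f"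
        by (subst (3) sum_of_singles[of f, symmetric]) (simp add: scalar_mult_def monomial_def mult_single)
      ultimately show ?thesis
        by (simp add: g_def bipoly.scale_right_diff_distrib sum_subtractf)
    qed
    ultimately show "\<exists>g. Poly_Mapping.keys g \<subseteq> M \<and> f - g \<in> I" by blast
  next
    fix f g g' :: "'k bipoly"
    assume g: "Poly_Mapping.keys g \<subseteq> M \<and> f - g \<in> I" and g': "Poly_Mapping.keys g' \<subseteq> M \<and> f - g' \<in> I"
    have "g' - g \<in> I" using graded_idealD(4)[OF I, of "f - g" "f - g'"] g g' by simp
    then have "dehomogenize n (g' - g) \<in> slice I n" for n using graded_ideal_mem_iff[OF I] by blast
    moreover have "supported_in M n (dehomogenize n (g' - g))" for n
      using g g' by (simp add: dehomogenize_diff supported_in_diff supported_in_dehomogenize)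
    ultimately have "dehomogenize n (g' - g) = 0" for n using ca unfolding complement_at_def by blast
    then have "g' - g = 0" by (intro bipoly_eqI_dehomogenize) simp
    then show "g = g'" by simp
  qed
qed

lemma coordinates_eq:
  fixes I :: "'k::field bipoly set"
  assumes I: "graded_ideal I" and mb: "monomial_basis M I"
    and h: "supported_in M (mdeg \<mu>) h" "monom 1 (snd \<mu>) - h \<in> slice I (mdeg \<mu>)"
  shows "coordinates M I (\<mu>, \<nu>) = (if mdeg \<nu> = mdeg \<mu> then coeff h (snd \<nu>) else 0)"
proof -
  have "homogenize (mdeg \<mu>) (monom 1 (snd \<mu>)) = (monomial \<mu> :: 'k bipoly)"
    using homogenize_monom[of "snd \<mu>" "mdeg \<mu>"] by (simp add: mdeg_def)
  then have "monomial \<mu> - homogenize (mdeg \<mu>) h \<in> I"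
    using h(2) by (simp add: slice_def homogenize_diff)
  moreover have "Poly_Mapping.keys (homogenize (mdeg \<mu>) h) \<subseteq> M"
    using h(1) keys_homogenize_subset_iff supported_in_degree by blast
  moreover have "\<exists>!g. Poly_Mapping.keys g \<subseteq> M \<and> monomial \<mu> - g \<in> I"
    using mb unfolding monomial_basis_def by blast
  ultimately have "normal_form M I (monomial \<mu>) = homogenize (mdeg \<mu>) h"
    unfolding normal_form_def by (intro the1_equality) auto
  then show ?thesis by (simp add: coordinates_def lookup_homogenize)
qed

text \<open>The polynomial \<open>y\<^sup>b\<close> minus its normal form, written in terms of the coordinates \<open>x\<close> of the chart. For
  \<open>b\<close> outside of \<open>M\<close> these vectors form a basis of the slice, so that the slice depends polynomially on the
  coordinates.\<close>

definition chart_vector :: "mono set \<Rightarrow> nat \<Rightarrow> (mono \<times> mono \<Rightarrow> 'k::field) \<Rightarrow> nat \<Rightarrow> 'k poly" where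
  "chart_vector M n x b = monom 1 b - (\<Sum>c\<in>{c. c \<le> n \<and> (n - c, c) \<in> M}. monom (x ((n - b, b), (n - c, c))) c)"

lemma coeff_chart_vector:
  "coeff (chart_vector M n x b) k = (if k = b then 1 else 0) -
     (if k \<le> n \<and> (n - k, k) \<in> M then x ((n - b, b), (n - k, k)) else 0)"
proof -
  have "(\<Sum>c\<in>{c. c \<le> n \<and> (n - c, c) \<in> M}. coeff (monom (x ((n - b, b), (n - c, c))) c) k) =
      (\<Sum>c\<in>{c. c \<le> n \<and> (n - c, c) \<in> M}. if c = k then x ((n - b, b), (n - k, k)) else 0)"
    by (intro sum.cong) auto
  then show ?thesis by (simp add: chart_vector_def coeff_sum sum.delta)
qed

lemma slice_eq_span_chart_vectors:
  fixes I :: "'k::field bipoly set"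
  assumes I: "graded_ideal I" and mb: "monomial_basis M I"
  shows "slice I n = pv.span (chart_vector M n (coordinates M I) ` {b. b \<le> n \<and> (n - b, b) \<notin> M})"
    (is "_ = pv.span (?u ` ?K)")
proof
  have ca: "complement_at M n (slice I n)" using mb monomial_basis_iff[OF I] by blast
  have W: "slice_system (slice I)" by (rule slice_system_slice[OF I])
  have u: "?u b \<in> slice I n" if b: "b \<le> n" for b
  proof -
    obtain h where h: "supported_in M n h" "monom 1 b - h \<in> slice I n"
      using ca b unfolding complement_at_def by blast
    have n: "mdeg (n - c, c) = n" if "c \<le> n" for c using that by (simp add: mdeg_def)
    have "coeff (?u b) k = coeff (monom 1 b - h) k" for k
    proof (cases "k \<le> n \<and> (n - k, k) \<in> M")
      case True
      then have "coordinates M I ((n - b, b), (n - k, k)) = coeff h k"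
        using coordinates_eq[OF I mb, of "(n - b, b)" h "(n - k, k)"] h n[OF b] n[of k] by simp
      then show ?thesis using True by (simp add: coeff_chart_vector)
    next
      case False
      then have "coeff h k = 0" using h(1) by (auto simp: supported_in_def)
      then show ?thesis using False by (auto simp: coeff_chart_vector)
    qed
    then have "?u b = monom 1 b - h" by (rule poly_eqI)
    then show ?thesis using h(2) by simp
  qed
  show "pv.span (?u ` ?K) \<subseteq> slice I n"
    using u slice_systemD(1)[OF W] by (intro pv.span_minimal) auto
  show "slice I n \<subseteq> pv.span (?u ` ?K)"
  proof
    fix g assume g: "g \<in> slice I n"
    let ?s = "\<Sum>b\<in>?K. smult (coeff g b) (?u b)"
    have "g - ?s \<in> slice I n"
      using g u slice_systemD(1)[OF W]
      by (intro pv.subspace_diff pv.subspace_sum pv.subspace_scale) auto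
    moreover have "supported_in M n (g - ?s)"
      unfolding supported_in_def
    proof (intro allI impI, rule ccontr)
      fix c assume nz: "coeff (g - ?s) c \<noteq> 0" and not: "\<not> (c \<le> n \<and> (n - c, c) \<in> M)"
      have "coeff ?s c = (\<Sum>b\<in>?K. if b = c then coeff g c else 0)"
        unfolding coeff_sum using not by (intro sum.cong) (auto simp: coeff_chart_vector)
      also have "\<dots> = (if c \<in> ?K then coeff g c else 0)" by (simp add: sum.delta)
      finally show False using nz not g by (auto simp: slice_def coeff_eq_0 split: if_splits)
    qed
    ultimately have "g - ?s = 0" using ca unfolding complement_at_def by blast
    then have "g = ?s" by simp
    moreover have "?s \<in> pv.span (?u ` ?K)" by (intro pv.span_sum pv.span_scale pv.span_base imageI)
    ultimately show "g \<in> pv.span (?u ` ?K)" by simp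
  qed
qed

text \<open>Polynomials that are independent at \<open>x0\<close> stay independent wherever the denominator of their elimination
  does not vanish.\<close>

lemma (in function_algebra) rank_semicontinuous:
  fixes w :: "'p \<Rightarrow> 'r \<Rightarrow> 'k poly"
  assumes J: "finite J" and w: "\<And>j k. j \<in> J \<Longrightarrow> (\<lambda>x. coeff (w x j) k) \<in> \<P>"
  obtains p where "p \<in> \<P>" "p x0 \<noteq> 0"
    "\<And>x. p x \<noteq> 0 \<Longrightarrow> pv.dim (pv.span (w x0 ` J)) \<le> pv.dim (pv.span (w x ` J))"
proof -
  obtain B where B: "B \<subseteq> w x0 ` J" "pv.independent B" "w x0 ` J \<subseteq> pv.span B"
    using pv.maximal_independent_subset by blast
  obtain A where A: "A \<subseteq> J" "inj_on (w x0) A" "B = w x0 ` A"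
    using B(1) by (auto simp: subset_image_inj)
  have fA: "finite A" using A(1) J finite_subset by blast
  have dim0: "pv.dim (pv.span (w x0 ` J)) = card A"
  proof -
    have "pv.span (w x0 ` J) = pv.span B"
      using pv.span_mono[OF B(1)] pv.span_minimal[OF B(3)] by auto
    then show ?thesis
      using pv.dim_span_eq_card_independent[OF B(2)] A card_image[OF A(2)] by simp
  qed
  have "\<exists>\<kappa> q M. inj_on \<kappa> A \<and> \<kappa> ` A \<subseteq> UNIV \<and> q \<in> \<P> \<and> q x0 \<noteq> 0 \<and>
     (\<forall>l\<in>A. \<forall>i\<in>A. M l i \<in> \<P>) \<and>
     (\<forall>l\<in>A. \<forall>l'\<in>A. \<forall>x. (\<Sum>i\<in>A. M l i x * coeff (w x i) (\<kappa> l')) = (if l = l' then q x else 0))"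
  proof (rule fraction_free_inverse[OF fA])
    show "(\<lambda>x. coeff (w x i) k) \<in> \<P>" if "i \<in> A" for i k
      using w that A(1) by auto
    fix c i assume c: "\<And>k. k \<in> UNIV \<Longrightarrow> (\<Sum>i\<in>A. c i * coeff (w x0 i) k) = 0" and i: "i \<in> A"
    have "(\<Sum>i\<in>A. smult (c i) (w x0 i)) = 0" by (rule poly_eqI) (use c in \<open>simp add: coeff_sum\<close>)
    then show "c i = 0" using scalars_zero_of_independent[OF fA A(2)] A(3) B(2) i by blast
  qed
  then obtain \<kappa> q M where q: "q \<in> \<P>" "q x0 \<noteq> 0"
    and M: "\<forall>l\<in>A. \<forall>l'\<in>A. \<forall>x. (\<Sum>i\<in>A. M l i x * coeff (w x i) (\<kappa> l')) = (if l = l' then q x else 0)"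
    by blast
  have "pv.dim (pv.span (w x0 ` J)) \<le> pv.dim (pv.span (w x ` J))" if "q x \<noteq> 0" for x
  proof -
    define u where "u l = (\<Sum>i\<in>A. smult (M l i x) (w x i))" for l
    have "coeff (u l) (\<kappa> l') = (if l = l' then q x else 0)" if "l \<in> A" "l' \<in> A" for l l'
      using M that by (simp add: u_def coeff_sum)
    note ind = independent_of_pivots[OF fA \<open>q x \<noteq> 0\<close> this]
    have "u ` A \<subseteq> pv.span (w x ` J)"
    proof clarify
      fix l assume "l \<in> A"
      have "(\<Sum>i\<in>A. smult (M l i x) (w x i)) \<in> pv.span (w x ` J)"
        using A(1) by (intro pv.span_sum pv.span_scale pv.span_base) auto
      then show "u l \<in> pv.span (w x ` J)" by (simp add: u_def)
    qed
    then have "pv.dim (pv.span (u ` A)) \<le> pv.dim (pv.span (w x ` J))"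
      using pv.dim_mono_of_finite[OF pv.span_minimal[OF _ pv.subspace_span] subset_refl] J by blast
    then show ?thesis using ind by (simp add: dim0 pv.dim_span_eq_card_independent card_image del: pv.dim_span)
  qed
  then show ?thesis using q that by blast
qed

lemma decomposables_semicontinuous:
  fixes M :: "mono set"
  obtains p where "p \<in> polynomial_functions" "p x0 \<noteq> 0"
    "\<And>I I0 :: 'k::field bipoly set. graded_ideal I \<Longrightarrow> monomial_basis M I \<Longrightarrow> graded_ideal I0 \<Longrightarrow> monomial_basis M I0 \<Longrightarrow>
       coordinates M I0 = x0 \<Longrightarrow> p (coordinates M I) \<noteq> 0 \<Longrightarrow>
       pv.dim (decomposables (slice I0) (Suc n)) \<le> pv.dim (decomposables (slice I) (Suc n))"
proof -
  let ?K = "{b. b \<le> n \<and> (n - b, b) \<notin> M}"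
  let ?J = "?K \<times> (UNIV :: bool set)"
  define w :: "(mono \<times> mono \<Rightarrow> 'k) \<Rightarrow> nat \<times> bool \<Rightarrow> 'k poly" where
    "w x = (\<lambda>(b, \<epsilon>). if \<epsilon> then pCons 0 (chart_vector M n x b) else chart_vector M n x b)" for x
  have cv: "(\<lambda>x. coeff (chart_vector M n x b) k) \<in> polynomial_functions" for b k
    unfolding coeff_chart_vector
    by (cases "k = b"; cases "k \<le> n \<and> (n - k, k) \<in> M")
      (auto simp del: diff_0 intro!: polynomial_functions.closure polynomial_functions.coord)
  have pf: "(\<lambda>x. coeff (w x j) k) \<in> polynomial_functions" if "j \<in> ?J" for j k
  proof (cases j)
    case (Pair b \<epsilon>)
    show ?thesis
    proof (cases k)
      case 0
      then show ?thesis using Pair cv[of b 0] by (cases \<epsilon>) (simp_all add: w_def polynomial_functions.const)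
    next
      case (Suc m)
      then show ?thesis using Pair cv[of b m] cv[of b "Suc m"] by (cases \<epsilon>) (simp_all add: w_def)
    qed
  qed
  have dec: "decomposables (slice I) (Suc n) = pv.span (w (coordinates M I) ` ?J)"
    if I: "graded_ideal I" "monomial_basis M I" for I :: "'k bipoly set"
  proof -
    let ?u = "chart_vector M n (coordinates M I)"
    have W: "slice I n = pv.span (?u ` ?K)" by (rule slice_eq_span_chart_vectors[OF I])
    have img: "w (coordinates M I) ` ?J = ?u ` ?K \<union> pCons 0 ` ?u ` ?K"
      by (force simp: w_def image_iff)
    have "pv.subspace {g. pCons 0 g \<in> pv.span S}" for S :: "'k poly set"
      by (rule subspace_pCons_vimage) simp
    then have "pv.span (?u ` ?K) \<subseteq> {g. pCons 0 g \<in> pv.span (?u ` ?K \<union> pCons 0 ` ?u ` ?K)}"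
      by (intro pv.span_minimal) (auto intro: pv.span_base)
    moreover have "pv.span (?u ` ?K) \<subseteq> pv.span (?u ` ?K \<union> pCons 0 ` ?u ` ?K)" by (intro pv.span_mono) auto
    ultimately have "pv.span (slice I n \<union> pCons 0 ` slice I n) \<subseteq> pv.span (?u ` ?K \<union> pCons 0 ` ?u ` ?K)"
      unfolding W by (intro pv.span_minimal) auto
    moreover have "pv.span (?u ` ?K \<union> pCons 0 ` ?u ` ?K) \<subseteq> pv.span (slice I n \<union> pCons 0 ` slice I n)"
      unfolding W using pv.span_superset[of "?u ` ?K"] by (intro pv.span_mono) blast
    ultimately show ?thesis unfolding img decomposables_def nat.case by (rule antisym)
  qed
  have "finite ?J" by simp
  then obtain p where p: "p \<in> polynomial_functions" "p x0 \<noteq> 0"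
    "\<And>x. p x \<noteq> 0 \<Longrightarrow> pv.dim (pv.span (w x0 ` ?J)) \<le> pv.dim (pv.span (w x ` ?J))"
    by (rule polynomial_functions.rank_semicontinuous[where J="?J" and w=w and ?x0.0=x0]) (rule pf, assumption, rule that)
  show ?thesis
  proof (rule that[OF p(1,2)])
    fix I I0 :: "'k bipoly set"
    assume *: "graded_ideal I" "monomial_basis M I" "graded_ideal I0" "monomial_basis M I0"
      "coordinates M I0 = x0" "p (coordinates M I) \<noteq> 0"
    show "pv.dim (decomposables (slice I0) (Suc n)) \<le> pv.dim (decomposables (slice I) (Suc n))"
      unfolding dec[OF *(1,2)] dec[OF *(3,4)] *(5) by (rule p(3)[OF *(6)])
  qed
qed

lemma openin_affine_zariski_nonvanishing:
  "p \<in> polynomial_functions \<Longrightarrow> openin affine_zariski {v. p v \<noteq> 0}"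
  unfolding affine_zariski_def by (intro topology_generated_by_Basis) auto

text \<open>The dimensions of the slices are fixed on \<open>X\<close>, so the number of generators can only drop where the
  dimensions of the decomposables grow; and these are ranks of families with polynomial entries.\<close>

lemma openin_min_generators_le:
  fixes X :: "'k::field bipoly set set"
  assumes X: "\<And>I. I \<in> X \<Longrightarrow> graded_ideal I" "\<And>I. I \<in> X \<Longrightarrow> monomial_basis M I"
    and dims: "\<And>I n. I \<in> X \<Longrightarrow> pv.dim (slice I n) = r n"
    and full: "\<And>I n. I \<in> X \<Longrightarrow> N \<le> n \<Longrightarrow> slice I n = {g. degree g \<le> n}"
  shows "openin (pullback_topology X (coordinates M) affine_zariski) {I \<in> X. min_generators I \<le> m}"
proof -
  define \<U> where "\<U> = {{v. p v \<noteq> 0} | p. p \<in> polynomial_functions \<and>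
      (\<forall>I\<in>X. p (coordinates M I) \<noteq> 0 \<longrightarrow> min_generators I \<le> m)}"
  have "openin affine_zariski (\<Union>\<U>)"
    unfolding \<U>_def by (intro openin_Union) (auto intro: openin_affine_zariski_nonvanishing)
  moreover have "{I \<in> X. min_generators I \<le> m} = coordinates M -` (\<Union>\<U>) \<inter> X"
  proof
    show "coordinates M -` (\<Union>\<U>) \<inter> X \<subseteq> {I \<in> X. min_generators I \<le> m}" by (auto simp: \<U>_def)
    show "{I \<in> X. min_generators I \<le> m} \<subseteq> coordinates M -` (\<Union>\<U>) \<inter> X"
    proof
      fix I0 assume "I0 \<in> {I \<in> X. min_generators I \<le> m}"
      then have I0: "I0 \<in> X" "min_generators I0 \<le> m" by auto
      have "\<exists>p. p \<in> polynomial_functions \<and> p (coordinates M I0) \<noteq> 0 \<and> (\<forall>I\<in>X. p (coordinates M I) \<noteq> 0 \<longrightarrow>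
          pv.dim (decomposables (slice I0) n) \<le> pv.dim (decomposables (slice I) n))" for n
      proof (cases n)
        case 0
        then show ?thesis
          by (intro exI[of _ "\<lambda>_. 1"]) (auto simp: decomposables_def polynomial_functions.const)
      next
        case (Suc n')
        obtain p where "p \<in> polynomial_functions" "p (coordinates M I0) \<noteq> 0"
          "\<And>I I0' :: 'k bipoly set. graded_ideal I \<Longrightarrow> monomial_basis M I \<Longrightarrow> graded_ideal I0' \<Longrightarrow> monomial_basis M I0' \<Longrightarrow>
           coordinates M I0' = coordinates M I0 \<Longrightarrow> p (coordinates M I) \<noteq> 0 \<Longrightarrow>
           pv.dim (decomposables (slice I0') (Suc n')) \<le> pv.dim (decomposables (slice I) (Suc n'))"
          by (rule decomposables_semicontinuous[of "coordinates M I0" M n']) (rule that)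
        then show ?thesis using X I0(1) Suc by (intro exI[of _ p]) auto
      qed
      then obtain p where p: "\<And>n. p n \<in> polynomial_functions" "\<And>n. p n (coordinates M I0) \<noteq> 0"
        "\<And>n I. I \<in> X \<Longrightarrow> p n (coordinates M I) \<noteq> 0 \<Longrightarrow> pv.dim (decomposables (slice I0) n) \<le> pv.dim (decomposables (slice I) n)"
        by metis
      define P where "P x = (\<Prod>n\<le>N. p n x)" for x
      have P: "P \<in> polynomial_functions"
        using polynomial_functions.prod_mem[of "{..N}" p] p(1) by (simp add: P_def[abs_def])
      have "min_generators I \<le> m" if I: "I \<in> X" and nz: "P (coordinates M I) \<noteq> 0" for I
      proof -
        have "pv.dim (decomposables (slice I0) n) \<le> pv.dim (decomposables (slice I) n)" if "n \<le> N" for n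
          using p(3)[OF I, of n] nz that by (auto simp: P_def)
        then have "(\<Sum>n\<le>N. pv.dim (slice I n) - pv.dim (decomposables (slice I) n)) \<le>
            (\<Sum>n\<le>N. pv.dim (slice I0 n) - pv.dim (decomposables (slice I0) n))"
          using dims I I0(1) by (intro sum_mono) (auto intro: diff_le_mono2)
        then have "min_generators I \<le> min_generators I0"
          using min_generators_eq[OF X(1)[OF I] full[OF I]] min_generators_eq[OF X(1)[OF I0(1)] full[OF I0(1)]] by simp
        then show ?thesis using I0(2) by simp
      qed
      then have "{v. P v \<noteq> 0} \<in> \<U>" unfolding \<U>_def using P by blast
      moreover have "P (coordinates M I0) \<noteq> 0" using p(2) by (simp add: P_def)
      ultimately show "I0 \<in> coordinates M -` (\<Union>\<U>) \<inter> X" using I0 by auto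
    qed
  qed
  ultimately show ?thesis unfolding openin_pullback_topology by blast
qed

section \<open>Curves of ideals and generic ideals of a cell\<close>

text \<open>A family of ideals over the affine line whose slices have bases that depend polynomially on the
  parameter. Density is proved by following such curves, in place of irreducibility of the varieties.\<close>

definition ideal_curve :: "nat \<Rightarrow> ('k::field \<Rightarrow> 'k bipoly set) \<Rightarrow> bool" where
  "ideal_curve N \<gamma> \<longleftrightarrow> (\<forall>s. graded_ideal (\<gamma> s)) \<and>
     (\<forall>n\<ge>N. \<forall>s. slice (\<gamma> s) n = {g. degree g \<le> n}) \<and>
     (\<forall>n. \<exists>(A :: nat set) v. finite A \<and> (\<forall>i\<in>A. \<forall>k. (\<lambda>s. coeff (v s i) k) \<in> univariate_functions) \<and>
        (\<forall>s. slice (\<gamma> s) n = pv.span (v s ` A) \<and> pv.dim (slice (\<gamma> s) n) = card A))"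

lemma card_support_complement:
  fixes W :: "'k::field poly set"
  assumes ca: "complement_at M n W" and W: "W \<subseteq> {g. degree g \<le> n}" "W \<subseteq> pv.span (v ` A)" "finite A"
  shows "card {b. b \<le> n \<and> (n - b, b) \<notin> M} \<le> card A"
proof -
  let ?K = "{b. b \<le> n \<and> (n - b, b) \<notin> M}" and ?L = "{b. b \<le> n \<and> (n - b, b) \<in> M}"
  let ?S = "v ` A \<union> monom 1 ` ?L"
  have "monom 1 b \<in> pv.span ?S" if b: "b \<le> n" for b
  proof -
    obtain h where h: "supported_in M n h" "monom 1 b - h \<in> W"
      using ca b unfolding complement_at_def by blast
    have "h = (\<Sum>c\<le>n. smult (coeff h c) (monom 1 c))"
      using poly_as_sum_of_monoms'[OF supported_in_degree[OF h(1)]] by (simp add: smult_monom)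
    also have "\<dots> = (\<Sum>c\<in>?L. smult (coeff h c) (monom 1 c))"
      using h(1) by (intro sum.mono_neutral_right) (auto simp: supported_in_def)
    also have "\<dots> \<in> pv.span ?S" by (intro pv.span_sum pv.span_scale pv.span_base) auto
    finally have "h \<in> pv.span ?S" .
    moreover have "monom 1 b - h \<in> pv.span ?S"
      using h(2) W(2) pv.span_mono[of "v ` A" ?S] by blast
    ultimately have "(monom 1 b - h) + h \<in> pv.span ?S" by (intro pv.span_add)
    then show ?thesis by simp
  qed
  then have "pv.span (monom 1 ` {..n}) \<subseteq> pv.span ?S" by (intro pv.span_minimal) auto
  then have "{g :: 'k poly. degree g \<le> n} \<subseteq> pv.span ?S" using degree_le_subset_span by blast
  then have "Suc n \<le> card ?S"
    using pv.dim_le_card[of "{g :: 'k poly. degree g \<le> n}" ?S] W(3) dim_degree_le[of n, where 'k='k] by simp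
  also have "\<dots> \<le> card A + card ?L"
    using W(3) by (intro le_trans[OF card_Un_le add_mono] card_image_le) auto
  finally have "Suc n \<le> card A + card ?L" .
  moreover have "card {..n} = card (?K \<union> ?L)" by (rule arg_cong[of _ _ card]) auto
  moreover have "card (?K \<union> ?L) = card ?K + card ?L" by (intro card_Un_disjoint) auto
  ultimately show ?thesis by simp
qed

text \<open>In a chart that contains the point \<open>s0\<close> of the curve, the coordinates along the curve are rational
  functions of the parameter with a common denominator \<open>q\<close>, and the curve stays in the chart where
  \<open>q\<close> does not vanish. The numerators are \<open>R\<close>; all of this is Cramer's rule, in the form of
  \<open>fraction_free_inverse\<close>.\<close>

lemma curve_complement_at:
  fixes \<gamma> :: "'k::field \<Rightarrow> 'k bipoly set"
  assumes \<gamma>: "ideal_curve N \<gamma>" and ca: "complement_at M n (slice (\<gamma> s0) n)"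
  obtains q R where "q \<in> univariate_functions" "q s0 \<noteq> 0" "\<And>b c. R b c \<in> univariate_functions"
    "\<And>s. q s \<noteq> 0 \<Longrightarrow> complement_at M n (slice (\<gamma> s) n)"
    "\<And>s b. q s \<noteq> 0 \<Longrightarrow> b \<le> n \<Longrightarrow> \<exists>h. supported_in M n h \<and> monom 1 b - h \<in> slice (\<gamma> s) n \<and> (\<forall>c. q s * coeff h c = R b c s)"
proof -
  let ?U = "univariate_functions :: ('k \<Rightarrow> 'k) set"
  let ?K = "{b. b \<le> n \<and> (n - b, b) \<notin> M}"
  obtain A :: "nat set" and v where A: "finite A" and v: "\<And>i k. i \<in> A \<Longrightarrow> (\<lambda>s. coeff (v s i) k) \<in> ?U"
    and span: "\<And>s. slice (\<gamma> s) n = pv.span (v s ` A)" and dim: "\<And>s. pv.dim (slice (\<gamma> s) n) = card A"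
    using \<gamma> unfolding ideal_curve_def by metis
  have sl: "slice (\<gamma> s) n \<subseteq> {g. degree g \<le> n}" for s by (auto simp: slice_def)
  have sub: "pv.subspace (slice (\<gamma> s) n)" for s unfolding span by simp
  have cK: "card ?K \<le> card A"
    by (rule card_support_complement[OF ca sl eq_refl[OF span] A])
  have ind0: "inj_on (v s0) A" "pv.independent (v s0 ` A)"
    using independent_of_dim_eq_card[OF A, of "v s0"] dim[of s0] span[of s0] by auto
  have "\<exists>\<kappa> q C. inj_on \<kappa> A \<and> \<kappa> ` A \<subseteq> ?K \<and> q \<in> ?U \<and> q s0 \<noteq> 0 \<and> (\<forall>l\<in>A. \<forall>i\<in>A. C l i \<in> ?U) \<and>
     (\<forall>l\<in>A. \<forall>l'\<in>A. \<forall>s. (\<Sum>i\<in>A. C l i s * coeff (v s i) (\<kappa> l')) = (if l = l' then q s else 0))"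
  proof (rule univariate_functions.fraction_free_inverse[OF A])
    fix c i assume c: "\<And>k. k \<in> ?K \<Longrightarrow> (\<Sum>i\<in>A. c i * coeff (v s0 i) k) = 0" and i: "i \<in> A"
    let ?g = "\<Sum>i\<in>A. smult (c i) (v s0 i)"
    have g: "?g \<in> slice (\<gamma> s0) n"
      unfolding span by (intro pv.span_sum pv.span_scale pv.span_base imageI)
    moreover have "supported_in M n ?g"
      unfolding supported_in_def
    proof (intro allI impI, rule ccontr)
      fix k assume k: "coeff ?g k \<noteq> 0" "\<not> (k \<le> n \<and> (n - k, k) \<in> M)"
      have "k \<le> n" using k(1) g le_degree[of ?g k] by (auto simp: slice_def)
      then show False using c[of k] k by (simp add: coeff_sum)
    qed
    ultimately have "?g = 0" using ca unfolding complement_at_def by blast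
    then show "c i = 0" using scalars_zero_of_independent[OF A ind0] i by blast
  qed (use v in auto)
  then obtain \<kappa> q C where \<kappa>: "inj_on \<kappa> A" "\<kappa> ` A \<subseteq> ?K" and q: "q \<in> ?U" "q s0 \<noteq> 0"
    and C: "\<forall>l\<in>A. \<forall>i\<in>A. C l i \<in> ?U"
      "\<forall>l\<in>A. \<forall>l'\<in>A. \<forall>s. (\<Sum>i\<in>A. C l i s * coeff (v s i) (\<kappa> l')) = (if l = l' then q s else 0)"
    by blast
  have onto: "\<kappa> ` A = ?K"
    using \<kappa> cK card_image[OF \<kappa>(1)] by (intro card_seteq) auto
  define u where "u s l = (\<Sum>i\<in>A. smult (C l i s) (v s i))" for s l
  have u_slice: "u s l \<in> slice (\<gamma> s) n" if "l \<in> A" for s l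
    unfolding u_def span by (intro pv.span_sum pv.span_scale pv.span_base imageI)
  have u_piv: "coeff (u s l) (\<kappa> l') = (if l = l' then q s else 0)" if "l \<in> A" "l' \<in> A" for s l l'
    using C(2) that by (simp add: u_def coeff_sum)
  have u_U: "(\<lambda>s. coeff (u s l) k) \<in> ?U" if "l \<in> A" for l k
    using C(1) v that by (auto simp: u_def coeff_sum intro!: univariate_functions.closure)
  \<comment> \<open>The row \<open>b\<close> is replaced by \<open>y\<^sup>b - u / q\<close> for the vector \<open>u\<close> with pivot \<open>b\<close>; a row of \<open>M\<close> stays.\<close>
  define R where "R b c s = (if b \<in> ?K then (if c = b then q s else 0) - coeff (u s (inv_into A \<kappa> b)) c
      else (if c = b then q s else 0))" for b c s
  have R_U: "R b c \<in> ?U" for b c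
  proof -
    have d: "(\<lambda>s. if c = b then q s else 0) \<in> ?U"
      using q(1) univariate_functions.const_mem by (cases "c = b") auto
    show ?thesis
    proof (cases "b \<in> ?K")
      case True
      then have "inv_into A \<kappa> b \<in> A" using onto by (intro inv_into_into) auto
      then have "(\<lambda>s. (if c = b then q s else 0) - coeff (u s (inv_into A \<kappa> b)) c) \<in> ?U"
        by (intro univariate_functions.diff_mem d u_U)
      then show ?thesis using True by (simp add: R_def[abs_def])
    next
      case False
      then have "R b c = (\<lambda>s. if c = b then q s else 0)" unfolding R_def by (auto simp: fun_eq_iff)
      then show ?thesis using d by simp
    qed
  qed
  have ex: "\<exists>h. supported_in M n h \<and> monom 1 b - h \<in> slice (\<gamma> s) n \<and> (\<forall>c. q s * coeff h c = R b c s)"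
    if qs: "q s \<noteq> 0" and b: "b \<le> n" for s b
  proof (cases "b \<in> ?K")
    case True
    define l where "l = inv_into A \<kappa> b"
    have l: "l \<in> A" "\<kappa> l = b" using True onto unfolding l_def by (auto intro: inv_into_into f_inv_into_f)
    define h where "h = monom 1 b - smult (inverse (q s)) (u s l)"
    have "supported_in M n h"
      unfolding supported_in_def
    proof (intro allI impI, rule ccontr)
      fix k assume k: "coeff h k \<noteq> 0" "\<not> (k \<le> n \<and> (n - k, k) \<in> M)"
      have "k \<le> n"
      proof (rule ccontr)
        assume "\<not> k \<le> n"
        then have "coeff (u s l) k = 0" using u_slice[OF l(1), of s] by (auto simp: slice_def intro: coeff_eq_0)
        then show False using k(1) b \<open>\<not> k \<le> n\<close> by (simp add: h_def)
      qed
      then have "k \<in> ?K" using k(2) by auto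
      then obtain l' where l': "l' \<in> A" "k = \<kappa> l'" using onto by blast
      then have "(k = b) = (l' = l)" using l \<kappa>(1) by (auto dest: inj_onD)
      then have "coeff h k = 0" using u_piv[OF l(1) l'(1), of s] l'(2) qs by (auto simp: h_def)
      then show False using k(1) by simp
    qed
    moreover have "monom 1 b - h \<in> slice (\<gamma> s) n"
      using u_slice[OF l(1)] sub by (simp add: h_def pv.subspace_scale)
    moreover have "q s * coeff h c = R b c s" for c
      using True qs by (auto simp: h_def R_def l_def right_diff_distrib)
    ultimately show ?thesis by blast
  next
    case False
    then have "supported_in M n (monom (1::'k) b)" using b by (auto simp: supported_in_def)
    moreover have "monom 1 b - monom 1 b \<in> slice (\<gamma> s) n" using sub pv.subspace_0 by auto
    moreover have "q s * coeff (monom 1 b) c = R b c s" for c using False by (auto simp: R_def)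
    ultimately show ?thesis by blast
  qed
  have uniq: "g = 0" if qs: "q s \<noteq> 0" and g: "g \<in> slice (\<gamma> s) n" "supported_in M n g" for s g
  proof -
    note ind = independent_of_pivots[OF A qs u_piv]
    have "pv.span (u s ` A) = slice (\<gamma> s) n"
    proof (rule pv.subspace_eq_of_dim_eq)
      show "pv.span (u s ` A) \<subseteq> slice (\<gamma> s) n" using u_slice sub by (intro pv.span_minimal) auto
      show "slice (\<gamma> s) n \<subseteq> pv.span (v s ` A)" using span by simp
      show "pv.dim (slice (\<gamma> s) n) \<le> pv.dim (pv.span (u s ` A))"
        using ind dim by (simp add: pv.dim_span_eq_card_independent card_image del: pv.dim_span)
    qed (use A in auto)
    then obtain f where f: "g = (\<Sum>x\<in>u s ` A. smult (f x) x)"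
      using g(1) pv.span_finite[of "u s ` A"] A by auto
    then have g_eq: "g = (\<Sum>l\<in>A. smult (f (u s l)) (u s l))" by (simp only: sum.reindex[OF ind(1)] o_def)
    have "f (u s l) = 0" if l: "l \<in> A" for l
    proof -
      have "coeff g (\<kappa> l) = (\<Sum>i\<in>A. if i = l then f (u s l) * q s else 0)"
        unfolding g_eq coeff_sum using l u_piv by (intro sum.cong) auto
      also have "\<dots> = f (u s l) * q s" using A l by simp
      finally have "coeff g (\<kappa> l) = f (u s l) * q s" .
      moreover have "coeff g (\<kappa> l) = 0" using g(2) \<kappa>(2) l by (auto simp: supported_in_def)
      ultimately show ?thesis using qs by simp
    qed
    then show ?thesis unfolding g_eq by (intro sum.neutral) simp
  qed
  have "complement_at M n (slice (\<gamma> s) n)" if "q s \<noteq> 0" for s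
    unfolding complement_at_def using ex[OF that] uniq[OF that] by blast
  then show ?thesis using that[OF q R_U _ ex] by blast
qed

lemma curve_monomial_basis:
  fixes \<gamma> :: "'k::field \<Rightarrow> 'k bipoly set"
  assumes \<gamma>: "ideal_curve N \<gamma>" and mb: "monomial_basis M (\<gamma> s0)"
  shows "finite {s. \<not> monomial_basis M (\<gamma> s)}"
proof -
  have gr: "graded_ideal (\<gamma> s)" for s using \<gamma> by (simp add: ideal_curve_def)
  have ca: "complement_at M n (slice (\<gamma> s0) n)" for n using mb monomial_basis_iff[OF gr] by blast
  have fin: "finite {s. \<not> complement_at M n (slice (\<gamma> s) n)}" for n
  proof -
    obtain q where "q \<in> univariate_functions" "q s0 \<noteq> 0" and *: "\<And>s. q s \<noteq> 0 \<Longrightarrow> complement_at M n (slice (\<gamma> s) n)"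
      by (rule curve_complement_at[OF \<gamma> ca[of n]]) (rule that)
    then have "finite {s. q s = 0}" by (intro finite_zeros_univariate)
    then show ?thesis by (rule rev_finite_subset) (use * in auto)
  qed
  have "complement_at M n (slice (\<gamma> s) n)" if "N \<le> n" for n s
    using ca[of n] \<gamma> that by (simp add: ideal_curve_def)
  then have "n < N" if "\<not> complement_at M n (slice (\<gamma> s) n)" for n s
    using that by (meson not_le)
  then have "{s. \<not> monomial_basis M (\<gamma> s)} \<subseteq> (\<Union>n<N. {s. \<not> complement_at M n (slice (\<gamma> s) n)})"
    unfolding monomial_basis_iff[OF gr] by blast
  then show ?thesis by (rule finite_subset) (use fin in auto)
qed

text \<open>Denominators are cleared separately for every polynomial function, since it involves only finitely many
  coordinates.\<close>

lemma curve_polynomial_function: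
  fixes \<gamma> :: "'k::field \<Rightarrow> 'k bipoly set"
  assumes \<gamma>: "ideal_curve N \<gamma>" and mb: "monomial_basis M (\<gamma> s0)" and p: "p \<in> polynomial_functions"
  shows "\<exists>q\<in>univariate_functions. \<exists>R\<in>univariate_functions. q s0 \<noteq> 0 \<and>
    (\<forall>s. monomial_basis M (\<gamma> s) \<longrightarrow> q s \<noteq> 0 \<longrightarrow> q s * p (coordinates M (\<gamma> s)) = R s)"
  using p
proof (induction p rule: polynomial_functions.induct)
  case (const c)
  show ?case
    by (rule bexI[of _ "\<lambda>_. 1"], rule bexI[of _ "\<lambda>_. c"]) (auto simp: univariate_functions.const_mem)
next
  case (coord i)
  obtain \<mu> \<nu> where i: "i = (\<mu>, \<nu>)" by (cases i)
  have gr: "graded_ideal (\<gamma> s)" for s using \<gamma> by (simp add: ideal_curve_def)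
  have ca: "complement_at M (mdeg \<mu>) (slice (\<gamma> s0) (mdeg \<mu>))" using mb monomial_basis_iff[OF gr] by blast
  obtain q R where q: "q \<in> univariate_functions" "q s0 \<noteq> 0" "\<And>b c. R b c \<in> univariate_functions"
    and ex: "\<And>s b. q s \<noteq> 0 \<Longrightarrow> b \<le> mdeg \<mu> \<Longrightarrow> \<exists>h. supported_in M (mdeg \<mu>) h \<and>
       monom 1 b - h \<in> slice (\<gamma> s) (mdeg \<mu>) \<and> (\<forall>c. q s * coeff h c = R b c s)"
    by (rule curve_complement_at[OF \<gamma> ca]) (rule that)
  define R' where "R' = (if mdeg \<nu> = mdeg \<mu> then R (snd \<mu>) (snd \<nu>) else (\<lambda>_. 0))"
  have "q s * coordinates M (\<gamma> s) i = R' s" if s: "monomial_basis M (\<gamma> s)" "q s \<noteq> 0" for s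
  proof -
    have "snd \<mu> \<le> mdeg \<mu>" by (simp add: mdeg_def)
    from ex[OF s(2) this] obtain h where h: "supported_in M (mdeg \<mu>) h"
      "monom 1 (snd \<mu>) - h \<in> slice (\<gamma> s) (mdeg \<mu>)" "\<And>c. q s * coeff h c = R (snd \<mu>) c s" by blast
    show ?thesis unfolding i coordinates_eq[OF gr s(1) h(1,2)] by (simp add: R'_def h(3))
  qed
  moreover have "R' \<in> univariate_functions"
    using q(3) by (simp add: R'_def univariate_functions.const_mem)
  ultimately show ?case using q(1,2) by blast
next
  case (add p p')
  then obtain q R q' R' where *: "q \<in> univariate_functions" "R \<in> univariate_functions" "q s0 \<noteq> 0"
    "q' \<in> univariate_functions" "R' \<in> univariate_functions" "q' s0 \<noteq> 0"
    and e: "\<And>s. monomial_basis M (\<gamma> s) \<Longrightarrow> q s \<noteq> 0 \<Longrightarrow> q s * p (coordinates M (\<gamma> s)) = R s"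
    "\<And>s. monomial_basis M (\<gamma> s) \<Longrightarrow> q' s \<noteq> 0 \<Longrightarrow> q' s * p' (coordinates M (\<gamma> s)) = R' s"
    by blast
  show ?case
  proof (rule bexI[of _ "\<lambda>s. q s * q' s"], rule bexI[of _ "\<lambda>s. q' s * R s + q s * R' s"], intro conjI allI impI)
    fix s assume "monomial_basis M (\<gamma> s)" "q s * q' s \<noteq> 0"
    then show "q s * q' s * (p (coordinates M (\<gamma> s)) + p' (coordinates M (\<gamma> s))) = q' s * R s + q s * R' s"
      using e[of s, symmetric] by (simp add: algebra_simps)
  qed (use * in \<open>auto intro!: univariate_functions.closure\<close>)
next
  case (mult p p')
  then obtain q R q' R' where *: "q \<in> univariate_functions" "R \<in> univariate_functions" "q s0 \<noteq> 0"
    "q' \<in> univariate_functions" "R' \<in> univariate_functions" "q' s0 \<noteq> 0"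
    and e: "\<And>s. monomial_basis M (\<gamma> s) \<Longrightarrow> q s \<noteq> 0 \<Longrightarrow> q s * p (coordinates M (\<gamma> s)) = R s"
    "\<And>s. monomial_basis M (\<gamma> s) \<Longrightarrow> q' s \<noteq> 0 \<Longrightarrow> q' s * p' (coordinates M (\<gamma> s)) = R' s"
    by blast
  show ?case
  proof (rule bexI[of _ "\<lambda>s. q s * q' s"], rule bexI[of _ "\<lambda>s. R s * R' s"], intro conjI allI impI)
    fix s assume "monomial_basis M (\<gamma> s)" "q s * q' s \<noteq> 0"
    then show "q s * q' s * (p (coordinates M (\<gamma> s)) * p' (coordinates M (\<gamma> s))) = R s * R' s"
      using e[of s, symmetric] by (simp add: algebra_simps)
  qed (use * in \<open>auto intro!: univariate_functions.closure\<close>)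
qed

text \<open>A curve that starts in an open set leaves it for at most finitely many parameters.\<close>

lemma curve_meets_open:
  fixes \<gamma> :: "'k::field \<Rightarrow> 'k bipoly set"
  assumes \<gamma>: "ideal_curve N \<gamma>" and O: "openin (pullback_topology X (coordinates M) affine_zariski) O'"
    and s0: "\<gamma> s0 \<in> O'" and X: "\<And>I. I \<in> X \<Longrightarrow> monomial_basis M I"
    and mem: "\<And>s. monomial_basis M (\<gamma> s) \<Longrightarrow> \<gamma> s \<in> X"
  shows "finite {s. \<gamma> s \<notin> O'}"
proof -
  obtain U where U: "openin affine_zariski U" "O' = coordinates M -` U \<inter> X"
    using O unfolding openin_pullback_topology by blast
  have mb: "monomial_basis M (\<gamma> s0)" using s0 U(2) X by blast
  have "generate_topology_on {{v. p v \<noteq> 0} | p. p \<in> polynomial_functions} U"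
    using U(1) unfolding affine_zariski_def by (rule openin_topology_generated_by)
  then have "coordinates M (\<gamma> s0) \<in> U \<longrightarrow> finite {s. monomial_basis M (\<gamma> s) \<and> coordinates M (\<gamma> s) \<notin> U}"
  proof (induction U rule: generate_topology_on.induct)
    case Empty
    show ?case by simp
  next
    case (Int U U')
    have "{s. monomial_basis M (\<gamma> s) \<and> coordinates M (\<gamma> s) \<notin> U \<inter> U'} \<subseteq>
      {s. monomial_basis M (\<gamma> s) \<and> coordinates M (\<gamma> s) \<notin> U} \<union> {s. monomial_basis M (\<gamma> s) \<and> coordinates M (\<gamma> s) \<notin> U'}"
      by auto
    then show ?case using Int.IH finite_subset by blast
  next
    case (UN K)
    show ?case
    proof
      assume "coordinates M (\<gamma> s0) \<in> \<Union>K"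
      then obtain U where U: "U \<in> K" "coordinates M (\<gamma> s0) \<in> U" by auto
      then have "finite {s. monomial_basis M (\<gamma> s) \<and> coordinates M (\<gamma> s) \<notin> U}" using UN.IH by blast
      then show "finite {s. monomial_basis M (\<gamma> s) \<and> coordinates M (\<gamma> s) \<notin> \<Union>K}"
        by (rule rev_finite_subset) (use U(1) in auto)
    qed
  next
    case (Basis U)
    then obtain p where p: "p \<in> polynomial_functions" "U = {v. p v \<noteq> 0}" by auto
    show ?case
    proof
      assume "coordinates M (\<gamma> s0) \<in> U"
      then have nz: "p (coordinates M (\<gamma> s0)) \<noteq> 0" using p(2) by simp
      obtain q R where q: "q \<in> univariate_functions" "R \<in> univariate_functions" "q s0 \<noteq> 0"
        "\<And>s. monomial_basis M (\<gamma> s) \<Longrightarrow> q s \<noteq> 0 \<Longrightarrow> q s * p (coordinates M (\<gamma> s)) = R s"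
        using curve_polynomial_function[OF \<gamma> mb p(1)] by blast
      have "R s0 \<noteq> 0" using q(4)[OF mb q(3)] nz q(3) by auto
      then have "finite ({s. q s = 0} \<union> {s. R s = 0})"
        using finite_zeros_univariate q by blast
      then show "finite {s. monomial_basis M (\<gamma> s) \<and> coordinates M (\<gamma> s) \<notin> U}"
        by (rule rev_finite_subset) (use q(4) p(2) in force)
    qed
  qed
  then have "finite ({s. monomial_basis M (\<gamma> s) \<and> coordinates M (\<gamma> s) \<notin> U} \<union> {s. \<not> monomial_basis M (\<gamma> s)})"
    using curve_monomial_basis[OF \<gamma> mb] s0 U(2) by auto
  then show ?thesis by (rule rev_finite_subset) (use U(2) mem in auto)
qed

definition standard_monomials :: "(nat \<Rightarrow> nat set) \<Rightarrow> mono set" where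
  "standard_monomials D = {(a, b). b \<notin> D (a + b)}"

text \<open>Division with remainder: as long as the degree of a polynomial is the degree of an element of \<open>W\<close>, subtract a multiple
  of this element; otherwise move the leading term to the remainder.\<close>

lemma complement_at_of_degrees:
  fixes W :: "'k::field poly set"
  assumes W: "pv.subspace W" "degree ` (W - {0}) = D n" and D: "D n \<subseteq> {..n}"
  shows "complement_at (standard_monomials D) n W"
proof -
  have supp: "supported_in (standard_monomials D) n h \<longleftrightarrow> (\<forall>c. coeff h c \<noteq> 0 \<longrightarrow> c \<le> n \<and> c \<notin> D n)" for h :: "'k poly"
    by (auto simp: supported_in_def standard_monomials_def)
  have "\<exists>h. supported_in (standard_monomials D) n h \<and> f - h \<in> W" if "degree f \<le> n" for f
    using that
  proof (induction "if f = 0 then 0 else Suc (degree f)" arbitrary: f rule: less_induct)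
    case less
    show ?case
    proof (cases "f = 0")
      case True
      then show ?thesis using pv.subspace_0[OF W(1)] by (intro exI[of _ 0]) (auto simp: supp)
    next
      case False
      obtain g where g: "degree g = degree f" "lead_coeff g = lead_coeff f" "g \<in> W \<or> supported_in (standard_monomials D) n g"
      proof (cases "degree f \<in> D n")
        case True
        then have "degree f \<in> degree ` (W - {0})" by (simp only: W(2))
        then obtain g where "degree f = degree g" "g \<in> W - {0}" by (rule imageE)
        then have g: "g \<in> W" "g \<noteq> 0" "degree g = degree f" by simp_all
        have "coeff g (degree f) \<noteq> 0" using g(2,3) by (metis leading_coeff_0_iff)
        then show ?thesis
          by (intro that[of "smult (lead_coeff f / lead_coeff g) g"])
            (use g False pv.subspace_scale[OF W(1)] in auto)
      next
        case False
        show ?thesis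
          by (rule that[of "monom (lead_coeff f) (degree f)"])
            (use False less.prems \<open>f \<noteq> 0\<close> in \<open>auto simp: supp degree_monom_eq\<close>)
      qed
      have "(if f - g = 0 then 0 else Suc (degree (f - g))) < (if f = 0 then 0 else Suc (degree f)) \<and> degree (f - g) \<le> n"
      proof (cases "f - g = 0")
        case d: False
        have "coeff (f - g) k = 0" if "k \<ge> degree f" for k
          using that g by (cases "k = degree f") (auto simp: coeff_eq_0)
        then have "degree (f - g) < degree f" using d by (metis leading_coeff_0_iff not_less)
        then show ?thesis using False less.prems by auto
      qed (use False in auto)
      then obtain h where h: "supported_in (standard_monomials D) n h" "f - g - h \<in> W"
        using less.hyps[of "f - g"] by blast
      from g(3) show ?thesis
      proof
        assume "g \<in> W"
        then have "f - h \<in> W" using pv.subspace_add[OF W(1) h(2), of g] by simp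
        then show ?thesis using h(1) by blast
      next
        assume "supported_in (standard_monomials D) n g"
        then have "supported_in (standard_monomials D) n (h + g)"
          using h(1) by (auto simp: supp) (metis add.right_neutral add_0)+
        moreover have "f - (h + g) = f - g - h" by simp
        ultimately show ?thesis using h(2) by metis
      qed
    qed
  qed
  then have "\<forall>b\<le>n. \<exists>h. supported_in (standard_monomials D) n h \<and> monom 1 b - h \<in> W"
    by (simp add: degree_monom_eq)
  moreover have "g = 0" if "g \<in> W" "supported_in (standard_monomials D) n g" for g
  proof (rule ccontr)
    assume "g \<noteq> 0"
    then have "degree g \<in> degree ` (W - {0})" and nz: "coeff g (degree g) \<noteq> 0" using that by auto
    then have "degree g \<in> D n" by (simp only: W(2))
    then show False using that(2) nz unfolding supp by blast
  qed
  ultimately show ?thesis unfolding complement_at_def by blast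
qed

context staircase
begin

lemma degree_cell_monomial_basis:
  assumes "I \<in> degree_cell D" shows "monomial_basis (standard_monomials D) I"
proof -
  have I: "graded_ideal I" "\<And>n. degree ` (slice I n - {0}) = D n" using assms by (simp_all add: degree_cell_def)
  show ?thesis
    unfolding monomial_basis_iff[OF I(1)]
    by (intro allI complement_at_of_degrees slice_systemD(1)[OF slice_system_slice[OF I(1)]] I(2))
      (use D_le in auto)
qed

lemma basis_coeff_univariate:
  fixes a a' :: "nat \<times> nat \<Rightarrow> 'k::field"
  shows "(\<lambda>s. coeff (basis (\<lambda>i. a i + s * (a' i - a i)) b) k) \<in> univariate_functions"
proof (induction b arbitrary: k rule: less_induct)
  case (less b)
  show ?case
  proof (cases b)
    case 0
    then show ?thesis by (simp add: univariate_functions.const_mem)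
  next
    case (Suc m)
    have s: "(\<lambda>s. (a (m, c) + s * (a' (m, c) - a (m, c))) * coeff (basis (\<lambda>i. a i + s * (a' i - a i)) c) k) \<in> univariate_functions"
      if "c \<le> m" for c
      using less.IH[of c k] that Suc by (intro univariate_functions.closure identity_univariate) auto
    have "(\<lambda>s. coeff (pCons 0 (basis (\<lambda>i. a i + s * (a' i - a i)) m)) k) \<in> univariate_functions"
      using less.IH[of m "k - 1"] Suc by (cases k) (auto simp: univariate_functions.const_mem)
    then have "(\<lambda>s. coeff (pCons 0 (basis (\<lambda>i. a i + s * (a' i - a i)) m)) k +
        (\<Sum>c\<in>{c. c \<le> m \<and> entry c \<le> Suc (entry m)}. (a (m, c) + s * (a' (m, c) - a (m, c))) * coeff (basis (\<lambda>i. a i + s * (a' i - a i)) c) k)) \<in> univariate_functions"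
      using s by (intro univariate_functions.add_mem univariate_functions.sum_mem) auto
    then show ?thesis by (simp add: Suc cell_basis.simps(2) coeff_sum)
  qed
qed

lemma ideal_curve_cell_line:
  fixes a a' :: "nat \<times> nat \<Rightarrow> 'k::field"
  shows "ideal_curve N (\<lambda>s. cell_ideal (\<lambda>i. a i + s * (a' i - a i)))"
  unfolding ideal_curve_def
proof (intro conjI allI impI)
  fix n
  let ?a = "\<lambda>s i. a i + s * (a' i - a i)"
  show "\<exists>(A :: nat set) v. finite A \<and> (\<forall>i\<in>A. \<forall>k. (\<lambda>s. coeff (v s i) k) \<in> univariate_functions) \<and>
        (\<forall>s. slice (cell_ideal (?a s)) n = pv.span (v s ` A) \<and> pv.dim (slice (cell_ideal (?a s)) n) = card A)"
    using basis_coeff_univariate[of a a'] dim_slice_degree_cell[OF cell_ideal_in_cell]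
    by (intro exI[of _ "D n"] exI[of _ "\<lambda>s. basis (?a s)"]) (auto simp: slice_cell_ideal cell_slices_def)
qed (auto simp: graded_cell_ideal slice_full_degree_cell[OF cell_ideal_in_cell])

text \<open>The ideals with at most \<open>generic_generators\<close> generators form an open subset of the cell. It is dense:
  join any ideal of the cell with one of this subset by a line in the space of parameters. All but finitely many
  points of the line lie both in a given neighbourhood of its start and in the subset, and the field is
  infinite.\<close>

theorem generic_value_degree_cell:
  assumes inf: "infinite (UNIV :: 'k::field set)"
  shows "generic_value (pullback_topology (degree_cell D :: 'k bipoly set set) (coordinates (standard_monomials D)) affine_zariski)
    min_generators = generic_generators"
proof (rule generic_value_eqI)
  let ?X = "degree_cell D :: 'k bipoly set set" and ?M = "standard_monomials D"
  let ?T = "pullback_topology ?X (coordinates ?M) affine_zariski"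
  let ?U = "{I \<in> ?X. min_generators I \<le> generic_generators}"
  have mb: "\<And>I. I \<in> ?X \<Longrightarrow> monomial_basis ?M I" by (rule degree_cell_monomial_basis)
  show op: "openin ?T ?U"
    by (rule openin_min_generators_le[OF _ mb dim_slice_degree_cell slice_full_degree_cell])
      (auto simp: degree_cell_def)
  obtain a' :: "nat \<times> nat \<Rightarrow> 'k" where a': "min_generators (cell_ideal a') = generic_generators"
    by (rule exists_generic_generators)
  then have U: "cell_ideal a' \<in> ?U" using cell_ideal_in_cell by auto
  then show "?U \<noteq> {}" by blast
  show "\<forall>I\<in>?U. min_generators I = generic_generators"
    using generic_generators_le by (auto intro: antisym)
  have top: "topspace ?T = ?X"
  proof -
    have "topspace affine_zariski = (UNIV :: (mono \<times> mono \<Rightarrow> 'k) set)"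
      using openin_subset[OF openin_affine_zariski_nonvanishing[OF polynomial_functions.const[of 1]]] by auto
    then show ?thesis by (simp add: topspace_pullback_topology)
  qed
  show "?T closure_of ?U = topspace ?T"
  proof
    show "?T closure_of ?U \<subseteq> topspace ?T" by (rule closure_of_subset_topspace)
    show "topspace ?T \<subseteq> ?T closure_of ?U"
    proof
      fix I assume I: "I \<in> topspace ?T"
      then obtain a where a: "I = cell_ideal a" using degree_cell_eq_cell_ideal top by metis
      show "I \<in> ?T closure_of ?U"
        unfolding in_closure_of
      proof (intro conjI allI impI I)
        fix O' assume O': "I \<in> O' \<and> openin ?T O'"
        define \<gamma> where "\<gamma> s = cell_ideal (\<lambda>i. a i + s * (a' i - a i))" for s
        have \<gamma>: "ideal_curve N \<gamma>" unfolding \<gamma>_def by (rule ideal_curve_cell_line)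
        have \<gamma>X: "\<gamma> s \<in> ?X" for s unfolding \<gamma>_def by (rule cell_ideal_in_cell)
        have "\<gamma> 0 = I" "\<gamma> 1 = cell_ideal a'" by (simp_all add: \<gamma>_def a)
        then have "finite {s. \<gamma> s \<notin> O'}" "finite {s. \<gamma> s \<notin> ?U}"
          using curve_meets_open[OF \<gamma> conjunct2[OF O'] _ mb \<gamma>X, of 0]
            curve_meets_open[OF \<gamma> op _ mb \<gamma>X, of 1] O' U by simp_all
        then have "finite ({s. \<gamma> s \<notin> O'} \<union> {s. \<gamma> s \<notin> ?U})" by simp
        then obtain s where "s \<notin> {s. \<gamma> s \<notin> O'} \<union> {s. \<gamma> s \<notin> ?U}"
          using ex_new_if_finite[OF inf] by blast
        then show "\<exists>y. y \<in> ?U \<and> y \<in> O'" by blast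
      qed
    qed
  qed
qed

end

section \<open>Shearing an ideal into general position\<close>

text \<open>The functions \<open>e \<mapsto> binomial e k\<close> with \<open>k \<le> r\<close> generate all products of \<open>r\<close> linear factors, in every
  characteristic, because \<open>(e - m) binomial e k = (k + 1) binomial e (k + 1) + (k - m) binomial e k\<close>.\<close>

lemma prod_diff_in_binomial_span:
  fixes R :: "nat set"
  assumes "finite R"
  shows "\<exists>\<alpha> :: nat \<Rightarrow> 'k::field. \<forall>e. (\<Prod>m\<in>R. of_nat e - of_nat m) = (\<Sum>k\<le>card R. \<alpha> k * of_nat (e choose k))"
  using assms
proof (induction R rule: finite_induct)
  case empty
  show ?case by (intro exI[of _ "\<lambda>_. 1"]) simp
next
  case (insert m R)
  then obtain \<alpha> :: "nat \<Rightarrow> 'k" where \<alpha>: "\<And>e. (\<Prod>m\<in>R. of_nat e - of_nat m) = (\<Sum>k\<le>card R. \<alpha> k * of_nat (e choose k))"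
    by blast
  define \<beta> where "\<beta> k = (if k = 0 then 0 else of_nat k * \<alpha> (k - 1)) + (if k \<le> card R then (of_nat k - of_nat m) * \<alpha> k else 0)" for k
  have step: "(of_nat e - of_nat m) * of_nat (e choose k) =
      of_nat (Suc k) * of_nat (e choose Suc k) + (of_nat k - of_nat m) * (of_nat (e choose k) :: 'k)" for e k
  proof -
    have "e * (e choose k) = Suc k * (e choose Suc k) + k * (e choose k)"
    proof (cases "k \<le> e")
      case True
      have "Suc k * (e choose Suc k) = (e - k) * (e choose k)"
        using binomial_absorb_comp[of e k] binomial_absorption[of k e] by (metis Suc_times_binomial_eq binomial_absorption mult.commute)
      then show ?thesis using True by (metis add.commute add_mult_distrib le_add_diff_inverse)
    next
      case False
      then show ?thesis by (simp add: binomial_eq_0)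
    qed
    then have "(of_nat (e * (e choose k)) :: 'k) = of_nat (Suc k * (e choose Suc k) + k * (e choose k))" by simp
    then have "(of_nat e * of_nat (e choose k) :: 'k) = of_nat (Suc k) * of_nat (e choose Suc k) + of_nat k * of_nat (e choose k)"
      by (simp only: of_nat_mult of_nat_add)
    then show ?thesis by (simp only: left_diff_distrib add_diff_eq)
  qed
  have "(\<Prod>m\<in>insert m R. of_nat e - of_nat m) = (\<Sum>k\<le>card (insert m R). \<beta> k * of_nat (e choose k))" for e
  proof -
    have "(\<Prod>m\<in>insert m R. of_nat e - (of_nat m :: 'k)) = (\<Sum>k\<le>card R. \<alpha> k * ((of_nat e - of_nat m) * of_nat (e choose k)))"
      using insert.hyps by (simp add: \<alpha> sum_distrib_left ac_simps)
    also have "\<dots> = (\<Sum>k\<le>card R. of_nat (Suc k) * \<alpha> k * of_nat (e choose Suc k)) + (\<Sum>k\<le>card R. (of_nat k - of_nat m) * \<alpha> k * of_nat (e choose k))"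
      unfolding step sum.distrib[symmetric] by (intro sum.cong refl) (simp add: algebra_simps)
    also have "(\<Sum>k\<le>card R. of_nat (Suc k) * \<alpha> k * of_nat (e choose Suc k)) =
        (\<Sum>k\<le>Suc (card R). (if k = 0 then 0 else of_nat k * \<alpha> (k - 1)) * of_nat (e choose k))"
      by (subst sum.atMost_Suc_shift) simp
    also have "(\<Sum>k\<le>card R. (of_nat k - of_nat m) * \<alpha> k * of_nat (e choose k)) =
        (\<Sum>k\<le>Suc (card R). (if k \<le> card R then (of_nat k - of_nat m) * \<alpha> k else 0) * of_nat (e choose k))"
      by simp
    finally show ?thesis
      using insert.hyps by (simp only: \<beta>_def distrib_right sum.distrib card_insert_disjoint[OF insert.hyps])
  qed
  then show ?case by blast
qed

text \<open>Pairing \<open>c\<close> with the product over \<open>m \<noteq> l\<close> of \<open>e - m\<close> isolates \<open>c l\<close>.\<close>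

lemma binomial_vandermonde:
  fixes c :: "nat \<Rightarrow> 'k::field"
  assumes S: "finite S" and inj: "inj_on (of_nat :: nat \<Rightarrow> 'k) S"
    and zero: "\<And>k. k < card S \<Longrightarrow> (\<Sum>e\<in>S. c e * of_nat (e choose k)) = 0" and l: "l \<in> S"
  shows "c l = 0"
proof -
  obtain \<alpha> :: "nat \<Rightarrow> 'k" where \<alpha>: "\<And>e. (\<Prod>m\<in>S - {l}. of_nat e - of_nat m) = (\<Sum>k\<le>card (S - {l}). \<alpha> k * of_nat (e choose k))"
    using prod_diff_in_binomial_span[of "S - {l}"] S by blast
  have "card (S - {l}) < card S" using S l by (rule card_Diff1_less)
  then have "0 = (\<Sum>k\<le>card (S - {l}). \<alpha> k * (\<Sum>e\<in>S. c e * of_nat (e choose k)))" using zero by simp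
  also have "\<dots> = (\<Sum>k\<le>card (S - {l}). \<Sum>e\<in>S. c e * (\<alpha> k * of_nat (e choose k)))"
    unfolding sum_distrib_left by (intro sum.cong refl) (simp add: ac_simps)
  also have "\<dots> = (\<Sum>e\<in>S. \<Sum>k\<le>card (S - {l}). c e * (\<alpha> k * of_nat (e choose k)))" by (rule sum.swap)
  also have "\<dots> = (\<Sum>e\<in>S. c e * (\<Prod>m\<in>S - {l}. of_nat e - of_nat m))"
    by (simp only: \<alpha> sum_distrib_left)
  also have "\<dots> = (\<Sum>e\<in>S. if e = l then c l * (\<Prod>m\<in>S - {l}. of_nat l - of_nat m) else 0)"
    using S by (intro sum.cong refl) (auto simp: prod_zero_iff)
  also have "\<dots> = c l * (\<Prod>m\<in>S - {l}. of_nat l - of_nat m)" using S l by simp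
  finally have "c l * (\<Prod>m\<in>S - {l}. of_nat l - (of_nat m :: 'k)) = 0" by simp
  moreover have "(\<Prod>m\<in>S - {l}. of_nat l - (of_nat m :: 'k)) \<noteq> 0"
    using S inj l by (auto simp: prod_zero_iff dest: inj_onD)
  ultimately show ?thesis by simp
qed

text \<open>The substitution \<open>x \<mapsto> x + s y\<close> on forms of degree \<open>n\<close>, after setting \<open>x = 1\<close>.\<close>

definition shear :: "nat \<Rightarrow> 'k::field \<Rightarrow> 'k poly \<Rightarrow> 'k poly" where
  "shear n s g = (\<Sum>i\<le>n. smult (coeff g i) (monom 1 i * [:1, s:] ^ (n - i)))"

lemma shear_add: "shear n s (f + g) = shear n s f + shear n s g"
  by (simp add: shear_def smult_add_left sum.distrib)

lemma shear_smult: "shear n s (smult c g) = smult c (shear n s g)"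
  by (simp add: shear_def pv.scale_sum_right)

lemma shear_diff: "shear n s (f - g) = shear n s f - shear n s g"
  by (simp add: shear_def smult_diff_left sum_subtractf)

lemma linear_shear: "Vector_Spaces.linear smult smult (shear n s)"
  by unfold_locales (simp_all add: shear_add shear_smult smult_add_right smult_add_left)

lemma coeff_shear:
  "coeff (shear n s g) m = (\<Sum>i\<le>n. coeff g i * (if i \<le> m then of_nat ((n - i) choose (m - i)) * s ^ (m - i) else 0))"
proof -
  have "coeff ([:1, s:] ^ k) j = of_nat (k choose j) * s ^ j" for k j
  proof (induction k arbitrary: j)
    case 0
    then show ?case by (cases j) auto
  next
    case (Suc k)
    show ?case by (cases j) (simp_all add: Suc.IH algebra_simps)
  qed
  then show ?thesis
    unfolding shear_def coeff_sum by (intro sum.cong refl) (auto simp: coeff_monom_mult)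
qed

lemma shear_Suc:
  assumes "degree g \<le> n"
  shows "shear (Suc n) s g = shear n s g + smult s (pCons 0 (shear n s g))"
proof -
  have "coeff g (Suc n) = 0" using assms by (simp add: coeff_eq_0)
  then have "shear (Suc n) s g = (\<Sum>i\<le>n. smult (coeff g i) (monom 1 i * [:1, s:] ^ (Suc n - i)))"
    by (simp add: shear_def)
  also have "\<dots> = (\<Sum>i\<le>n. [:1, s:] * smult (coeff g i) (monom 1 i * [:1, s:] ^ (n - i)))"
    by (intro sum.cong refl) (simp only: atMost_iff Suc_diff_le power_Suc mult_smult_right mult.left_commute)
  also have "\<dots> = [:1, s:] * shear n s g" by (simp only: shear_def sum_distrib_left)
  also have "\<dots> = shear n s g + smult s (pCons 0 (shear n s g))" by simp
  finally show ?thesis .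
qed

lemma shear_Suc_pCons: "shear (Suc n) s (pCons 0 g) = pCons 0 (shear n s g)"
proof (rule poly_eqI)
  fix m
  show "coeff (shear (Suc n) s (pCons 0 g)) m = coeff (pCons 0 (shear n s g)) m"
  proof (cases m)
    case 0
    then show ?thesis by (simp add: coeff_shear sum.atMost_Suc_shift del: sum.atMost_Suc)
  next
    case (Suc k)
    then show ?thesis
      by (simp add: coeff_shear sum.atMost_Suc_shift diff_Suc_Suc del: sum.atMost_Suc) (intro sum.cong refl, simp)
  qed
qed

lemma degree_shear: "degree (shear n s g) \<le> n"
proof (rule degree_le, intro allI impI)
  fix m assume "n < m"
  then show "coeff (shear n s g) m = 0" by (auto simp: coeff_shear binomial_eq_0 intro!: sum.neutral)
qed

lemma shear_0: "degree g \<le> n \<Longrightarrow> shear n 0 g = g"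
proof (rule poly_eqI)
  fix m assume d: "degree g \<le> n"
  have "coeff (shear n 0 g) m = (\<Sum>i\<le>n. if i = m then coeff g m else 0)"
    unfolding coeff_shear by (intro sum.cong refl) (auto simp: power_0_left)
  then show "coeff (shear n 0 g) m = coeff g m" using d by (simp add: coeff_eq_0)
qed

text \<open>A shear does not change the lowest coefficient.\<close>

lemma shear_eq_0:
  assumes d: "degree g \<le> n" and z: "shear n s g = 0" shows "g = 0"
proof (rule ccontr)
  assume "g \<noteq> 0"
  then have ex: "\<exists>m. coeff g m \<noteq> 0" by (metis leading_coeff_0_iff)
  define m where "m = (LEAST m. coeff g m \<noteq> 0)"
  have m: "coeff g m \<noteq> 0" "\<And>i. i < m \<Longrightarrow> coeff g i = 0"
    unfolding m_def using LeastI_ex[OF ex] not_less_Least by blast+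
  have "m \<le> n" using m(1) d le_degree order_trans by blast
  have "coeff (shear n s g) m = (\<Sum>i\<le>n. if i = m then coeff g m else 0)"
    unfolding coeff_shear using m(2) by (intro sum.cong refl) (auto simp: not_le)
  also have "\<dots> = coeff g m" using \<open>m \<le> n\<close> by simp
  finally show False using z m(1) by simp
qed

lemma coeff_shear_univariate: "(\<lambda>s. coeff (shear n s g) m) \<in> univariate_functions"
proof -
  have pow: "(\<lambda>s. s ^ k) \<in> univariate_functions" for k
    by (induction k) (auto intro: univariate_functions.closure identity_univariate)
  have "(\<lambda>s. coeff g i * (if i \<le> m then of_nat ((n - i) choose (m - i)) * s ^ (m - i) else 0)) \<in> univariate_functions" for i
    by (cases "i \<le> m") (auto intro!: univariate_functions.closure pow)
  then show ?thesis unfolding coeff_shear by (intro univariate_functions.sum_mem)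
qed

definition sheared_ideal :: "'k::field bipoly set \<Rightarrow> 'k \<Rightarrow> 'k bipoly set" where
  "sheared_ideal I s = ideal_of_slices (\<lambda>n. shear n s ` slice I n)"

context
  fixes I :: "'k::field bipoly set"
  assumes I: "graded_ideal I"
begin

lemma slice_system_shear: "slice_system (\<lambda>n. shear n s ` slice I n)"
  unfolding slice_system_def
proof (intro allI ballI conjI)
  fix n
  have W: "slice_system (slice I)" by (rule slice_system_slice[OF I])
  interpret h: Vector_Spaces.linear smult smult "shear n s :: 'k poly \<Rightarrow> _" by (rule linear_shear)
  show "pv.subspace (shear n s ` slice I n)" using slice_systemD(1)[OF W] by (rule h.subspace_image)
  fix f assume "f \<in> shear n s ` slice I n"
  then obtain g where g: "g \<in> slice I n" "f = shear n s g" by auto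
  have d: "degree g \<le> n" using g(1) slice_systemD(2)[OF W] by blast
  show "degree f \<le> n" using g(2) degree_shear by simp
  have p: "pCons 0 f = shear (Suc n) s (pCons 0 g)" using g(2) by (simp add: shear_Suc_pCons)
  then show "pCons 0 f \<in> shear (Suc n) s ` slice I (Suc n)"
    using slice_systemD(4)[OF W g(1)] by blast
  have "f = shear (Suc n) s (g - smult s (pCons 0 g))"
    unfolding shear_diff shear_smult shear_Suc_pCons shear_Suc[OF d] g(2) by simp
  moreover have "g - smult s (pCons 0 g) \<in> slice I (Suc n)"
    using slice_systemD(1,3,4)[OF W] g(1) by (intro pv.subspace_diff pv.subspace_scale)
  ultimately show "f \<in> shear (Suc n) s ` slice I (Suc n)" by blast
qed

lemma slice_sheared_ideal: "slice (sheared_ideal I s) n = shear n s ` slice I n"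
  unfolding sheared_ideal_def by (rule slice_ideal_of_slices[OF slice_system_shear])

lemma graded_sheared_ideal: "graded_ideal (sheared_ideal I s)"
  unfolding sheared_ideal_def by (rule graded_ideal_of_slices[OF slice_system_shear])

lemma sheared_ideal_0: "sheared_ideal I 0 = I"
proof -
  have "shear n 0 ` slice I n = slice I n" for n
    using shear_0 by (force simp: slice_def image_iff)
  then show ?thesis using graded_ideal_eq_iff[OF graded_sheared_ideal I] slice_sheared_ideal by simp
qed

lemma slice_echelon_basis:
  obtains g where "\<And>b. degree (g b) = b" "\<And>b. lead_coeff (g b) = 1"
    "slice I n = pv.span (g ` (degree ` (slice I n - {0})))"
    "\<And>b. b \<in> degree ` (slice I n - {0}) \<Longrightarrow> g b \<in> slice I n"
proof -
  let ?B = "degree ` (slice I n - {0})"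
  have sub: "pv.subspace (slice I n)" using slice_systemD(1)[OF slice_system_slice[OF I]] .
  have "\<exists>g. degree g = b \<and> lead_coeff g = 1 \<and> (b \<in> ?B \<longrightarrow> g \<in> slice I n)" for b
  proof (cases "b \<in> ?B")
    case True
    then obtain h where h: "b = degree h" "h \<in> slice I n - {0}" by (rule imageE)
    then have "smult (inverse (lead_coeff h)) h \<in> slice I n" by (intro pv.subspace_scale[OF sub]) simp
    then show ?thesis using h by (intro exI[of _ "smult (inverse (lead_coeff h)) h"]) auto
  next
    case False
    then show ?thesis by (intro exI[of _ "monom 1 b"]) (auto simp: degree_monom_eq)
  qed
  then obtain g where g: "\<And>b. degree (g b) = b" "\<And>b. lead_coeff (g b) = 1" "\<And>b. b \<in> ?B \<Longrightarrow> g b \<in> slice I n"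
    by metis
  have "g b \<noteq> 0" for b using g(2)[of b] by auto
  then have "slice I n = pv.span (g ` ?B)" using g by (intro echelon_span[OF sub]) auto
  then show ?thesis using that g by blast
qed

lemma finite_slice_degrees: "finite (degree ` (slice I n - {0}))"
  by (rule finite_subset[of _ "{..n}"]) (auto simp: slice_def)

lemma slice_sheared_span:
  assumes g: "\<And>b. degree (g b) = b" "\<And>b. lead_coeff (g b) = 1"
    "slice I n = pv.span (g ` (degree ` (slice I n - {0})))"
  shows "slice (sheared_ideal I s) n = pv.span ((\<lambda>b. shear n s (g b)) ` (degree ` (slice I n - {0})))"
    "pv.dim (slice (sheared_ideal I s) n) = pv.dim (slice I n)"
proof -
  let ?B = "degree ` (slice I n - {0})"
  interpret h: Vector_Spaces.linear smult smult "shear n s :: 'k poly \<Rightarrow> _" by (rule linear_shear)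
  have "shear n s ` slice I n = shear n s ` pv.span (g ` ?B)" using g(3) by (rule arg_cong)
  also have "\<dots> = pv.span (shear n s ` g ` ?B)" by (rule h.span_image[symmetric])
  finally show sp: "slice (sheared_ideal I s) n = pv.span ((\<lambda>b. shear n s (g b)) ` ?B)"
    unfolding slice_sheared_ideal by (simp add: image_image)
  have nz: "g b \<noteq> 0" for b using g(2)[of b] by auto
  have ind: "inj_on g ?B" "pv.independent (g ` ?B)"
    using echelon_independent[OF finite_slice_degrees, of n g] g(1) nz by auto
  have inj: "inj_on (shear n s) (pv.span (g ` ?B))"
    unfolding g(3)[symmetric]
  proof (rule inj_onI)
    fix x y assume xy: "x \<in> slice I n" "y \<in> slice I n" "shear n s x = shear n s y"
    then have "shear n s (x - y) = 0" by (simp add: shear_diff)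
    moreover have "degree (x - y) \<le> n" using xy by (auto simp: slice_def intro: degree_diff_le)
    ultimately show "x = y" using shear_eq_0 by fastforce
  qed
  have ind': "pv.independent (shear n s ` g ` ?B)" by (rule h.independent_injective_image[OF ind(2) inj])
  have "pv.dim (slice (sheared_ideal I s) n) = card (shear n s ` g ` ?B)"
    unfolding sp using pv.dim_span_eq_card_independent[OF ind'] by (simp add: image_image del: pv.dim_span)
  also have "\<dots> = card (g ` ?B)" using inj_on_subset[OF inj pv.span_superset] by (rule card_image)
  also have "\<dots> = pv.dim (slice I n)" using pv.dim_span_eq_card_independent[OF ind(2)] g(3) by simp
  finally show "pv.dim (slice (sheared_ideal I s) n) = pv.dim (slice I n)" .
qed

lemma dim_slice_sheared: "pv.dim (slice (sheared_ideal I s) n) = pv.dim (slice I n)"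
  by (rule slice_echelon_basis[of n]) (rule slice_sheared_span(2))

lemma ideal_curve_shear:
  assumes full: "\<And>n. N \<le> n \<Longrightarrow> slice I n = {g. degree g \<le> n}"
  shows "ideal_curve N (sheared_ideal I)"
  unfolding ideal_curve_def
proof (intro conjI allI impI graded_sheared_ideal)
  fix n s assume n: "N \<le> n"
  show "slice (sheared_ideal I s) n = {g. degree g \<le> n}"
  proof (rule pv.subspace_eq_of_dim_eq)
    show "pv.subspace (slice (sheared_ideal I s) n)"
      using slice_systemD(1)[OF slice_system_slice[OF graded_sheared_ideal]] .
    show "pv.dim {g :: 'k poly. degree g \<le> n} \<le> pv.dim (slice (sheared_ideal I s) n)"
      unfolding dim_slice_sheared full[OF n] ..
  qed (use degree_le_subset_span in \<open>auto simp: slice_def\<close>)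
next
  fix n
  let ?B = "degree ` (slice I n - {0})"
  obtain g where g: "\<And>b. degree (g b) = b" "\<And>b. lead_coeff (g b) = 1" "slice I n = pv.span (g ` ?B)"
    by (rule slice_echelon_basis[of n]) (rule that)
  have "pv.dim (slice I n) = card ?B"
    by (rule dim_eq_card_degrees[OF slice_systemD(1)[OF slice_system_slice[OF I]] finite_slice_degrees])
  then have "pv.dim (slice (sheared_ideal I s) n) = card ?B" for s by (simp add: dim_slice_sheared)
  then show "\<exists>(A :: nat set) v. finite A \<and> (\<forall>i\<in>A. \<forall>k. (\<lambda>s. coeff (v s i) k) \<in> univariate_functions) \<and>
        (\<forall>s. slice (sheared_ideal I s) n = pv.span (v s ` A) \<and> pv.dim (slice (sheared_ideal I s) n) = card A)"
    using slice_sheared_span(1)[OF g] finite_slice_degrees coeff_shear_univariate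
    by (intro exI[of _ ?B] exI[of _ "\<lambda>s b. shear n s (g b)"]) blast
qed

text \<open>For a suitable \<open>s\<close> the initial monomials of degree \<open>n\<close> are the last ones. Let \<open>r\<close> be the dimension of the slice.
  The claim is that the coefficients of \<open>y\<^sup>n\<^sup>-\<^sup>k\<close> with \<open>k < r\<close> determine the elements of the sheared slice.
  For the monic basis element \<open>g b\<close> this coefficient is \<open>Q s b k\<close> up to a power of \<open>s\<close>, and
  \<open>Q 0 b k\<close> is the binomial coefficient of \<open>n - b\<close> over \<open>k\<close>. Since the \<open>n - b\<close> are distinct in the field,
  the matrix \<open>Q 0\<close> is invertible, hence so is \<open>Q s\<close> for all but finitely many \<open>s\<close>. It is a Wronskian
  matrix up to scaling of its rows and columns.\<close>

lemma sheared_no_low_degree: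
  assumes inf: "infinite (UNIV :: 'k set)" and inj: "inj_on (of_nat :: nat \<Rightarrow> 'k) {..n}"
  obtains s where "\<And>f. f \<in> slice (sheared_ideal I s) n \<Longrightarrow> degree f + pv.dim (slice I n) \<le> n \<Longrightarrow> f = 0"
proof -
  let ?B = "degree ` (slice I n - {0})"
  let ?r = "card ?B"
  have fB: "finite ?B" by (rule finite_slice_degrees)
  have Bn: "b \<le> n" if "b \<in> ?B" for b using that by (auto simp: slice_def)
  have r: "pv.dim (slice I n) = ?r"
    by (rule dim_eq_card_degrees[OF slice_systemD(1)[OF slice_system_slice[OF I]] fB])
  obtain g where g: "\<And>b. degree (g b) = b" "\<And>b. lead_coeff (g b) = 1" "slice I n = pv.span (g ` ?B)"
    by (rule slice_echelon_basis[of n]) (rule that)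
  have g_top: "coeff (g b) b = 1" for b using g(1,2)[of b] by simp
  \<comment> \<open>The coefficient of \<open>y\<^sup>n\<^sup>-\<^sup>k\<close> in the sheared \<open>g b\<close>, multiplied by \<open>s ^ (b + k) / s ^ n\<close> which
    removes the negative powers of \<open>s\<close> and the common factor that vanishes at \<open>s = 0\<close>.\<close>
  define Q where "Q s b k = (\<Sum>i\<le>b. coeff (g b) i * of_nat ((n - i) choose k) * s ^ (b - i))" for s :: 'k and b k
  define w where "w s b = (\<Sum>k<?r. monom (Q s b k) k)" for s b
  have coeff_w: "coeff (w s b) k = (if k < ?r then Q s b k else 0)" for s b k
    by (simp add: w_def coeff_sum if_distrib sum.delta cong: if_cong)
  have pow: "(\<lambda>s :: 'k. s ^ k) \<in> univariate_functions" for k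
    by (induction k) (auto intro: univariate_functions.closure identity_univariate)
  have w_U: "(\<lambda>s. coeff (w s b) k) \<in> univariate_functions" for b k
    unfolding coeff_w Q_def by (cases "k < ?r") (auto intro!: univariate_functions.closure pow)
  have ind0: "c b = 0" if c: "(\<Sum>b\<in>?B. smult (c b) (w 0 b)) = 0" and b: "b \<in> ?B" for c b
  proof -
    have Q0: "Q 0 b k = of_nat ((n - b) choose k)" for b k
    proof -
      have "Q 0 b k = (\<Sum>i\<le>b. if i = b then of_nat ((n - b) choose k) else 0)"
        unfolding Q_def by (intro sum.cong refl) (auto simp: power_0_left g_top)
      then show ?thesis by simp
    qed
    let ?S = "(\<lambda>b. n - b) ` ?B"
    have injB: "inj_on (\<lambda>b. n - b) ?B" using Bn by (intro inj_onI) (metis diff_diff_cancel)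
    have "(\<Sum>e\<in>?S. c (n - e) * of_nat (e choose k)) = 0" if "k < card ?S" for k
    proof -
      have k: "k < ?r" using that card_image[OF injB] by simp
      have "(\<Sum>e\<in>?S. c (n - e) * of_nat (e choose k)) = (\<Sum>b\<in>?B. c (n - (n - b)) * of_nat ((n - b) choose k))"
        by (simp only: sum.reindex[OF injB] o_def)
      also have "\<dots> = (\<Sum>b\<in>?B. c b * of_nat ((n - b) choose k))"
        using Bn by (intro sum.cong refl) simp
      also have "\<dots> = coeff (\<Sum>b\<in>?B. smult (c b) (w 0 b)) k"
        using k by (simp add: coeff_sum coeff_w Q0)
      finally show ?thesis using c by simp
    qed
    moreover have "inj_on (of_nat :: nat \<Rightarrow> 'k) ?S" by (rule inj_on_subset[OF inj]) auto
    moreover have "n - b \<in> ?S" using b by blast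
    ultimately have "c (n - (n - b)) = 0"
      using fB by (intro binomial_vandermonde[of ?S "\<lambda>e. c (n - e)"]) auto
    then show ?thesis using Bn[OF b] by simp
  qed
  have dim0: "pv.dim (pv.span (w 0 ` ?B)) = ?r"
  proof -
    have ind: "inj_on (w 0) ?B" "pv.independent (w 0 ` ?B)"
      by (rule pv.independent_family[OF fB], rule ind0, assumption+)+
    show ?thesis
      using pv.dim_span_eq_card_independent[OF ind(2)] card_image[OF ind(1)] by simp
  qed
  obtain p where p: "p \<in> univariate_functions" "p 0 \<noteq> 0"
    "\<And>s. p s \<noteq> 0 \<Longrightarrow> pv.dim (pv.span (w 0 ` ?B)) \<le> pv.dim (pv.span (w s ` ?B))"
    by (rule univariate_functions.rank_semicontinuous[where J="?B" and w=w and ?x0.0=0])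
      (rule fB, rule w_U, rule that)
  have "finite ({s. p s = 0} \<union> {0})" using finite_zeros_univariate[OF p(1,2)] by simp
  then obtain s where s: "p s \<noteq> 0" "s \<noteq> 0" using ex_new_if_finite[OF inf] by blast
  have "pv.dim (pv.span (w s ` ?B)) \<le> ?r"
    using pv.dim_le_card[of "pv.span (w s ` ?B)" "w s ` ?B"] card_image_le[OF fB, of "w s"] fB by simp
  then have dims: "pv.dim (pv.span (w s ` ?B)) = ?r" using p(3)[OF s(1)] dim0 by simp
  note ind = independent_of_dim_eq_card[OF fB dims]
  have "f = 0" if f: "f \<in> slice (sheared_ideal I s) n" and d: "degree f + pv.dim (slice I n) \<le> n" for f
  proof -
    obtain h where h: "h \<in> slice I n" "f = shear n s h" using f slice_sheared_ideal by auto
    have nz: "g b \<noteq> 0" for b using g(2)[of b] by auto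
    have h_span: "h \<in> pv.span (g ` ?B)" using g(3) h(1) by (rule subst)
    have g_inj: "inj_on g ?B" by (rule echelon_independent(1)[OF fB]) (use g(1) nz in auto)
    obtain c where c: "h = (\<Sum>b\<in>?B. smult (c b) (g b))"
      by (rule span_image_eq[OF fB g_inj h_span]) (rule that)
    have coeff_g: "s ^ (b + k) * coeff (shear n s (g b)) (n - k) = s ^ n * Q s b k" if b: "b \<in> ?B" and k: "k \<le> n" for b k
    proof -
      let ?S = "\<Sum>i\<le>b. coeff (g b) i * (if i \<le> n - k then of_nat ((n - i) choose (n - k - i)) * s ^ (n - k - i) else 0)"
      have "coeff (shear n s (g b)) (n - k) = (\<Sum>i\<le>b. coeff (g b) i * (if i \<le> n - k then of_nat ((n - i) choose (n - k - i)) * s ^ (n - k - i) else 0))"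
        unfolding coeff_shear using Bn[OF b] g(1)[of b]
        by (intro sum.mono_neutral_right) (auto simp: coeff_eq_0)
      moreover have "s ^ (b + k) * ?S = (\<Sum>i\<le>b. s ^ n * (coeff (g b) i * of_nat ((n - i) choose k) * s ^ (b - i)))"
        unfolding sum_distrib_left
      proof (intro sum.cong refl)
        fix i assume i: "i \<in> {..b}"
        show "s ^ (b + k) * (coeff (g b) i * (if i \<le> n - k then of_nat ((n - i) choose (n - k - i)) * s ^ (n - k - i) else 0)) =
          s ^ n * (coeff (g b) i * of_nat ((n - i) choose k) * s ^ (b - i))"
        proof (cases "i \<le> n - k")
          case True
          have "(n - i) choose (n - k - i) = (n - i) choose k"
            using True k i Bn[OF b] binomial_symmetric[of k "n - i"] by (simp add: add.commute)
          moreover have "s ^ (b + k) * s ^ (n - k - i) = s ^ n * s ^ (b - i)"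
            using True k i by (simp add: add.commute flip: power_add)
          then have "s ^ (b + k) * (x * (y * s ^ (n - k - i))) = s ^ n * (x * y * s ^ (b - i))" for x y
            by (metis mult.assoc mult.left_commute)
          ultimately show ?thesis using True by simp
        next
          case False
          then have "n - i < k" using i Bn[OF b] k by auto
          then show ?thesis using False by (simp add: binomial_eq_0)
        qed
      qed
      ultimately show ?thesis by (simp only: Q_def sum_distrib_left)
    qed
    have "(\<Sum>b\<in>?B. smult (c b * inverse (s ^ b)) (w s b)) = 0"
    proof (rule poly_eqI)
      fix k
      show "coeff (\<Sum>b\<in>?B. smult (c b * inverse (s ^ b)) (w s b)) k = coeff 0 k"
      proof (cases "k < ?r")
        case True
        have kn: "k \<le> n" and "degree f < n - k" using True d r by auto
        then have "0 = coeff f (n - k)" by (simp add: coeff_eq_0)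
        also have "f = (\<Sum>b\<in>?B. smult (c b) (shear n s (g b)))"
        proof -
          interpret h: Vector_Spaces.linear smult smult "shear n s :: 'k poly \<Rightarrow> _" by (rule linear_shear)
          show ?thesis unfolding h(2) c by (simp add: h.sum shear_smult)
        qed
        also have "coeff \<dots> (n - k) = (\<Sum>b\<in>?B. c b * coeff (shear n s (g b)) (n - k))" by (simp add: coeff_sum)
        also have "\<dots> = (\<Sum>b\<in>?B. s ^ n * inverse (s ^ k) * (c b * inverse (s ^ b) * Q s b k))"
        proof (intro sum.cong refl)
          fix b assume "b \<in> ?B"
          have "coeff (shear n s (g b)) (n - k) = inverse (s ^ (b + k)) * (s ^ (b + k) * coeff (shear n s (g b)) (n - k))"
            using s(2) by simp
          also have "\<dots> = inverse (s ^ b) * inverse (s ^ k) * (s ^ n * Q s b k)"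
            unfolding coeff_g[OF \<open>b \<in> ?B\<close> kn] by (simp add: power_add)
          finally show "c b * coeff (shear n s (g b)) (n - k) = s ^ n * inverse (s ^ k) * (c b * inverse (s ^ b) * Q s b k)"
            by (simp only: ac_simps)
        qed
        finally have "s ^ n * inverse (s ^ k) * (\<Sum>b\<in>?B. c b * inverse (s ^ b) * Q s b k) = 0"
          by (simp only: sum_distrib_left)
        then have "(\<Sum>b\<in>?B. c b * inverse (s ^ b) * Q s b k) = 0" using s(2) by simp
        then show ?thesis using True by (simp add: coeff_sum coeff_w)
      next
        case False
        then show ?thesis by (simp add: coeff_sum coeff_w)
      qed
    qed
    from scalars_zero_of_independent[OF fB ind this] have "c b = 0" if "b \<in> ?B" for b
      using that s(2) by simp
    then have "h = 0" unfolding c by (intro sum.neutral) simp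
    moreover have "shear n s 0 = 0" by (simp add: shear_def)
    ultimately show ?thesis using h(2) by simp
  qed
  then show ?thesis by (rule that)
qed

end

section \<open>Generic graded ideals with a given Hilbert function\<close>

text \<open>The rows of the dense cell of \<open>G T\<close>: in every degree the last monomials of the lexicographic order.\<close>

definition final_rows :: "(nat \<Rightarrow> nat) \<Rightarrow> nat \<Rightarrow> nat set" where
  "final_rows T n = {T n..n}"

lemma curve_meets_open_G:
  fixes \<gamma> :: "'k::field \<Rightarrow> 'k bipoly set"
  assumes \<gamma>: "ideal_curve N \<gamma>" "\<And>s. \<gamma> s \<in> G T"
    and O': "openin (G_topology T) O'" and s0: "\<gamma> s0 \<in> O'"
  shows "finite {s. \<gamma> s \<notin> O'}"
proof -
  have "generate_topology_on (\<Union>M. {U. openin (pullback_topology {I \<in> G T. monomial_basis M I} (coordinates M) affine_zariski) U}) O'"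
    using O' unfolding G_topology_def by (rule openin_topology_generated_by)
  then have "\<gamma> s0 \<in> O' \<longrightarrow> finite {s. \<gamma> s \<notin> O'}"
  proof (induction O' rule: generate_topology_on.induct)
    case Empty
    show ?case by simp
  next
    case (Int U U')
    have "{s. \<gamma> s \<notin> U \<inter> U'} = {s. \<gamma> s \<notin> U} \<union> {s. \<gamma> s \<notin> U'}" by auto
    then show ?case using Int.IH by simp
  next
    case (UN K)
    show ?case
    proof
      assume "\<gamma> s0 \<in> \<Union>K"
      then obtain U where U: "U \<in> K" "\<gamma> s0 \<in> U" by auto
      then have "finite {s. \<gamma> s \<notin> U}" using UN.IH by blast
      then show "finite {s. \<gamma> s \<notin> \<Union>K}" by (rule rev_finite_subset) (use U(1) in auto)
    qed
  next
    case (Basis U)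
    then obtain M where M: "openin (pullback_topology {I \<in> G T. monomial_basis M I} (coordinates M) affine_zariski) U"
      by blast
    show ?case using curve_meets_open[OF \<gamma>(1) M] \<gamma>(2) by simp
  qed
  then show ?thesis using s0 by blast
qed

lemma dim_slice_G:
  assumes I: "I \<in> G T" and T: "T n \<le> Suc n"
  shows "pv.dim (slice I n) = Suc n - T n"
proof -
  have "T n = Suc n - pv.dim (slice I n)"
    using I hilbert_function_eq[of I n] by (auto simp: G_def)
  then show ?thesis using dim_slice_le[of I n] by simp
qed

text \<open>All rows that enter in degree \<open>n\<close> are at least \<open>T n\<close>, so for \<open>t \<le> Suc (T n)\<close> none is excluded from the count. For
  larger \<open>t\<close> the only column left is \<open>Suc n\<close>, and the row \<open>n\<close> compensates for it.\<close>

lemma staircase_defect_final_rows: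
  assumes T1: "\<And>n. T n \<le> Suc n" and T2: "\<And>n. T n \<le> n \<Longrightarrow> T (Suc n) \<le> T n"
  shows "staircase_defect (entering (final_rows T) n) (entering (final_rows T) (Suc n)) =
     card (entering (final_rows T) (Suc n)) - card (entering (final_rows T) n)"
proof -
  let ?B = "entering (final_rows T) n" and ?C = "entering (final_rows T) (Suc n)"
  have fin: "finite ?B" "finite ?C" by (auto simp: entering_def final_rows_def)
  have ex: "staircase_excess ?B ?C t \<le> card ?C - card ?B" for t
  proof (cases "t \<le> Suc (T n)")
    case True
    have "{b \<in> ?B. t \<le> Suc b} = ?B" using True by (auto simp: entering_def final_rows_def)
    moreover have "card {c \<in> ?C. t \<le> c} \<le> card ?C" using fin by (intro card_mono) auto
    ultimately show ?thesis by (simp add: staircase_excess_def diff_le_mono)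
  next
    case False
    have sub: "{c \<in> ?C. t \<le> c} \<subseteq> {Suc n}"
      using False by (auto simp: entering_def final_rows_def)
    have "staircase_excess ?B ?C t = 0"
    proof (cases "t \<le> Suc n")
      case True
      then have "n \<in> {b \<in> ?B. t \<le> Suc b}"
        using False by (auto simp: entering_def final_rows_def split: nat.splits)
      then have "card {n} \<le> card {b \<in> ?B. t \<le> Suc b}" using fin by (intro card_mono) auto
      moreover have "card {c \<in> ?C. t \<le> c} \<le> 1" using card_mono[OF _ sub] by simp
      ultimately show ?thesis by (simp add: staircase_excess_def)
    next
      case f: False
      then have e: "{c \<in> ?C. t \<le> c} = {}" using sub by auto
      show ?thesis unfolding staircase_excess_def e by simp
    qed
    then show ?thesis by simp
  qed
  obtain t where "staircase_defect ?B ?C = staircase_excess ?B ?C t"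
    by (rule staircase_defect_attained[OF fin(2)])
  then show ?thesis using ex card_diff_le_staircase_defect[OF fin(2), of ?B] by (metis antisym)
qed

lemma staircase_final_rows:
  assumes T1: "\<And>n. T n \<le> Suc n" and T2: "\<And>n. T n \<le> n \<Longrightarrow> T (Suc n) \<le> T n"
    and T3: "\<And>n. N \<le> n \<Longrightarrow> T n = 0"
  shows "staircase (final_rows T) N"
proof
  fix b n
  show "b \<in> final_rows T n \<Longrightarrow> b \<le> n" by (simp add: final_rows_def)
  show "b \<in> final_rows T n \<Longrightarrow> b \<in> final_rows T (Suc n)" "b \<in> final_rows T n \<Longrightarrow> Suc b \<in> final_rows T (Suc n)"
    using T2[of n] by (auto simp: final_rows_def)
  show "N \<le> n \<Longrightarrow> final_rows T n = {..n}" using T3 by (auto simp: final_rows_def)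
qed

lemma degrees_eq_final_rows:
  fixes I :: "'k::field bipoly set"
  assumes I: "graded_ideal I" and d: "pv.dim (slice I n) = Suc n - T n"
    and low: "\<And>f. f \<in> slice I n \<Longrightarrow> degree f < T n \<Longrightarrow> f = 0"
  shows "degree ` (slice I n - {0}) = final_rows T n"
proof (rule card_subset_eq)
  show "finite (final_rows T n)" by (simp add: final_rows_def)
  show sub: "degree ` (slice I n - {0}) \<subseteq> final_rows T n"
  proof
    fix b assume "b \<in> degree ` (slice I n - {0})"
    then obtain f where f: "b = degree f" "f \<in> slice I n - {0}" by (rule imageE)
    then show "b \<in> final_rows T n" using low[of f] by (auto simp: final_rows_def slice_def not_less[symmetric])
  qed
  then have "finite (degree ` (slice I n - {0}))" by (rule finite_subset) (simp add: final_rows_def)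
  then show "card (degree ` (slice I n - {0})) = card (final_rows T n)"
    using dim_eq_card_degrees[OF slice_systemD(1)[OF slice_system_slice[OF I]], of n] d by (simp add: final_rows_def)
qed

text \<open>The cell of \<open>final_rows T\<close> is a chart of \<open>G T\<close>, hence open. To reach it from an arbitrary ideal \<open>I\<close>
  within a given neighbourhood, follow the curve of shears of \<open>I\<close>; then follow a line inside the cell
  to an ideal with the generic number of generators.\<close>

theorem generic_value_G:
  fixes T :: "nat \<Rightarrow> nat"
  assumes inf: "infinite (UNIV :: 'k::field set)"
    and T1: "\<And>n. T n \<le> Suc n" and T2: "\<And>n. T n \<le> n \<Longrightarrow> T (Suc n) \<le> T n"
    and T3: "\<And>n. N \<le> n \<Longrightarrow> T n = 0"
    and char: "\<And>n. 0 < T n \<Longrightarrow> T n \<le> n \<Longrightarrow> inj_on (of_nat :: nat \<Rightarrow> 'k) {..n}"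
  shows "generic_value (G_topology T :: 'k bipoly set topology) min_generators =
    staircase.generic_generators (final_rows T) N"
proof -
  interpret staircase "final_rows T" N by (rule staircase_final_rows[OF T1 T2 T3])
  let ?D = "final_rows T"
  let ?M = "standard_monomials ?D"
  let ?G = "G_topology T :: 'k bipoly set topology"
  let ?X = "{I :: 'k bipoly set. I \<in> G T \<and> monomial_basis ?M I}"
  have cell_G: "I \<in> G T" if "I \<in> degree_cell ?D" for I :: "'k bipoly set"
  proof -
    have "hilbert_function I n = T n" for n
      unfolding hilbert_function_eq dim_slice_degree_cell[OF that] using T1[of n] by (simp add: final_rows_def)
    then show ?thesis using that by (auto simp: G_def degree_cell_def)
  qed
  have X: "?X = degree_cell ?D"
  proof (intro set_eqI iffI)
    fix I :: "'k bipoly set" assume I: "I \<in> ?X"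
    then have gr: "graded_ideal I" by (simp add: G_def)
    have "degree ` (slice I n - {0}) = ?D n" for n
    proof (rule degrees_eq_final_rows[OF gr])
      show "pv.dim (slice I n) = Suc n - T n" using I T1 by (intro dim_slice_G) auto
      fix f assume f: "f \<in> slice I n" "degree f < T n"
      have "complement_at ?M n (slice I n)" using I monomial_basis_iff[OF gr] by blast
      moreover have "supported_in ?M n f"
        unfolding supported_in_def
      proof (intro allI impI)
        fix c assume "coeff f c \<noteq> 0"
        then have "c \<le> degree f" by (rule le_degree)
        then show "c \<le> n \<and> (n - c, c) \<in> ?M"
          using f by (auto simp: slice_def standard_monomials_def final_rows_def)
      qed
      ultimately show "f = 0" using f(1) unfolding complement_at_def by blast
    qed
    then show "I \<in> degree_cell ?D" using gr by (simp add: degree_cell_def)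
  next
    fix I :: "'k bipoly set" assume "I \<in> degree_cell ?D"
    then show "I \<in> ?X" using cell_G degree_cell_monomial_basis by blast
  qed
  have openX: "openin ?G U" if "openin (pullback_topology ?X (coordinates ?M) affine_zariski) U" for U
    unfolding G_topology_def by (rule topology_generated_by_Basis) (use that in blast)
  have G_full: "slice I n = {g. degree g \<le> n}" if I: "I \<in> G T" and n: "N \<le> n" for I :: "'k bipoly set" and n
  proof (rule pv.subspace_eq_of_dim_eq)
    show "pv.subspace (slice I n)"
      using I slice_systemD(1)[OF slice_system_slice] by (auto simp: G_def)
    show "pv.dim {g :: 'k poly. degree g \<le> n} \<le> pv.dim (slice I n)"
      unfolding dim_slice_G[OF I T1] dim_degree_le T3[OF n] by simp
  qed (use degree_le_subset_span in \<open>auto simp: slice_def\<close>)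
  let ?U = "{I \<in> ?X. min_generators I \<le> generic_generators}"
  have op: "openin ?G ?U"
  proof (rule openX, rule openin_min_generators_le)
    fix I :: "'k bipoly set" and n assume I: "I \<in> ?X"
    show "graded_ideal I" using I by (simp add: G_def)
    show "monomial_basis ?M I" using I by simp
    show "pv.dim (slice I n) = Suc n - T n" using I T1 by (intro dim_slice_G) auto
    show "slice I n = {g. degree g \<le> n}" if "N \<le> n" using I that by (intro G_full) auto
  qed
  obtain a' :: "nat \<times> nat \<Rightarrow> 'k" where a': "min_generators (cell_ideal a') = generic_generators"
    by (rule exists_generic_generators)
  have U: "cell_ideal a' \<in> ?U" using cell_ideal_in_cell[of a'] a' X by auto
  show ?thesis
  proof (rule generic_value_eqI[OF op])
    show "?U \<noteq> {}" using U by blast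
    show "\<forall>I\<in>?U. min_generators I = generic_generators"
      using generic_generators_le X by (auto intro: antisym)
    show "?G closure_of ?U = topspace ?G"
    proof
      show "?G closure_of ?U \<subseteq> topspace ?G" by (rule closure_of_subset_topspace)
      show "topspace ?G \<subseteq> ?G closure_of ?U"
      proof
        fix I assume I: "I \<in> topspace ?G"
        have "topspace ?G \<subseteq> G T"
          unfolding G_topology_def topology_generated_by_topspace
          by (auto dest!: openin_subset simp: topspace_pullback_topology)
        then have IG: "I \<in> G T" using I by blast
        then have gr: "graded_ideal I" by (simp add: G_def)
        show "I \<in> ?G closure_of ?U"
          unfolding in_closure_of
        proof (intro conjI allI impI I)
          fix O' assume O': "I \<in> O' \<and> openin ?G O'"
          define \<gamma> where "\<gamma> = sheared_ideal I"
          have \<gamma>: "ideal_curve N \<gamma>" unfolding \<gamma>_def by (rule ideal_curve_shear[OF gr G_full[OF IG]])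
          have \<gamma>G: "\<gamma> s \<in> G T" for s
          proof -
            have "hilbert_function (\<gamma> s) n = hilbert_function I n" for n
              by (simp add: hilbert_function_eq \<gamma>_def dim_slice_sheared[OF gr])
            then show ?thesis using IG graded_sheared_ideal[OF gr] by (auto simp: G_def \<gamma>_def)
          qed
          have "\<gamma> 0 = I" by (simp add: \<gamma>_def sheared_ideal_0[OF gr])
          then have fin1: "finite {s. \<gamma> s \<notin> O'}"
            using curve_meets_open_G[OF \<gamma> \<gamma>G, of O' 0] O' by simp
          have fin2: "finite {s. \<not> complement_at ?M n (slice (\<gamma> s) n)}" for n
          proof -
            have "\<exists>s. \<forall>f\<in>slice (\<gamma> s) n. degree f < T n \<longrightarrow> f = 0"
            proof (cases "0 < T n \<and> T n \<le> n")
              case True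
              obtain s where "\<And>f. f \<in> slice (sheared_ideal I s) n \<Longrightarrow> degree f + pv.dim (slice I n) \<le> n \<Longrightarrow> f = 0"
                by (rule sheared_no_low_degree[OF gr inf char[of n]]) (use True that in auto)
              then have "\<forall>f\<in>slice (\<gamma> s) n. degree f < T n \<longrightarrow> f = 0"
                using True dim_slice_G[OF IG T1, of n] by (auto simp: \<gamma>_def)
              then show ?thesis ..
            next
              case False
              then consider "T n = 0" | "T n = Suc n" using T1[of n] by linarith
              then show ?thesis
              proof cases
                case 2
                have "pv.dim (slice I n) = 0" using dim_slice_G[OF IG T1, of n] 2 by simp
                then have "card (degree ` (slice I n - {0})) = 0"
                  using dim_eq_card_degrees[OF slice_systemD(1)[OF slice_system_slice[OF gr]] finite_slice_degrees[OF gr]] by simp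
                then have "slice I n - {0} = {}" using finite_slice_degrees[OF gr] by simp
                moreover have "slice (\<gamma> 0) n = slice I n" using \<open>\<gamma> 0 = I\<close> by simp
                ultimately show ?thesis by (intro exI[of _ 0]) auto
              qed simp
            qed
            then obtain s where s: "\<And>f. f \<in> slice (\<gamma> s) n \<Longrightarrow> degree f < T n \<Longrightarrow> f = 0" by blast
            have gs: "graded_ideal (\<gamma> s)" using \<gamma>G[of s] by (simp add: G_def)
            have "degree ` (slice (\<gamma> s) n - {0}) = ?D n"
              by (rule degrees_eq_final_rows[OF gs dim_slice_G[OF \<gamma>G T1] s])
            then have "complement_at ?M n (slice (\<gamma> s) n)"
              using slice_systemD(1)[OF slice_system_slice[OF gs]]
              by (intro complement_at_of_degrees) (auto simp: final_rows_def)
            then obtain q where q: "q \<in> univariate_functions" "q s \<noteq> 0" "\<And>s'. q s' \<noteq> 0 \<Longrightarrow> complement_at ?M n (slice (\<gamma> s') n)"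
              by (rule curve_complement_at[OF \<gamma>]) (rule that)
            have "finite {s'. q s' = 0}" using q(1,2) by (rule finite_zeros_univariate)
            then show ?thesis by (rule rev_finite_subset) (use q(3) in auto)
          qed
          have "complement_at ?M n (slice (\<gamma> s) n)" if "N \<le> n" for n s
          proof -
            have "slice (\<gamma> s) n = slice (cell_ideal a') n"
              using G_full[OF \<gamma>G that] G_full[OF _ that, of "cell_ideal a'"] U by simp
            moreover have "complement_at ?M n (slice (cell_ideal a') n)"
              using U monomial_basis_iff[OF graded_cell_ideal] by blast
            ultimately show ?thesis by simp
          qed
          then have small: "n < N" if "\<not> complement_at ?M n (slice (\<gamma> s) n)" for n s
            using that by (meson not_le)
          have "finite ({s. \<gamma> s \<notin> O'} \<union> (\<Union>n<N. {s. \<not> complement_at ?M n (slice (\<gamma> s) n)}))"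
            using fin1 fin2 by simp
          then obtain s1 where s1: "s1 \<notin> {s. \<gamma> s \<notin> O'} \<union> (\<Union>n<N. {s. \<not> complement_at ?M n (slice (\<gamma> s) n)})"
            using ex_new_if_finite[OF inf] by blast
          have "graded_ideal (\<gamma> s1)" using \<gamma>G[of s1] by (simp add: G_def)
          then have "monomial_basis ?M (\<gamma> s1)" using monomial_basis_iff s1 small by blast
          then have "\<gamma> s1 \<in> degree_cell ?D" using \<gamma>G X by blast
          then obtain a where a: "\<gamma> s1 = cell_ideal a" by (rule degree_cell_eq_cell_ideal)
          define \<gamma>' where "\<gamma>' s = cell_ideal (\<lambda>i. a i + s * (a' i - a i))" for s
          have \<gamma>': "ideal_curve N \<gamma>'" unfolding \<gamma>'_def by (rule ideal_curve_cell_line)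
          have \<gamma>'G: "\<gamma>' s \<in> G T" for s unfolding \<gamma>'_def by (rule cell_G[OF cell_ideal_in_cell])
          have "\<gamma>' 0 = \<gamma> s1" "\<gamma>' 1 = cell_ideal a'" by (simp_all add: \<gamma>'_def a)
          then have "finite {s. \<gamma>' s \<notin> O'}" "finite {s. \<gamma>' s \<notin> ?U}"
            using curve_meets_open_G[OF \<gamma>' \<gamma>'G conjunct2[OF O'], of 0]
              curve_meets_open_G[OF \<gamma>' \<gamma>'G op, of 1] s1 U by simp_all
          then have "finite ({s. \<gamma>' s \<notin> O'} \<union> {s. \<gamma>' s \<notin> ?U})" by simp
          then obtain s where "s \<notin> {s. \<gamma>' s \<notin> O'} \<union> {s. \<gamma>' s \<notin> ?U}"
            using ex_new_if_finite[OF inf] by blast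
          then show "\<exists>y. y \<in> ?U \<and> y \<in> O'" by blast
        qed
      qed
    qed
  qed
qed

section \<open>A criterion for special partitions\<close>

lemma staircase_defect_empty: "finite F \<Longrightarrow> staircase_defect {} F = card F"
proof (rule antisym)
  assume F: "finite F"
  obtain t where t: "staircase_defect {} F = staircase_excess {} F t" by (rule staircase_defect_attained[OF F])
  have "card {c \<in> F. t \<le> c} \<le> card F" using F by (intro card_mono) auto
  then show "staircase_defect {} F \<le> card F" unfolding t by (simp add: staircase_excess_def)
  show "card F \<le> staircase_defect {} F" using card_diff_le_staircase_defect[OF F, of "{}"] by simp
qed

lemma staircase_defect_eq_0:
  assumes B: "finite B" "n \<in> B" and F: "F \<subseteq> {Suc n}" shows "staircase_defect B F = 0"
proof -
  have fF: "finite F" using F finite_subset by blast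
  obtain t where t: "staircase_defect B F = staircase_excess B F t" by (rule staircase_defect_attained[OF fF])
  show ?thesis
  proof (cases "t \<le> Suc n")
    case True
    have "card {n} \<le> card {b \<in> B. t \<le> Suc b}" using B True by (intro card_mono) auto
    moreover have "card {c \<in> F. t \<le> c} \<le> card {Suc n}" using F by (intro card_mono) auto
    ultimately show ?thesis unfolding t staircase_excess_def by simp
  next
    case False
    then have e: "{c \<in> F. t \<le> c} = {}" using F by auto
    show ?thesis unfolding t staircase_excess_def e by simp
  qed
qed

lemma sum_neq_iff_of_le:
  fixes a b :: "nat \<Rightarrow> nat"
  assumes "finite A" "\<And>n. n \<in> A \<Longrightarrow> a n \<le> b n"
  shows "sum b A \<noteq> sum a A \<longleftrightarrow> (\<exists>n\<in>A. b n \<noteq> a n)"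
proof
  show "sum b A \<noteq> sum a A \<Longrightarrow> \<exists>n\<in>A. b n \<noteq> a n" by (metis sum.cong)
  assume "\<exists>n\<in>A. b n \<noteq> a n"
  then have "\<exists>n\<in>A. a n < b n" using assms(2) by (metis le_neq_implies_less)
  then have "sum a A < sum b A" using assms by (intro sum_strict_mono_ex1) auto
  then show "sum b A \<noteq> sum a A" by simp
qed

lemma (in staircase) card_entering:
  "card (entering D 0) = card (D 0)" "card (entering D (Suc n)) = card (D (Suc n)) - card (D n)"
  using card_D_Suc[of n] by (simp_all add: entering_def)

lemma (in staircase) staircase_later: "N \<le> N' \<Longrightarrow> staircase D N'"
  by unfold_locales (erule D_le, erule D_Suc, erule Suc_D, rule D_full, erule (1) le_trans)

text \<open>Both numbers are sums over the degrees with the same first term, and the terms for the cell of \<open>P\<close>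
  are at least those for the dense cell. So the sums differ iff some terms differ.\<close>

theorem special_iff_defect:
  assumes inf: "infinite (UNIV :: 'k::field set)"
    and P: "is_partition P" and T: "diagonal_lengths TYPE('k) P = T"
    and char: "\<And>n. 0 < T n \<Longrightarrow> T n \<le> n \<Longrightarrow> inj_on (of_nat :: nat \<Rightarrow> 'k) {..n}"
  shows "special TYPE('k) T P \<longleftrightarrow> (\<exists>n. staircase_defect (entering (diagonal_rows P) n) (entering (diagonal_rows P) (Suc n)) \<noteq>
      card (entering (diagonal_rows P) (Suc n)) - card (entering (diagonal_rows P) n))"
proof -
  let ?D = "diagonal_rows P"
  let ?defect = "\<lambda>n. staircase_defect (entering ?D n) (entering ?D (Suc n))"
  let ?diff = "\<lambda>n. card (entering ?D (Suc n)) - card (entering ?D n)"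
  obtain N where N: "staircase ?D N" by (rule staircase_diagonal_rows[OF P])
  have key: "special TYPE('k) T P \<longleftrightarrow> (\<exists>n\<in>{..<N'}. ?defect n \<noteq> ?diff n)" if "N \<le> N'" for N'
  proof -
    interpret staircase ?D N' using staircase.staircase_later[OF N that] .
    have T_eq: "T n = Suc n - card (?D n)" for n using diagonal_lengths_eq[OF P, where 'k='k] T by auto
    have card_le: "card (?D n) \<le> Suc n" for n
      using card_mono[of "{..n}" "?D n"] D_le by auto
    have T1: "T n \<le> Suc n" for n by (simp add: T_eq)
    have T2: "T (Suc n) \<le> T n" if "T n \<le> n" for n
    proof -
      have "?D n \<noteq> {}" using that T_eq[of n] by auto
      then have ne: "Max (?D n) \<in> ?D n" by (intro Max_in) auto
      have "insert (Suc (Max (?D n))) (?D n) \<subseteq> ?D (Suc n)" using D_Suc Suc_D[OF ne] by auto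
      from card_mono[OF finite_D this] have "card (insert (Suc (Max (?D n))) (?D n)) \<le> card (?D (Suc n))" .
      moreover have "Suc (Max (?D n)) \<notin> ?D n"
      proof
        assume "Suc (Max (?D n)) \<in> ?D n"
        from Max_ge[OF finite_D this] show False by simp
      qed
      ultimately have "Suc (card (?D n)) \<le> card (?D (Suc n))" by simp
      then show ?thesis unfolding T_eq by linarith
    qed
    have T3: "T n = 0" if "N' \<le> n" for n using D_full[OF that] by (simp add: T_eq)
    interpret G: staircase "final_rows T" N' by (rule staircase_final_rows[OF T1 T2 T3])
    have card_eq: "card (final_rows T n) = card (?D n)" for n using card_le[of n] by (simp add: final_rows_def T_eq)
    have ent_eq: "card (entering (final_rows T) n) = card (entering ?D n)" for n
      by (cases n) (simp_all only: card_entering G.card_entering card_eq)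
    have "C P = standard_monomials ?D" by (auto simp: standard_monomials_def diagonal_rows_def E_def)
    then have "kappa_cell TYPE('k) P = generic_generators"
      unfolding kappa_cell_def cell_topology_def jordan_cell_eq[OF P]
      using generic_value_degree_cell[OF inf] by simp
    moreover have "kappa TYPE('k) T = G.generic_generators"
      unfolding kappa_def by (rule generic_value_G[OF inf T1 T2 T3 char])
    ultimately have "special TYPE('k) T P \<longleftrightarrow> (\<Sum>n<N'. ?defect n) \<noteq> (\<Sum>n<N'. ?diff n)"
      by (simp add: special_def generic_generators_def G.generic_generators_def card_eq ent_eq staircase_defect_final_rows[OF T1 T2])
    then show ?thesis
      using sum_neq_iff_of_le[of "{..<N'}" ?diff ?defect] card_diff_le_staircase_defect[OF finite_entering] by simp
  qed
  show ?thesis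
  proof
    assume "special TYPE('k) T P"
    then show "\<exists>n. ?defect n \<noteq> ?diff n" using key[OF order_refl] by blast
  next
    assume "\<exists>n. ?defect n \<noteq> ?diff n"
    then obtain n where "?defect n \<noteq> ?diff n" ..
    then show "special TYPE('k) T P" using key[of "max N (Suc n)"] by auto
  qed
qed

text \<open>Only the thresholds \<open>t = 0\<close> and \<open>t = Suc v\<close> with \<open>v \<in> K1 \<union> K2\<close> matter for the excess of \<open>(B, F)\<close>: by
  \<open>gap\<close>, passing from \<open>v\<close> to \<open>Suc v\<close> for another \<open>v\<close> does not increase the excess. At these
  thresholds the counts are those of the right-hand side, where \<open>\<sigma>\<close> closes up the rows.\<close>

lemma staircase_defect_transfer:
  fixes \<sigma> :: "nat \<Rightarrow> nat"
  assumes fin: "finite B" "finite F"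
    and \<sigma>: "bij_betw \<sigma> (K1 \<union> K2) {..e}" "\<And>u v. u \<in> K1 \<union> K2 \<Longrightarrow> v \<in> K1 \<union> K2 \<Longrightarrow> u < v \<Longrightarrow> \<sigma> u < \<sigma> v"
    and disj: "K1 \<inter> K2 = {}"
    and cards: "card F = Suc (card K2)" "card B = card K1"
    and above_F: "\<And>v. v \<in> K1 \<union> K2 \<Longrightarrow> card {c \<in> F. Suc v \<le> c} = Suc (card {h \<in> K2. v < h})"
    and above_B: "\<And>v. v \<in> K1 \<union> K2 \<Longrightarrow> card {b \<in> B. v \<le> b} = card {a \<in> K1. v \<le> a}"
    and gap: "\<And>v. v \<in> B \<Longrightarrow> Suc v \<notin> K1 \<union> K2 \<Longrightarrow> Suc v \<in> F"
  shows "staircase_defect B F = staircase_defect (\<sigma> ` K1) ({..Suc e} - \<sigma> ` K1)"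
proof -
  let ?V = "K1 \<union> K2" and ?B = "\<sigma> ` K1" and ?F = "{..Suc e} - \<sigma> ` K1"
  have finV: "finite ?V" using bij_betw_finite[OF \<sigma>(1)] by simp
  have inj: "inj_on \<sigma> ?V" using \<sigma>(1) by (rule bij_betw_imp_inj_on)
  have img: "\<sigma> ` ?V = {..e}" using \<sigma>(1) by (rule bij_betw_imp_surj_on)
  have less_iff: "\<sigma> u < \<sigma> v \<longleftrightarrow> u < v" if "u \<in> ?V" "v \<in> ?V" for u v
    using \<sigma>(2)[OF that] \<sigma>(2)[OF that(2,1)] by (metis less_asym less_irrefl linorder_neqE_nat)
  have compl: "{..e} - \<sigma> ` K1 = \<sigma> ` K2"
    using img inj disj by (auto simp: inj_on_def)
  have "\<sigma> ` K1 \<subseteq> {..e}" using img by blast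
  then have "?F = insert (Suc e) ({..e} - \<sigma> ` K1)" by auto
  then have F_eq: "?F = insert (Suc e) (\<sigma> ` K2)" by (simp only: compl)
  have K2_le: "\<sigma> ` K2 \<subseteq> {..e}" using img by auto
  have excess0: "staircase_excess B F 0 = staircase_excess ?B ?F 0"
  proof -
    have "card ?F = Suc (card (\<sigma> ` K2))"
      unfolding F_eq using K2_le finV by (subst card_insert_disjoint) auto
    also have "card (\<sigma> ` K2) = card K2" using inj by (intro card_image) (auto simp: inj_on_def)
    finally have "card ?F = card F" using cards by simp
    moreover have "card ?B = card B" using inj cards by (subst card_image) (auto simp: inj_on_def)
    moreover have "{c \<in> S. 0 \<le> c} = S" "{b \<in> S. 0 \<le> Suc b} = S" for S :: "nat set" by simp_all
    ultimately show ?thesis unfolding staircase_excess_def by (simp only:)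
  qed
  have excessS: "staircase_excess B F (Suc v) = staircase_excess ?B ?F (Suc (\<sigma> v))" if v: "v \<in> ?V" for v
  proof -
    have "\<sigma> v \<le> e" using v img by blast
    then have "{c \<in> ?F. Suc (\<sigma> v) \<le> c} = insert (Suc e) (\<sigma> ` {h \<in> K2. v < h})"
      unfolding F_eq using less_iff[OF v] by (auto simp: Suc_le_eq)
    moreover have "Suc e \<notin> \<sigma> ` {h \<in> K2. v < h}" using K2_le by auto
    moreover have "card (\<sigma> ` {h \<in> K2. v < h}) = card {h \<in> K2. v < h}"
      using inj by (intro card_image) (auto simp: inj_on_def)
    ultimately have "card {c \<in> ?F. Suc (\<sigma> v) \<le> c} = card {c \<in> F. Suc v \<le> c}"
      using above_F[OF v] finV by simp
    moreover have "card {b \<in> ?B. Suc (\<sigma> v) \<le> Suc b} = card {b \<in> B. Suc v \<le> Suc b}"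
    proof -
      have "{b \<in> ?B. Suc (\<sigma> v) \<le> Suc b} = \<sigma> ` {a \<in> K1. v \<le> a}"
        using less_iff[OF _ v] by (auto simp: not_less[symmetric])
      moreover have "card (\<sigma> ` {a \<in> K1. v \<le> a}) = card {a \<in> K1. v \<le> a}"
        using inj by (intro card_image) (auto simp: inj_on_def)
      ultimately show ?thesis using above_B[OF v] by simp
    qed
    ultimately show ?thesis unfolding staircase_excess_def by (simp only:)
  qed
  have fin': "finite ?F" by simp
  have le: "staircase_excess B F t \<le> staircase_defect ?B ?F" for t
  proof (induction t)
    case 0
    show ?case unfolding excess0 by (rule staircase_excess_le_defect[OF fin'])
  next
    case (Suc v)
    show ?case
    proof (cases "v \<in> ?V")
      case True
      show ?thesis unfolding excessS[OF True] by (rule staircase_excess_le_defect[OF fin'])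
    next
      case False
      have F_split: "{c \<in> F. v \<le> c} = {c \<in> F. Suc v \<le> c} \<union> (F \<inter> {v})" by auto
      have cF: "card {c \<in> F. v \<le> c} = card {c \<in> F. Suc v \<le> c} + card (F \<inter> {v})"
        unfolding F_split by (intro card_Un_disjoint) (use fin in auto)
      have "staircase_excess B F (Suc v) \<le> staircase_excess B F v"
      proof (cases v)
        case 0
        have "card {b \<in> B. v \<le> Suc b} = card {b \<in> B. Suc v \<le> Suc b}" using 0 by simp
        then show ?thesis unfolding staircase_excess_def cF by linarith
      next
        case (Suc u)
        have B_split: "{b \<in> B. v \<le> Suc b} = {b \<in> B. Suc v \<le> Suc b} \<union> (B \<inter> {u})" using Suc by auto
        have cB: "card {b \<in> B. v \<le> Suc b} = card {b \<in> B. Suc v \<le> Suc b} + card (B \<inter> {u})"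
          unfolding B_split by (intro card_Un_disjoint) (use fin Suc in auto)
        have "card (B \<inter> {u}) \<le> card (F \<inter> {v})"
        proof (cases "u \<in> B")
          case True
          then have "v \<in> F" using gap[of u] False Suc by simp
          then show ?thesis using True by simp
        qed simp
        then show ?thesis unfolding staircase_excess_def cF cB by linarith
      qed
      then show ?thesis using Suc.IH by simp
    qed
  qed
  have ge: "staircase_excess ?B ?F t \<le> staircase_defect B F" for t
  proof (cases t)
    case 0
    show ?thesis unfolding 0 excess0[symmetric] by (rule staircase_excess_le_defect[OF fin(2)])
  next
    case (Suc u)
    show ?thesis
    proof (cases "u \<le> e")
      case True
      then obtain v where "v \<in> ?V" "u = \<sigma> v" using img by blast
      then show ?thesis unfolding Suc using excessS[of v] staircase_excess_le_defect[OF fin(2), of B "Suc v"] by simp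
    next
      case False
      then have "{c \<in> ?F. t \<le> c} = {}" using Suc by auto
      then have "staircase_excess ?B ?F t = 0" unfolding staircase_excess_def by (simp only: card.empty)
      then show ?thesis by simp
    qed
  qed
  show ?thesis
  proof (rule antisym)
    show "staircase_defect B F \<le> staircase_defect ?B ?F"
      by (rule staircase_defect_attained[OF fin(2), of B]) (use le in simp)
    show "staircase_defect ?B ?F \<le> staircase_defect B F"
      by (rule staircase_defect_attained[OF fin', of ?B]) (use ge in simp)
  qed
qed

context staircase
begin

text \<open>The rows of the monomial sets that define component partitions. \<open>border_rows\<close>, \<open>generator_rows\<close>,
  \<open>hand_rows\<close> and \<open>first_hand_rows\<close> belong to \<open>horizontal_border\<close>, \<open>V1\<close>, \<open>hand_monos\<close> and \<open>V2\<close>.\<close>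

definition border_rows :: "nat \<Rightarrow> nat set" where
  "border_rows i = {b \<in> D i. 0 < b \<and> b - 1 \<notin> D (i - 1)}"

definition generator_rows :: "nat \<Rightarrow> nat set" where
  "generator_rows i = (if 0 \<in> D i then border_rows i \<union>
     {b \<in> {b \<in> entering D i. b < i \<and> (\<forall>a\<in>border_rows i. b < a)}.
        \<forall>b' \<in> {b \<in> entering D i. b < i \<and> (\<forall>a\<in>border_rows i. b < a)}. b' \<le> b}
     else border_rows i)"

definition hand_rows :: "nat \<Rightarrow> nat set" where
  "hand_rows i = entering D (Suc i) - {Suc i}"

text \<open>The bound \<open>card (entering D (Suc i)) - 1\<close> is \<open>\<delta> T (i + 1)\<close>, if \<open>T\<close> is the Hilbert function.\<close>

definition first_hand_rows :: "nat \<Rightarrow> nat set" where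
  "first_hand_rows i = {h \<in> hand_rows i. card {h' \<in> hand_rows i. h' < h} < card (entering D (Suc i)) - 1}"

text \<open>If \<open>x\<^sup>i\<close> is in the ideal, the rows of degree \<open>i\<close> above the horizontal border form an initial segment
  \<open>{..v0}\<close>: a row \<open>u > 0\<close> of degree \<open>i\<close> that is not on the border comes from the row \<open>u - 1\<close> of degree \<open>i - 1\<close>.
  Its last element \<open>v0\<close> is on the vertical border, since otherwise \<open>Suc v0\<close> would belong to the segment.\<close>

lemma generator_rows_cases:
  assumes i: "0 < i" and proper: "D i \<noteq> {..i}"
  obtains (no_corner) "0 \<notin> D i" "generator_rows i = border_rows i"
  | (corner) v0 where "0 \<in> D i" "generator_rows i = insert v0 (border_rows i)" "{..v0} \<subseteq> D i"
      "\<And>a. a \<in> border_rows i \<Longrightarrow> v0 < a"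
proof (cases "0 \<in> D i")
  case False
  then show ?thesis using no_corner by (simp add: generator_rows_def)
next
  case True
  let ?A = "border_rows i"
  define Z where "Z = {u \<in> D i. \<forall>a\<in>?A. u < a}"
  have finZ: "finite Z" by (simp add: Z_def)
  have "0 \<in> Z" using True by (auto simp: Z_def border_rows_def)
  define v0 where "v0 = Max Z"
  have v0: "v0 \<in> Z" unfolding v0_def using finZ \<open>0 \<in> Z\<close> by (intro Max_in) auto
  have initial: "{..u} \<subseteq> D i" if "u \<in> Z" for u
    using that
  proof (induction u)
    case 0
    then show ?case using True by auto
  next
    case (Suc u)
    have "Suc u \<notin> ?A" using Suc.prems by (auto simp: Z_def)
    then have "u \<in> D (i - 1)" using Suc.prems by (auto simp: Z_def border_rows_def)
    then have "u \<in> D i" using D_mono[of "i - 1" i] by auto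
    then have "u \<in> Z" using Suc.prems by (auto simp: Z_def)
    moreover have "{..Suc u} = insert (Suc u) {..u}" by auto
    ultimately show ?case using Suc.IH Suc.prems by (auto simp: Z_def)
  qed
  have not_prev: "v0 \<notin> D (i - 1)"
  proof
    assume "v0 \<in> D (i - 1)"
    then have "Suc v0 \<in> D i" "Suc v0 \<notin> ?A" using Suc_D[of v0 "i - 1"] i by (auto simp: border_rows_def)
    then have "Suc v0 \<in> Z" using v0 by (auto simp: Z_def) (metis Suc_lessI)
    then have "Suc v0 \<le> v0" unfolding v0_def using finZ by (rule Max_ge[rotated])
    then show False by simp
  qed
  have "v0 < i"
  proof (rule ccontr)
    assume "\<not> v0 < i"
    then have "{..i} \<subseteq> D i" using initial[OF v0] by auto
    then show False using proper D_le by auto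
  qed
  have ent: "b \<in> entering D i \<longleftrightarrow> b \<in> D i \<and> b \<notin> D (i - 1)" for b using i by (cases i) (auto simp: entering_def)
  let ?Y = "{b \<in> entering D i. b < i \<and> (\<forall>a\<in>?A. b < a)}"
  have "v0 \<in> ?Y" using v0 not_prev \<open>v0 < i\<close> ent by (auto simp: Z_def)
  moreover have "b \<le> v0" if "b \<in> ?Y" for b
    unfolding v0_def using that finZ ent by (intro Max_ge) (auto simp: Z_def)
  ultimately have "{b \<in> ?Y. \<forall>b'\<in>?Y. b' \<le> b} = {v0}" by (blast intro: antisym)
  then have "generator_rows i = insert v0 ?A" using True by (simp add: generator_rows_def)
  then show ?thesis using corner[of v0] True initial[OF v0] v0 by (auto simp: Z_def)
qed

text \<open>Count the rows \<open>b \<ge> v\<close> of degree \<open>i\<close> in two ways: a row has either been there in degree \<open>i - 1\<close> or is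
  entering; and a row \<open>b > v\<close> is either the successor of a row of degree \<open>i - 1\<close> or on the horizontal
  border.\<close>

lemma card_entering_above:
  assumes i: "0 < i"
  shows "card {b \<in> entering D i. v \<le> b} = card (D i \<inter> {v}) + card {a \<in> border_rows i. v < a}"
proof -
  obtain k where k: "i = Suc k" using i by (cases i) auto
  let ?X = "{b \<in> D k. v \<le> b}"
  have "{b \<in> D i. v \<le> b} = {b \<in> entering D i. v \<le> b} \<union> ?X"
    using D_Suc unfolding k entering_def by auto
  then have 1: "card {b \<in> D i. v \<le> b} = card {b \<in> entering D i. v \<le> b} + card ?X"
    unfolding k entering_def by (subst card_Un_disjoint[symmetric]) auto
  have "{b \<in> D i. v \<le> b} = (D i \<inter> {v}) \<union> (Suc ` ?X \<union> {a \<in> border_rows i. v < a})"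
  proof (intro set_eqI iffI)
    fix b assume b: "b \<in> {b \<in> D i. v \<le> b}"
    show "b \<in> (D i \<inter> {v}) \<union> (Suc ` ?X \<union> {a \<in> border_rows i. v < a})"
    proof (cases "b = v")
      case False
      then obtain b' where "b = Suc b'" "v \<le> b'" using b by (cases b) auto
      then show ?thesis using b by (auto simp: border_rows_def k)
    qed (use b in auto)
  next
    fix b assume "b \<in> (D i \<inter> {v}) \<union> (Suc ` ?X \<union> {a \<in> border_rows i. v < a})"
    then show "b \<in> {b \<in> D i. v \<le> b}" using Suc_D by (auto simp: k border_rows_def)
  qed
  then have "card {b \<in> D i. v \<le> b} = card ((D i \<inter> {v}) \<union> (Suc ` ?X \<union> {a \<in> border_rows i. v < a}))" by simp
  also have "\<dots> = card (D i \<inter> {v}) + card (Suc ` ?X \<union> {a \<in> border_rows i. v < a})"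
    by (intro card_Un_disjoint) (auto simp: border_rows_def)
  also have "card (Suc ` ?X \<union> {a \<in> border_rows i. v < a}) = card ?X + card {a \<in> border_rows i. v < a}"
    by (subst card_Un_disjoint) (auto simp: border_rows_def k card_image)
  finally show ?thesis using 1 by simp
qed

text \<open>Exactly one entering row \<open>z\<close> is missing among the first hand rows, and it lies below these and below all rows of
  degree \<open>i\<close>. It is \<open>Suc i\<close>
  if \<open>y\<^sup>i\<^sup>+\<^sup>1\<close> is in the ideal, and the last hand row otherwise: below every row of degree \<open>i\<close> there is then a
  hand row, namely the successor of the last row of degree \<open>i\<close>.\<close>

lemma first_hand_rows_top:
  assumes nonempty: "D i \<noteq> {}"
  obtains z where "entering D (Suc i) = insert z (first_hand_rows i)" "z \<notin> first_hand_rows i"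
    "\<And>v. v \<in> first_hand_rows i \<union> D i \<Longrightarrow> v < z"
proof (cases "Suc i \<in> D (Suc i)")
  case True
  have ent: "Suc i \<in> entering D (Suc i)" using True D_le[of "Suc i" i] by (auto simp: entering_def)
  have cH: "card (hand_rows i) = card (entering D (Suc i)) - 1" using ent by (simp add: hand_rows_def)
  have "card {h' \<in> hand_rows i. h' < h} < card (hand_rows i)" if "h \<in> hand_rows i" for h
    using that by (intro psubset_card_mono) (auto simp: hand_rows_def)
  then have "first_hand_rows i = hand_rows i" by (auto simp: first_hand_rows_def cH)
  moreover have "v < Suc i" if "v \<in> hand_rows i \<union> D i" for v
    using that D_le[of v i] D_le[of v "Suc i"] by (auto simp: hand_rows_def entering_def)
  ultimately show ?thesis using ent by (intro that[of "Suc i"]) (auto simp: hand_rows_def)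
next
  case False
  let ?H = "hand_rows i"
  have H: "?H = entering D (Suc i)" using False by (auto simp: hand_rows_def entering_def)
  have fin: "finite ?H" by (simp add: H)
  have top: "\<exists>h\<in>?H. v < h" if "v \<in> D i" for v
  proof -
    let ?u = "Max (D i)"
    have u: "?u \<in> D i" "v \<le> ?u" using Max_in[OF finite_D nonempty] Max_ge[OF finite_D that] by simp_all
    have "Suc ?u \<notin> D i"
    proof
      assume "Suc ?u \<in> D i"
      from Max_ge[OF finite_D this] show False by simp
    qed
    then have "Suc ?u \<in> ?H" using Suc_D[OF u(1)] by (auto simp: H entering_def)
    then show ?thesis using u(2) by (auto intro: le_imp_less_Suc)
  qed
  have ne: "?H \<noteq> {}" using top nonempty by blast
  \<comment> \<open>\<open>y\<^sup>i\<^sup>+\<^sup>1\<close> is not in the ideal: there is one hand row too many, and the last one is dropped.\<close>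
  define z where "z = Max ?H"
  have z: "z \<in> ?H" "\<And>h. h \<in> ?H \<Longrightarrow> h \<le> z" unfolding z_def using fin ne by auto
  have "first_hand_rows i = ?H - {z}"
  proof (intro set_eqI iffI)
    fix h assume "h \<in> first_hand_rows i"
    then have h: "h \<in> ?H" "card {h' \<in> ?H. h' < h} < card ?H - 1" by (auto simp: first_hand_rows_def H)
    have "{h' \<in> ?H. h' < z} = ?H - {z}" using z by (auto simp: order_le_less)
    then have "card {h' \<in> ?H. h' < z} = card ?H - 1" using z(1) by simp
    then show "h \<in> ?H - {z}" using h by auto
  next
    fix h assume h: "h \<in> ?H - {z}"
    have "card {h' \<in> ?H. h' < h} < card (?H - {z})"
      using h z fin by (intro psubset_card_mono) (auto simp: order_le_less dest: z(2))
    then show "h \<in> first_hand_rows i" using h z(1) by (simp add: first_hand_rows_def H[symmetric])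
  qed
  moreover have "v < z" if "v \<in> (?H - {z}) \<union> D i" for v
    using that top z(2) by (auto simp: order_le_less) (meson le_less_trans less_imp_le less_le_trans z(2))+
  ultimately show ?thesis using z(1) H by (intro that[of z]) auto
qed

end

section \<open>Component partitions\<close>

context staircase
begin

lemma generator_rows_subset: "generator_rows i \<subseteq> D i"
  by (auto simp: generator_rows_def border_rows_def entering_def)

lemma first_hand_rows_disjoint: "first_hand_rows i \<inter> D i = {}"
  by (auto simp: first_hand_rows_def hand_rows_def entering_def)

lemma first_hand_rows_le: "first_hand_rows i \<subseteq> {..i}"
  using D_le[of _ "Suc i"] by (fastforce simp: first_hand_rows_def hand_rows_def entering_def)

lemma finite_rows: "finite (generator_rows i)" "finite (first_hand_rows i)" "finite (border_rows i)"
  using finite_subset[OF generator_rows_subset] finite_subset[OF first_hand_rows_le]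
  by (auto simp: border_rows_def)

lemma border_rows_subset: "border_rows i \<subseteq> generator_rows i"
  by (auto simp: generator_rows_def)

lemma card_generator_rows:
  assumes i: "0 < i" and proper: "D i \<noteq> {..i}"
  shows "card (generator_rows i) = card (entering D i)"
proof -
  have pos: "{a \<in> border_rows i. 0 < a} = border_rows i" by (auto simp: border_rows_def)
  have all: "{b \<in> entering D i. 0 \<le> b} = entering D i" by simp
  have c: "card (entering D i) = card (D i \<inter> {0}) + card (border_rows i)"
    using card_entering_above[OF i, of 0] unfolding pos all .
  consider (no_corner) "0 \<notin> D i" "generator_rows i = border_rows i"
    | (corner) v0 where "0 \<in> D i" "generator_rows i = insert v0 (border_rows i)" "{..v0} \<subseteq> D i"
      "\<And>a. a \<in> border_rows i \<Longrightarrow> v0 < a"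
    by (rule generator_rows_cases[OF i proper]) (erule (1) that(1), rule that(2))
  then show ?thesis
  proof cases
    case no_corner
    then show ?thesis using c by simp
  next
    case (corner v0)
    have "v0 \<notin> border_rows i" using corner(4) by auto
    then show ?thesis using c corner(1,2) finite_rows(3) by simp
  qed
qed

text \<open>By \<open>card_entering_above\<close> this compares the generator rows \<open>\<ge> v\<close> with the border rows \<open>> v\<close> and \<open>v\<close> itself. The
  additional row \<open>v0\<close> is above the whole border and above every hand row, so that it is counted only for \<open>v = v0\<close>.\<close>

lemma card_entering_above_generator_rows:
  assumes i: "0 < i" and proper: "D i \<noteq> {..i}" and v: "v \<in> generator_rows i \<union> first_hand_rows i"
  shows "card {b \<in> entering D i. v \<le> b} = card {a \<in> generator_rows i. v \<le> a}"
proof -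
  let ?A = "border_rows i"
  have A_D: "?A \<subseteq> D i" by (auto simp: border_rows_def)
  have split: "{a \<in> ?A. v \<le> a} = (?A \<inter> {v}) \<union> {a \<in> ?A. v < a}" by auto
  have cA: "card {a \<in> ?A. v \<le> a} = card (?A \<inter> {v}) + card {a \<in> ?A. v < a}"
    unfolding split using finite_rows(3) by (intro card_Un_disjoint) auto
  have c: "card {b \<in> entering D i. v \<le> b} = card (D i \<inter> {v}) + card {a \<in> ?A. v < a}"
    by (rule card_entering_above[OF i])
  consider (no_corner) "0 \<notin> D i" "generator_rows i = border_rows i"
    | (corner) v0 where "0 \<in> D i" "generator_rows i = insert v0 (border_rows i)" "{..v0} \<subseteq> D i"
      "\<And>a. a \<in> border_rows i \<Longrightarrow> v0 < a"
    by (rule generator_rows_cases[OF i proper]) (erule (1) that(1), rule that(2))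
  then show ?thesis
  proof cases
    case no_corner
    have "D i \<inter> {v} = ?A \<inter> {v}"
      using v no_corner(2) A_D first_hand_rows_disjoint by blast
    then show ?thesis using c cA no_corner(2) by simp
  next
    case (corner v0)
    show ?thesis
    proof (cases "v = v0")
      case True
      have "{a \<in> generator_rows i. v \<le> a} = insert v0 ?A" "{a \<in> ?A. v < a} = ?A"
        using corner(2,4) True by (auto intro: less_imp_le)
      moreover have "v0 \<notin> ?A" using corner(4) by auto
      moreover have "D i \<inter> {v} = {v}" using corner(3) True by auto
      ultimately show ?thesis using c finite_rows(3) by simp
    next
      case False
      have "v0 < v"
      proof (cases "v \<in> ?A")
        case True
        then show ?thesis by (rule corner(4))
      next
        case f: False
        then have "v \<notin> D i" using v False corner(2) first_hand_rows_disjoint by blast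
        then show ?thesis using corner(3) by (meson atMost_iff not_le subsetD)
      qed
      then have "{a \<in> generator_rows i. v \<le> a} = {a \<in> ?A. v \<le> a}" using corner(2) by auto
      moreover have "D i \<inter> {v} = ?A \<inter> {v}"
        using v corner(2) A_D first_hand_rows_disjoint False by blast
      ultimately show ?thesis using c cA by simp
    qed
  qed
qed

text \<open>The rows of the component in its degrees \<open>e\<close> and \<open>Suc e\<close> are obtained from the generator and hand rows
  by closing up the gaps. The element \<open>Suc e\<close> on the right stands for the entering row that is not
  among the first hand rows.\<close>

lemma staircase_defect_component:
  assumes i: "0 < i" and proper: "D i \<noteq> {..i}" and nonempty: "D i \<noteq> {}"
    and \<sigma>: "bij_betw \<sigma> (generator_rows i \<union> first_hand_rows i) {..e}"
      "\<And>u v. u \<in> generator_rows i \<union> first_hand_rows i \<Longrightarrow> v \<in> generator_rows i \<union> first_hand_rows i \<Longrightarrow> u < v \<Longrightarrow> \<sigma> u < \<sigma> v"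
  shows "staircase_defect (entering D i) (entering D (Suc i)) =
    staircase_defect (\<sigma> ` generator_rows i) ({..Suc e} - \<sigma> ` generator_rows i)"
proof (rule staircase_defect_transfer[OF finite_entering finite_entering \<sigma>])
  obtain z where z: "entering D (Suc i) = insert z (first_hand_rows i)" "z \<notin> first_hand_rows i"
    "\<And>v. v \<in> first_hand_rows i \<union> D i \<Longrightarrow> v < z"
    by (rule first_hand_rows_top[OF nonempty]) (rule that)
  show "generator_rows i \<inter> first_hand_rows i = {}"
    using generator_rows_subset first_hand_rows_disjoint by blast
  show "card (entering D (Suc i)) = Suc (card (first_hand_rows i))"
    unfolding z(1) using z(2) finite_rows(2) by simp
  show "card (entering D i) = card (generator_rows i)"
    by (rule card_generator_rows[OF i proper, symmetric])
  fix v assume v: "v \<in> generator_rows i \<union> first_hand_rows i"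
  show "card {b \<in> entering D i. v \<le> b} = card {a \<in> generator_rows i. v \<le> a}"
    by (rule card_entering_above_generator_rows[OF i proper v])
  have "v < z" using v z(3) generator_rows_subset by blast
  then have "{c \<in> entering D (Suc i). Suc v \<le> c} = insert z {h \<in> first_hand_rows i. v < h}"
    unfolding z(1) by auto
  then show "card {c \<in> entering D (Suc i). Suc v \<le> c} = Suc (card {h \<in> first_hand_rows i. v < h})"
    using z(2) finite_rows(2) by simp
next
  fix v assume v: "v \<in> entering D i" "Suc v \<notin> generator_rows i \<union> first_hand_rows i"
  obtain k where k: "i = Suc k" using i by (cases i) auto
  have vD: "v \<in> D i" "v \<notin> D (i - 1)" using v(1) by (auto simp: entering_def k)
  have "Suc v \<notin> D i"
  proof
    assume "Suc v \<in> D i"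
    then have "Suc v \<in> border_rows i" using vD by (simp add: border_rows_def)
    then show False using v(2) border_rows_subset by blast
  qed
  then show "Suc v \<in> entering D (Suc i)" using Suc_D[OF vD(1)] by (simp add: entering_def)
qed

end

context
  fixes P :: "nat list" and N i :: nat
  assumes st: "staircase (diagonal_rows P) N" and i: "0 < i"
begin

interpretation staircase "diagonal_rows P" N by (rule st)

lemma horizontal_border_eq: "horizontal_border P i = (\<lambda>b. (i - b, b)) ` border_rows i"
  using i by (auto simp: horizontal_border_def border_rows_def diagonal_rows_def image_iff)

lemma vertical_border_eq: "vertical_border P i = (\<lambda>b. (i - b, b)) ` {b \<in> entering (diagonal_rows P) i. b < i}"
proof -
  obtain k where k: "i = Suc k" using i by (cases i) auto
  have "(a, b) \<in> vertical_border P i \<longleftrightarrow> a = i - b \<and> b \<in> entering (diagonal_rows P) i \<and> b < i" for a b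
  proof (cases a)
    case 0
    then show ?thesis by (auto simp: vertical_border_def)
  next
    case (Suc a')
    have 1: "(a, b) \<in> vertical_border P i \<longleftrightarrow> a + b = i \<and> (a, b) \<in> E P \<and> (a', b) \<notin> E P"
      by (simp add: vertical_border_def Suc)
    have 2: "b \<in> entering (diagonal_rows P) i \<longleftrightarrow> (a, b) \<in> E P \<and> (a', b) \<notin> E P" if "a + b = i"
    proof -
      have "Suc k - b = a" "k - b = a'" "b \<le> k" using that Suc k by auto
      then show ?thesis by (simp add: k entering_def diagonal_rows_def)
    qed
    have 3: "a + b = i \<longleftrightarrow> a = i - b \<and> b < i" using Suc by auto
    show ?thesis using 1 2 3 by metis
  qed
  then show ?thesis by (auto simp: image_iff)
qed

lemma hand_monos_eq: "hand_monos P i = (\<lambda>b. (i - b, b)) ` hand_rows i"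
  by (auto simp: hand_monos_def hand_rows_def entering_def diagonal_rows_def image_iff E_def Suc_diff_le)

lemma V1_eq: "V1 P i = (\<lambda>b. (i - b, b)) ` generator_rows i"
proof -
  let ?m = "\<lambda>b. (i - b, b)"
  let ?Y = "{b \<in> entering (diagonal_rows P) i. b < i \<and> (\<forall>a\<in>border_rows i. b < a)}"
  have above: "vertical_border_above P i = ?m ` ?Y"
    unfolding vertical_border_above_def vertical_border_eq horizontal_border_eq by auto
  have "{\<nu> \<in> ?m ` ?Y. \<forall>\<nu>' \<in> ?m ` ?Y. snd \<nu>' \<le> snd \<nu>} = ?m ` {b \<in> ?Y. \<forall>b' \<in> ?Y. b' \<le> b}" by auto
  moreover have "(i, 0) \<in> C P \<longleftrightarrow> 0 \<notin> diagonal_rows P i" by (simp add: diagonal_rows_def E_def)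
  ultimately show ?thesis
    unfolding V1_def above horizontal_border_eq generator_rows_def by (simp add: image_Un)
qed

lemma V2_eq:
  assumes "\<delta> T (i + 1) = card (entering (diagonal_rows P) (Suc i)) - 1"
  shows "V2 T P i = (\<lambda>b. (i - b, b)) ` first_hand_rows i"
proof -
  let ?m = "\<lambda>b. (i - b, b)"
  have "{\<nu>' \<in> ?m ` hand_rows i. snd \<nu>' < h} = ?m ` {h' \<in> hand_rows i. h' < h}" for h by auto
  then have "card {\<nu>' \<in> ?m ` hand_rows i. snd \<nu>' < h} = card {h' \<in> hand_rows i. h' < h}" for h
    by (simp add: card_image inj_on_def)
  then show ?thesis
    unfolding V2_def hand_monos_eq assms first_hand_rows_def by auto
qed

end

lemma hilbert_sequence_antimono:
  assumes T: "hilbert_sequence T d j" and "d - 1 \<le> m" "m \<le> n"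
  shows "T n \<le> T m"
  using assms(3)
proof (induction n rule: dec_induct)
  case (step n)
  have "T (Suc n) \<le> T n"
  proof (cases "d \<le> n")
    case True
    then show ?thesis using T by (auto simp: hilbert_sequence_def)
  next
    case False
    then have "Suc n = d" using step(1) assms(2) by simp
    then show ?thesis using T by (auto simp: hilbert_sequence_def)
  qed
  then show ?case using step.IH by simp
qed simp

lemma inj_on_of_nat_atMost:
  assumes "CHAR('k::field) = 0 \<or> n < CHAR('k)"
  shows "inj_on (of_nat :: nat \<Rightarrow> 'k) {..n}"
proof -
  have "x = y" if "x \<le> y" "y \<le> n" "of_nat x = (of_nat y :: 'k)" for x y
  proof -
    have "of_nat (y - x) = (0 :: 'k)" using that by (simp add: of_nat_diff)
    then have "CHAR('k) dvd y - x" by (simp add: of_nat_eq_0_iff_char_dvd)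
    then show ?thesis using assms that by (auto dest: dvd_imp_le)
  qed
  then show ?thesis by (intro inj_onI) (metis atMost_iff nat_le_linear)
qed

text \<open>The generators of the ideal of the component have degrees \<open>e\<close> and \<open>Suc e\<close>, and include all monomials of degree \<open>Suc e\<close>.\<close>

lemma component_rows:
  assumes comp: "is_component TYPE('k::field) T P i Q"
  obtains s where "bij_betw s (V1 P i \<union> V2 T P i) (monos_of_degree (component_degree T i))"
    "\<And>\<mu> \<nu>. \<mu> \<in> V1 P i \<union> V2 T P i \<Longrightarrow> \<nu> \<in> V1 P i \<union> V2 T P i \<Longrightarrow> snd \<mu> < snd \<nu> \<Longrightarrow> snd (s \<mu>) < snd (s \<nu>)"
    "\<And>n. diagonal_rows Q n = (if n < component_degree T i then {}
       else if n = component_degree T i then snd ` s ` V1 P i else {..n})"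
proof -
  let ?e = "component_degree T i"
  obtain s where Q: "is_partition Q" and s: "bij_betw s (V1 P i \<union> V2 T P i) (monos_of_degree ?e)"
    "\<And>\<mu> \<nu>. \<mu> \<in> V1 P i \<union> V2 T P i \<Longrightarrow> \<nu> \<in> V1 P i \<union> V2 T P i \<Longrightarrow> snd \<mu> < snd \<nu> \<Longrightarrow> snd (s \<mu>) < snd (s \<nu>)"
    and E: "(E_ideal Q :: 'k bipoly set) = ideal.span (monomial ` (s ` V1 P i \<union> monos_of_degree (?e + 1)))"
    using comp unfolding is_component_def by blast
  let ?S = "s ` V1 P i \<union> monos_of_degree (?e + 1)"
  have memE: "\<mu> \<in> E Q \<longleftrightarrow> (\<exists>\<nu>\<in>?S. fst \<nu> \<le> fst \<mu> \<and> snd \<nu> \<le> snd \<mu>)" for \<mu>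
    using E monomial_in_span_upward_closed[OF upward_closed_E[OF Q], of \<mu>, where 'k='k]
      monomial_in_span_iff[of \<mu> ?S, where 'k='k] unfolding E_ideal_def by simp
  have s_deg: "mdeg (s \<mu>) = ?e" if "\<mu> \<in> V1 P i" for \<mu>
    using that bij_betw_apply[OF s(1), of \<mu>] by (auto simp: monos_of_degree_def)
  have deg_le: "mdeg \<nu> \<le> mdeg \<mu>" if "fst \<nu> \<le> fst \<mu>" "snd \<nu> \<le> snd \<mu>" for \<mu> \<nu> :: mono
    using that by (simp add: mdeg_def)
  have low: "\<mu> \<notin> E Q" if "mdeg \<mu> < ?e" for \<mu>
    using that s_deg deg_le unfolding memE by (fastforce simp: monos_of_degree_def)
  have mid: "\<mu> \<in> E Q \<longleftrightarrow> \<mu> \<in> s ` V1 P i" if \<mu>: "mdeg \<mu> = ?e" for \<mu>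
  proof
    assume "\<mu> \<in> E Q"
    then obtain \<nu> where \<nu>: "\<nu> \<in> ?S" "fst \<nu> \<le> fst \<mu>" "snd \<nu> \<le> snd \<mu>" unfolding memE by blast
    then have "\<nu> \<in> s ` V1 P i" using deg_le[OF \<nu>(2,3)] \<mu> by (auto simp: monos_of_degree_def)
    moreover from this have "mdeg \<nu> = ?e" using s_deg by blast
    then have "\<nu> = \<mu>" using \<nu>(2,3) \<mu> by (auto simp: mdeg_def prod_eq_iff)
    ultimately show "\<mu> \<in> s ` V1 P i" by simp
  next
    assume "\<mu> \<in> s ` V1 P i"
    then show "\<mu> \<in> E Q" unfolding memE by blast
  qed
  have high: "\<mu> \<in> E Q" if \<mu>: "?e < mdeg \<mu>" for \<mu>
  proof -
    let ?\<nu> = "(?e + 1 - min (snd \<mu>) (?e + 1), min (snd \<mu>) (?e + 1))"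
    have "?\<nu> \<in> ?S" by (auto simp: monos_of_degree_def mdeg_def)
    moreover have "fst ?\<nu> \<le> fst \<mu>" "snd ?\<nu> \<le> snd \<mu>" using \<mu> by (auto simp: mdeg_def)
    ultimately show ?thesis unfolding memE by blast
  qed
  have "diagonal_rows Q n = (if n < ?e then {} else if n = ?e then snd ` s ` V1 P i else {..n})" for n
  proof -
    consider "n < ?e" | "n = ?e" | "?e < n" by linarith
    then show ?thesis
    proof cases
      case 1
      then show ?thesis using low by (auto simp: diagonal_rows_def mdeg_def)
    next
      case 2
      have image: "b \<le> n \<and> (n - b, b) \<in> s ` V1 P i \<longleftrightarrow> b \<in> snd ` s ` V1 P i" for b
      proof
        assume "b \<le> n \<and> (n - b, b) \<in> s ` V1 P i"
        then have "snd (n - b, b) \<in> snd ` s ` V1 P i" by (intro imageI) simp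
        then show "b \<in> snd ` s ` V1 P i" by simp
      next
        assume "b \<in> snd ` s ` V1 P i"
        then obtain \<mu> where \<mu>: "\<mu> \<in> V1 P i" "b = snd (s \<mu>)" by auto
        then have "b \<le> n" "s \<mu> = (n - b, b)" using s_deg[OF \<mu>(1)] 2 by (auto simp: mdeg_def prod_eq_iff)
        then show "b \<le> n \<and> (n - b, b) \<in> s ` V1 P i" using \<mu>(1) by force
      qed
      have E_iff: "(n - b, b) \<in> E Q \<longleftrightarrow> (n - b, b) \<in> s ` V1 P i" if "b \<le> n" for b
        using mid[of "(n - b, b)"] that 2 by (simp add: mdeg_def)
      have "b \<in> diagonal_rows Q n \<longleftrightarrow> b \<in> snd ` s ` V1 P i" for b
        unfolding diagonal_rows_def mem_Collect_eq using image[of b] E_iff[of b] by argo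
      then have "diagonal_rows Q n = snd ` s ` V1 P i" by (intro set_eqI)
      then show ?thesis using 2 by simp
    next
      case 3
      then show ?thesis using high by (auto simp: diagonal_rows_def mdeg_def)
    qed
  qed
  then show ?thesis using that[OF s] by blast
qed

theorem theorem5p18:
  fixes T :: "nat \<Rightarrow> nat" and d j :: nat and P :: "nat list" and P_comp :: "nat \<Rightarrow> nat list"
  assumes field_char:
      "CHAR('k::field) = 0 \<or> (infinite (UNIV :: 'k set) \<and> j < CHAR('k))"
    and T: "hilbert_sequence T d j"
    and P: "is_partition P" "diagonal_lengths TYPE('k) P = T"
    and components: "\<And>i. i \<in> {d..j} \<Longrightarrow> is_component TYPE('k) T P i (P_comp i)"
  shows "special TYPE('k) T P \<longleftrightarrow>
         (\<exists>i \<in> {d..j}. special TYPE('k) (component_T T i) (P_comp i))"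
proof -
  have inf: "infinite (UNIV :: 'k set)"
    using field_char finite_imp_CHAR_pos[where 'a='k] by auto
  have inj: "inj_on (of_nat :: nat \<Rightarrow> 'k) {..n}" if "n \<le> j" for n
    using field_char that by (intro inj_on_of_nat_atMost) auto
  let ?D = "diagonal_rows P"
  let ?defect = "\<lambda>n. staircase_defect (entering ?D n) (entering ?D (Suc n))"
  let ?diff = "\<lambda>n. card (entering ?D (Suc n)) - card (entering ?D n)"
  obtain N where N: "staircase ?D N" by (rule staircase_diagonal_rows[OF P(1)])
  interpret staircase ?D N by (rule N)
  have d: "0 < d" and T_low: "\<And>n. n < d \<Longrightarrow> T n = Suc n" and T_d: "T d \<le> d"
    and T_j: "0 < T j" and T_high: "\<And>n. j < n \<Longrightarrow> T n = 0"
    using T by (auto simp: hilbert_sequence_def)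
  have T_le: "T n \<le> d" if "d - 1 \<le> n" for n
    using hilbert_sequence_antimono[OF T order_refl that] T_low[of "d - 1"] d by simp
  have T_D: "T n = Suc n - card (?D n)" for n using diagonal_lengths_eq[OF P(1), where 'k='k] P(2) by auto
  have card_le: "card (?D n) \<le> Suc n" for n using card_mono[of "{..n}" "?D n"] D_le by auto
  have card_D: "card (?D n) = Suc n - T n" for n using T_D[of n] card_le[of n] by simp
  have special_P: "special TYPE('k) T P \<longleftrightarrow> (\<exists>n. ?defect n \<noteq> ?diff n)"
    by (rule special_iff_defect[OF inf P]) (use inj T_high in \<open>metis less_irrefl not_le\<close>)
  \<comment> \<open>Below \<open>d\<close> no rows occur; for \<open>n > j\<close> all of them do in degree \<open>n\<close>, so that in degree
    \<open>Suc n\<close> only the row \<open>Suc n\<close> enters.\<close>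
  have trivial: "?defect n = ?diff n" if "n \<notin> {d..j}" for n
  proof (cases "n < d")
    case True
    then have "?D n = {}" using card_D[of n] T_low[of n] by simp
    then have "entering ?D n = {}" by (simp add: entering_def)
    then show ?thesis using staircase_defect_empty[OF finite_entering] by simp
  next
    case False
    then have n: "j < n" using that by auto
    have "?D n = {..n}"
      using card_D[of n] T_high[OF n] D_le by (intro card_subset_eq) auto
    then have "entering ?D (Suc n) \<subseteq> {Suc n}"
      using D_le[of _ "Suc n"] by (auto simp: entering_def le_Suc_eq)
    moreover have "n \<in> entering ?D n"
      using \<open>?D n = {..n}\<close> D_le[of n "n - 1"] by (cases n) (auto simp: entering_def)
    ultimately have "?defect n = 0"
      by (intro staircase_defect_eq_0[OF finite_entering])
    then show ?thesis using card_diff_le_staircase_defect[OF finite_entering[of "Suc n"], of "entering ?D n"] by simp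
  qed
  have comp: "special TYPE('k) (component_T T i) (P_comp i) \<longleftrightarrow> ?defect i \<noteq> ?diff i" if i: "i \<in> {d..j}" for i
  proof -
    let ?Q = "P_comp i" and ?e = "component_degree T i"
    have i0: "0 < i" using i d by auto
    have Ti: "T i \<le> d" "T (i - 1) \<le> d" "T i \<le> T (i - 1)" "T (Suc i) \<le> T i" "T j \<le> T i"
      using i T_le[of i] T_le[of "i - 1"] hilbert_sequence_antimono[OF T, of "i - 1" i]
        hilbert_sequence_antimono[OF T, of i "Suc i"] hilbert_sequence_antimono[OF T, of i j] by auto
    have cB: "card (entering ?D i) = Suc (\<delta> T i)"
      using i0 Ti i card_D[of i] card_D[of "i - 1"] by (cases i) (auto simp: card_entering \<delta>_def)
    have cF: "card (entering ?D (Suc i)) = Suc (\<delta> T (i + 1))"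
      using Ti i card_D[of i] card_D[of "Suc i"] by (auto simp: card_entering \<delta>_def)
    have proper: "?D i \<noteq> {..i}" and nonempty: "?D i \<noteq> {}"
      using card_D[of i] Ti T_j i by auto
    have v1: "V1 P i = (\<lambda>b. (i - b, b)) ` generator_rows i" by (rule V1_eq[OF N i0])
    have v2: "V2 T P i = (\<lambda>b. (i - b, b)) ` first_hand_rows i" by (rule V2_eq[OF N i0]) (simp add: cF)
    obtain s where s: "bij_betw s (V1 P i \<union> V2 T P i) (monos_of_degree ?e)"
      "\<And>\<mu> \<nu>. \<mu> \<in> V1 P i \<union> V2 T P i \<Longrightarrow> \<nu> \<in> V1 P i \<union> V2 T P i \<Longrightarrow> snd \<mu> < snd \<nu> \<Longrightarrow> snd (s \<mu>) < snd (s \<nu>)"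
      "\<And>n. diagonal_rows ?Q n = (if n < ?e then {} else if n = ?e then snd ` s ` V1 P i else {..n})"
      by (rule component_rows[OF components[OF i]]) (rule that)
    let ?K = "generator_rows i \<union> first_hand_rows i"
    define \<sigma> where "\<sigma> b = snd (s (i - b, b))" for b
    have img: "V1 P i \<union> V2 T P i = (\<lambda>b. (i - b, b)) ` ?K" unfolding v1 v2 by auto
    have "bij_betw (\<lambda>b. (i - b, b)) ?K (V1 P i \<union> V2 T P i)"
      unfolding img by (intro bij_betw_imageI) (auto simp: inj_on_def)
    moreover have "bij_betw snd (monos_of_degree ?e) {..?e}"
    proof (rule bij_betwI[of _ _ _ "\<lambda>b. (?e - b, b)"])
    qed (auto simp: monos_of_degree_def mdeg_def)
    ultimately have "bij_betw (snd \<circ> (s \<circ> (\<lambda>b. (i - b, b)))) ?K {..?e}"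
      using s(1) by (intro bij_betw_trans)
    then have \<sigma>_bij: "bij_betw \<sigma> ?K {..?e}" by (simp add: \<sigma>_def[abs_def] comp_def)
    have \<sigma>_mono: "\<sigma> u < \<sigma> v" if "u \<in> ?K" "v \<in> ?K" "u < v" for u v
      unfolding \<sigma>_def using that img by (intro s(2)) auto
    have rows_e: "snd ` s ` V1 P i = \<sigma> ` generator_rows i" unfolding v1 by (auto simp: \<sigma>_def image_iff)
    have rows: "diagonal_rows ?Q n = (if n < ?e then {} else if n = ?e then \<sigma> ` generator_rows i else {..n})" for n
      unfolding s(3) rows_e ..
    have K_le: "\<sigma> ` generator_rows i \<subseteq> {..?e}" using \<sigma>_bij by (auto dest: bij_betw_apply)
    have card_K: "card (\<sigma> ` generator_rows i) = Suc (\<delta> T i)"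
    proof -
      have "inj_on \<sigma> (generator_rows i)" using bij_betw_imp_inj_on[OF \<sigma>_bij] by (rule inj_on_subset) auto
      then show ?thesis using card_generator_rows[OF i0 proper] cB by (simp add: card_image)
    qed
    have Q: "is_partition ?Q" using components[OF i] by (simp add: is_component_def)
    have Q_T: "diagonal_lengths TYPE('k) ?Q = component_T T i"
    proof
      fix n show "diagonal_lengths TYPE('k) ?Q n = component_T T i n"
        unfolding diagonal_lengths_eq[OF Q] rows component_T_def
        using card_K by (auto simp: component_degree_def)
    qed
    have "?e \<le> j" using Ti i by (auto simp: component_degree_def \<delta>_def)
    then have "inj_on (of_nat :: nat \<Rightarrow> 'k) {..n}" if "0 < component_T T i n" for n
      using that inj by (auto simp: component_T_def split: if_splits)
    then have special_Q: "special TYPE('k) (component_T T i) ?Q \<longleftrightarrow>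
      (\<exists>n. staircase_defect (entering (diagonal_rows ?Q) n) (entering (diagonal_rows ?Q) (Suc n)) \<noteq>
        card (entering (diagonal_rows ?Q) (Suc n)) - card (entering (diagonal_rows ?Q) n))"
      by (intro special_iff_defect[OF inf Q Q_T])
    have ent: "entering (diagonal_rows ?Q) n = (if n < ?e then {} else if n = ?e then \<sigma> ` generator_rows i
       else if n = Suc ?e then {..n} - \<sigma> ` generator_rows i else {n})" for n
      by (cases n) (auto simp: entering_def rows)
    have "(\<exists>n. staircase_defect (entering (diagonal_rows ?Q) n) (entering (diagonal_rows ?Q) (Suc n)) \<noteq>
        card (entering (diagonal_rows ?Q) (Suc n)) - card (entering (diagonal_rows ?Q) n)) \<longleftrightarrow>
      staircase_defect (\<sigma> ` generator_rows i) ({..Suc ?e} - \<sigma> ` generator_rows i) \<noteq>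
        card ({..Suc ?e} - \<sigma> ` generator_rows i) - card (\<sigma> ` generator_rows i)" (is "(\<exists>n. ?f n \<noteq> ?g n) \<longleftrightarrow> _")
    proof -
      have "?f n = ?g n" if "n \<noteq> ?e" for n
      proof (cases "n < ?e")
        case True
        have "finite (entering (diagonal_rows ?Q) (Suc n))" unfolding ent using finite_rows by auto
        moreover have "entering (diagonal_rows ?Q) n = {}" unfolding ent using True by simp
        ultimately show ?thesis by (simp add: staircase_defect_empty)
      next
        case False
        then have n: "?e < n" using that by simp
        have fin: "finite (entering (diagonal_rows ?Q) n)" unfolding ent using finite_rows by auto
        have "n \<in> entering (diagonal_rows ?Q) n" unfolding ent using n K_le by auto
        moreover have F: "entering (diagonal_rows ?Q) (Suc n) = {Suc n}" unfolding ent using n by simp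
        ultimately have "?f n = 0" using fin by (intro staircase_defect_eq_0[where n=n]) auto
        then show ?thesis
          using card_diff_le_staircase_defect[of "entering (diagonal_rows ?Q) (Suc n)" "entering (diagonal_rows ?Q) n"] F by simp
      qed
      moreover have "?f ?e = staircase_defect (\<sigma> ` generator_rows i) ({..Suc ?e} - \<sigma> ` generator_rows i)"
        "?g ?e = card ({..Suc ?e} - \<sigma> ` generator_rows i) - card (\<sigma> ` generator_rows i)"
        by (simp_all add: ent)
      ultimately show ?thesis by metis
    qed
    moreover have "?defect i = staircase_defect (\<sigma> ` generator_rows i) ({..Suc ?e} - \<sigma> ` generator_rows i)"
      by (rule staircase_defect_component[OF i0 proper nonempty \<sigma>_bij \<sigma>_mono])
    moreover have "card ({..Suc ?e} - \<sigma> ` generator_rows i) = card (entering ?D (Suc i))"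
      "card (\<sigma> ` generator_rows i) = card (entering ?D i)"
    proof -
      have "card ({..Suc ?e} - \<sigma> ` generator_rows i) = Suc (Suc ?e) - Suc (\<delta> T i)"
        using K_le card_K finite_rows by (subst card_Diff_subset) auto
      then show "card ({..Suc ?e} - \<sigma> ` generator_rows i) = card (entering ?D (Suc i))"
        using cF by (simp add: component_degree_def)
      show "card (\<sigma> ` generator_rows i) = card (entering ?D i)" using card_K cB by simp
    qed
    ultimately show ?thesis using special_Q by simp
  qed
  show ?thesis unfolding special_P using trivial comp by blast
qed

end
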